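(* Let $n\ge 2$ and let $\Omega\subset\mathbb{Z}^n$ be a subgroup of rank $m\ge 2$ satisfying: for every $(\alpha,\beta)\in\mathbb{Z}^2\setminus\{0\}$ and all pairwise distinct $i,j,k,l\in\{0,\ldots,n\}$, with $v=\alpha(e_i-e_j)+\beta(e_k-e_l)$, we have $\Omega\not\subset(v\mathbb{Z})^\perp$. Let $\epsilon>0$. Suppose $a\in\Omega$ and $p$ is a prime such that $\rho_p(a;\Omega)$ is sufficiently large in terms of $\Omega$. Then $\Delta_p(a)\neq 0$ and \[ \frac{1}{p-1}\log\Delta_p(a) = m(\Omega) + O\!\left(\rho_p(a;\Omega)^{-\frac{1}{4n}+\epsilon}\right) \] as $\rho_p(a;\Omega)\to\infty$, where the implied constant depends only on $\Omega$ and $\epsilon$.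
   Context: $e_1,\ldots,e_n$ is the standard basis of $\mathbb{R}^n$ and $e_0=0$; $\langle\cdot,\cdot\rangle$ is the standard scalar product and $|\cdot|$ the supremum norm on $\mathbb{R}^n$. For $\Lambda\subset\mathbb{Z}^n$, $\Lambda^\perp=\{a\in\mathbb{Z}^n:\langle a,\lambda\rangle=0\ \forall\lambda\in\Lambda\}$. For $a=(a_1,\ldots,a_n)\in\mathbb{Z}^n$ and an integer $p\ge2$, $\Delta_p(a)=\prod_{t=1}^{p-1}|1+\zeta^{ta_1}+\cdots+\zeta^{ta_n}|$ with $\zeta=e^{2\pi\sqrt{-1}/p}$. For a prime $p$, $\rho_p(a;\Omega)=\inf\{|\omega|:\omega\in\Omega\setminus\{0\},\ \langle\omega,a\rangle\equiv0\pmod p\}$. For a non-zero Laurent polynomial $P$ in $m$ variables, $m(P)=\int_{[0,1]^m}\log|P(e^{2\pi\sqrt{-1}x_1},\ldots,e^{2\pi\sqrt{-1}x_m})|\,dx$. For $A=(a_{ij})\in\mathbb{Z}^{m\times n}$ whose rows form a basis of $\Omega$, $P_A=1+\sum_{j=1}^n X_1^{a_{1j}}\cdots X_m^{a_{mj}}$, and $m(\Omega)=m(P_A)$ (independent of the basis). *)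

theory Defs
  imports "HOL-Analysis.Analysis" "HOL-Library.Poly_Mapping"
begin

text \<open>
  \<open>\<int>\<^sup>n\<close> is the type \<open>int ^ 'n\<close> with \<open>n = CARD('n)\<close>. Its subgroups are its \<open>\<int>\<close>-submodules, so
  the subgroup, span and linear independence notions below are those of the library's
  locale \<open>module\<close>, with scalars in \<open>\<int>\<close>.
\<close>

interpretation int_vec: module "(*s) :: int \<Rightarrow> int ^ 'n \<Rightarrow> int ^ 'n"
  by unfold_locales (vector algebra_simps)+

text \<open>The index set \<open>{0,\<dots>,n}\<close> is \<open>'n option\<close>, where \<open>None\<close> plays the role of \<open>0\<close>.\<close>

fun std_vec :: "'n option \<Rightarrow> int ^ 'n" where
  "std_vec None = 0"
| "std_vec (Some i) = axis i 1"

definition orth :: "(int ^ 'n) set \<Rightarrow> (int ^ 'n) set" where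
  "orth L = {a. \<forall>l\<in>L. scalar_product a l = 0}"

definition sup_norm :: "int ^ 'n \<Rightarrow> real" where
  "sup_norm v = infnorm (\<chi> i. real_of_int (v $ i))"

definition Delta :: "nat \<Rightarrow> int ^ 'n \<Rightarrow> real" where
  "Delta p a =
     (let \<zeta> = exp (2 * of_real pi * \<i> / of_nat p) :: complex
      in \<Prod>t\<in>{1..<p}. cmod (1 + (\<Sum>j\<in>UNIV. \<zeta> powi (int t * a $ j))))"

definition rho :: "nat \<Rightarrow> int ^ 'n \<Rightarrow> (int ^ 'n) set \<Rightarrow> real" where
  "rho p a \<Omega> = Inf {sup_norm \<omega> |\<omega>. \<omega> \<in> \<Omega> - {0} \<and> int p dvd scalar_product \<omega> a}"

text \<open>
  The rank of a subgroup is the maximal number of \<open>\<int>\<close>-linearly independent elements; for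
  subgroups of \<open>\<int>\<^sup>n\<close> this is at most \<open>n\<close>, so the maximum exists.
\<close>

definition subgroup_rank :: "(int ^ 'n) set \<Rightarrow> nat" where
  "subgroup_rank \<Omega> = Max {card B |B. B \<subseteq> \<Omega> \<and> finite B \<and> int_vec.independent B}"

text \<open>\<open>A i $ j\<close> is the entry in row \<open>i\<close> and column \<open>j\<close>, the rows being indexed by \<open>{..<m}\<close>.\<close>

definition rows_form_basis :: "nat \<Rightarrow> (nat \<Rightarrow> int ^ 'n) \<Rightarrow> (int ^ 'n) set \<Rightarrow> bool" where
  "rows_form_basis m A \<Omega> \<longleftrightarrow>
     inj_on A {..<m} \<and> int_vec.independent (A ` {..<m}) \<and> int_vec.span (A ` {..<m}) = \<Omega>"

text \<open>
  Laurent polynomials are finitely supported maps from exponent vectors (themselves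
  finitely supported, with entries in \<open>\<int>\<close>) to coefficients; the variables are
  \<open>X\<^sub>i\<close> for \<open>i :: nat\<close>, counted from \<open>0\<close>.
\<close>

type_synonym laurent_poly = "(nat \<Rightarrow>\<^sub>0 int) \<Rightarrow>\<^sub>0 complex"

definition laurent_eval :: "laurent_poly \<Rightarrow> (nat \<Rightarrow> complex) \<Rightarrow> complex" where
  "laurent_eval P z =
     (\<Sum>e\<in>Poly_Mapping.keys P. Poly_Mapping.lookup P e *
        (\<Prod>i\<in>Poly_Mapping.keys e. z i powi Poly_Mapping.lookup e i))"

text \<open>
  For \<open>P \<noteq> 0\<close> in the variables \<open>X\<^sub>i\<close>, \<open>i < m\<close>, the integrand is integrable and the zeros of \<open>P\<close>,
  where \<open>ln 0 = 0\<close> in HOL, form a null set.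
\<close>

definition mahler_measure :: "nat \<Rightarrow> laurent_poly \<Rightarrow> real" where
  "mahler_measure m P =
     (LINT x:({..<m} \<rightarrow>\<^sub>E {0..1})|(\<Pi>\<^sub>M i\<in>{..<m}. lborel).
        ln (cmod (laurent_eval P (\<lambda>i. exp (2 * of_real pi * \<i> * of_real (x i))))))"

definition lattice_poly :: "nat \<Rightarrow> (nat \<Rightarrow> int ^ 'n) \<Rightarrow> laurent_poly" where
  "lattice_poly m A =
     1 + (\<Sum>j\<in>UNIV. Poly_Mapping.single (\<Sum>i<m. Poly_Mapping.single i (A i $ j)) 1)"

text \<open>
  The value does not depend on the chosen basis: a change of basis acts on the torus by an
  automorphism, which preserves Haar measure.
\<close>

definition lattice_mahler :: "(int ^ 'n) set \<Rightarrow> real" where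
  "lattice_mahler \<Omega> =
     (let m = subgroup_rank \<Omega>
      in mahler_measure m (lattice_poly m (SOME A. rows_form_basis m A \<Omega>)))"

end

theory Submission
  imports Defs "HOL-Number_Theory.Cong"
begin

text \<open>
  Write \<open>P\<close> for the Laurent polynomial of \<open>\<Omega>\<close>. Under the hypothesis on \<open>\<Omega>\<close> every monomial of degree
  at least \<open>C k\<close>, measured in a suitable plane, can be shortened modulo the \<open>k\<close>-th power of \<open>P\<close> or of its
  conjugate. The pigeonhole principle then yields a non-zero Laurent polynomial \<open>R\<close> with bounded integer
  coefficients and exponents in a box of side \<open>k\<^sup>2\<close> such that \<open>|R| \<le> C\<^bsup>k\<^sup>2\<^esup> |P|\<^sup>k\<close> on the torus. The values of
  \<open>R\<close> at the \<open>p\<close>-torsion points of the orbit of \<open>a\<close> have a product of modulus at least \<open>1\<close>, because it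
  is the norm of a non-zero algebraic integer. Hence the values of \<open>P\<close> do not vanish, and the loss in
  replacing \<open>ln |P|\<^sup>2\<close> by \<open>ln (|P|\<^sup>2 + q)\<close> is at most \<open>k\<close> times the average of \<open>q / (|P|\<^sup>2 + q)\<close>, up to
  \<open>O(ln k / k)\<close>. The smoothed functions have Chebyshev expansions in \<open>|P|\<^sup>2\<close>; their partial sums of degree
  below a multiple of \<open>\<rho>\<close> have the same average over the orbit as over the torus. On the torus, a sublevel
  estimate of van der Corput type bounds \<open>q / (|P|\<^sup>2 + q)\<close> on average by a power of \<open>q\<close>. The exponent
  results from \<open>q\<close> of the order of \<open>\<rho>\<^bsup>-3/2\<^esup>\<close> and \<open>k\<close> of the order of \<open>\<rho>\<^bsup>9/(32n)\<^esup>\<close>.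
\<close>

section \<open>Integer polynomials at roots of unity\<close>

text \<open>The obstacle is the singularity of the logarithm at the zeros of \<open>P\<close>.
  Equidistribution of the orbit controls only smoothed functions, and a norm of modulus at least 1
  bounds the sum of \<open>ln |P|\<close> below by 0, which is far from the expected mean. The
  auxiliary \<open>R\<close> closes this gap: each \<open>ln |R|\<close> is \<open>O(ln k)\<close>
  from above, their sum over the orbit is at least 0, and
  \<open>ln |R| \<le> O(k^2) + k ln |P|\<close>. Hence the sum of \<open>- ln |P|\<close> over the
  points where \<open>|P|\<close> is small is at most \<open>O(k)\<close> times their number plus
  \<open>O(p ln k / k)\<close>. The box has side \<open>k^2\<close> because the shortened exponents
  fill a strip of width \<open>O(k)\<close> in two directions and \<open>O(k^2)\<close> in the
  others: about \<open>k^(2m-2)\<close> remainders against \<open>k^(2m)\<close> unknowns. About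
  \<open>k\<close> rounds of shortening produce coefficients of size \<open>C^(k^2)\<close>, and the
  ratio \<open>k^2\<close> of the two counts pays for exactly that. The hypothesis on the subgroup
  says that differences of exponents over disjoint pairs of indices are never parallel, so a linear
  form cannot nearly tie both at its maximum and at its minimum.\<close>

lemma eisenstein_step:
  fixes F G :: "int poly" and p :: int
  assumes p: "prime p" and F0: "p dvd coeff F 0" and G0: "\<not> p dvd coeff G 0"
    and lead: "\<not> p dvd lead_coeff F" and dvd: "\<And>i. i \<le> degree F \<Longrightarrow> p dvd coeff (F * G) i"
  shows False
proof -
  \<comment> \<open>Modulo \<open>p\<close> the factor \<open>F\<close> begins at index
    \<open>i\<close>, so that coefficient \<open>i\<close> of \<open>F * G\<close> is congruent to
    \<open>coeff F i * coeff G 0\<close>.\<close>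
  define i where "i = (LEAST i. \<not> p dvd coeff F i)"
  have i: "\<not> p dvd coeff F i" unfolding i_def by (rule LeastI) (fact lead)
  have less: "p dvd coeff F j" if "j < i" for j
    using not_less_Least[of j "\<lambda>i. \<not> p dvd coeff F i"] that unfolding i_def by blast
  have "i \<le> degree F" unfolding i_def by (rule Least_le) (fact lead)
  then have "p dvd coeff (F * G) i" by (rule dvd)
  moreover have "coeff (F * G) i = coeff F i * coeff G 0 + (\<Sum>j<i. coeff F j * coeff G (i - j))"
    by (simp add: coeff_mult lessThan_Suc_atMost[symmetric])
  moreover have "p dvd (\<Sum>j<i. coeff F j * coeff G (i - j))"
    by (rule dvd_sum) (simp add: less)
  ultimately have "p dvd coeff F i * coeff G 0"
    by (simp add: dvd_add_left_iff)
  with i G0 p show False by (simp add: prime_dvd_mult_iff)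
qed

definition prime_cyclotomic :: "nat \<Rightarrow> int poly" where
  "prime_cyclotomic p = (\<Sum>i<p. monom 1 i)"

lemma coeff_prime_cyclotomic: "coeff (prime_cyclotomic p) i = (if i < p then 1 else 0)"
  by (simp add: prime_cyclotomic_def coeff_sum)

lemma degree_prime_cyclotomic:
  assumes "p > 0" shows "degree (prime_cyclotomic p) = p - 1"
proof (rule antisym)
  show "degree (prime_cyclotomic p) \<le> p - 1"
    by (rule degree_le) (auto simp: coeff_prime_cyclotomic)
  show "p - 1 \<le> degree (prime_cyclotomic p)"
    by (rule le_degree) (use assms in \<open>simp add: coeff_prime_cyclotomic\<close>)
qed

lemma prime_cyclotomic_mult: "[:-1, 1:] * prime_cyclotomic p = [:0, 1:] ^ p - 1"
  using power_diff_1_eq[of "[:0, 1:] :: int poly" p]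
  by (simp add: prime_cyclotomic_def monom_altdef one_pCons)

lemma pcompose_power: "pcompose (f ^ n) g = pcompose f g ^ n" for f g :: "'a :: comm_ring_1 poly"
  by (induction n) (simp_all add: pcompose_mult pcompose_1)

text \<open>At \<open>X + 1\<close> the quotient \<open>(X^p - 1) / (X - 1)\<close> becomes
  \<open>((X + 1)^p - 1) / X\<close>. In this form all coefficients but the leading one are
  divisible by \<open>p\<close>, as Eisenstein's criterion requires.\<close>

lemma coeff_prime_cyclotomic_shift:
  "coeff (pcompose (prime_cyclotomic p) [:1, 1:]) i = int (p choose (Suc i))"
proof -
  have "pcompose ([:-1, 1:] * prime_cyclotomic p) [:1, 1:] = [:1, 1:] ^ p - 1"
    unfolding prime_cyclotomic_mult by (simp add: pcompose_diff pcompose_power pcompose_1 pcompose_pCons)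
  then have eq: "[:0, 1:] * pcompose (prime_cyclotomic p) [:1, 1:] = [:1, 1:] ^ p - 1"
    unfolding pcompose_mult by (simp add: pcompose_pCons)
  have "coeff ([:0, 1:] * pcompose (prime_cyclotomic p) [:1, 1:]) (Suc i) = coeff (pcompose (prime_cyclotomic p) [:1, 1:]) i"
    by simp
  moreover have "coeff ([:1, 1:] ^ p - 1 :: int poly) (Suc i) = int (p choose (Suc i))"
  proof (cases "Suc i \<le> p")
    case False
    then have "coeff ([:1, 1:] ^ p :: int poly) (Suc i) = 0"
      by (intro coeff_eq_0) (simp add: degree_linear_power)
    with False show ?thesis by simp
  qed (simp add: coeff_linear_poly_power)
  ultimately show ?thesis unfolding eq by simp
qed

definition ceval :: "int poly \<Rightarrow> complex \<Rightarrow> complex" where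
  "ceval f z = poly (map_poly of_int f) z"

lemma ceval_0 [simp]: "ceval 0 z = 0"
  and ceval_pCons [simp]: "ceval (pCons a f) z = of_int a + z * ceval f z"
  by (simp_all add: ceval_def map_poly_pCons)

lemma ceval_1 [simp]: "ceval 1 z = 1"
  by (simp add: one_pCons)

lemma ceval_add [simp]: "ceval (f + g) z = ceval f z + ceval g z"
proof (induction f arbitrary: g)
  case (pCons a f)
  then show ?case by (cases g) (simp_all add: algebra_simps)
qed simp

lemma ceval_smult [simp]: "ceval (smult c f) z = of_int c * ceval f z"
  by (induction f) (simp_all add: algebra_simps)

lemma ceval_mult [simp]: "ceval (f * g) z = ceval f z * ceval g z"
  by (induction f) (simp_all add: algebra_simps)

lemma ceval_power [simp]: "ceval (f ^ n) z = ceval f z ^ n"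
  by (induction n) simp_all

lemma ceval_sum: "ceval (sum f A) z = (\<Sum>i\<in>A. ceval (f i) z)"
  by (induction A rule: infinite_finite_induct) simp_all

lemma ceval_prod: "ceval (prod f A) z = (\<Prod>i\<in>A. ceval (f i) z)"
  by (induction A rule: infinite_finite_induct) simp_all

lemma ceval_pcompose: "ceval (pcompose f g) z = ceval f (ceval g z)"
  by (induction f) (simp_all add: pcompose_pCons)

lemma ceval_monom [simp]: "ceval (monom c n) z = of_int c * z ^ n"
  by (simp add: monom_altdef)

lemma ceval_prime_cyclotomic:
  assumes "\<xi> ^ p = 1" "\<xi> \<noteq> 1"
  shows "ceval (prime_cyclotomic p) \<xi> = 0"
  using assms by (simp add: prime_cyclotomic_def ceval_sum geometric_sum)

text \<open>This is the irreducibility of the \<open>p\<close>-th cyclotomic polynomial. A primitive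
  polynomial \<open>f\<close> of least degree that vanishes at \<open>\<xi>\<close> divides it over
  the integers by Gauss's lemma, and Eisenstein's criterion at \<open>X + 1\<close> excludes a
  proper factor.\<close>

lemma int_poly_root_of_unity_zero:
  fixes r :: "int poly" and \<xi> :: complex
  assumes p: "prime p" and \<xi>: "\<xi> ^ p = 1" "\<xi> \<noteq> 1"
    and deg: "degree r < p - 1" and root: "ceval r \<xi> = 0"
  shows "r = 0"
proof (rule ccontr)
  assume "r \<noteq> 0"
  have p1: "p > 1" using p by (rule prime_gt_1_nat)
  define Q where "Q = (\<lambda>r::int poly. r \<noteq> 0 \<and> degree r < p - 1 \<and> ceval r \<xi> = 0)"
  have "\<exists>r. Q r \<and> (\<forall>r'. Q r' \<longrightarrow> degree r \<le> degree r')"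
    by (rule ex_has_least_nat[of Q r]) (use \<open>r \<noteq> 0\<close> deg root in \<open>auto simp: Q_def\<close>)
  then obtain r0 where r0: "Q r0" "\<And>r'. Q r' \<Longrightarrow> degree r0 \<le> degree r'" by auto
  define f where "f = primitive_part r0"
  have f: "Q f" "content f = 1" "degree f = degree r0"
  proof -
    have "of_int (content r0) * ceval f \<xi> = ceval (smult (content r0) (primitive_part r0)) \<xi>"
      by (simp only: f_def ceval_smult)
    also have "\<dots> = 0" using r0(1) by (simp only: content_times_primitive_part Q_def)
    finally have "of_int (content r0) * ceval f \<xi> = 0" .
    moreover have "content r0 \<noteq> 0" using r0(1) by (simp add: Q_def)
    ultimately show "Q f" using r0(1) by (simp add: Q_def f_def)
    show "content f = 1" "degree f = degree r0" using r0(1) by (simp_all add: Q_def f_def)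
  qed
  let ?P = "prime_cyclotomic p"
  have fnz: "f \<noteq> 0" using f(1) by (simp add: Q_def)
  \<comment> \<open>The leading coefficient of \<open>f\<close> need not be 1, hence
    pseudo-division; its price is the factor \<open>c\<close>. The remainder vanishes at
    \<open>\<xi>\<close> and has smaller degree than \<open>f\<close>, so it is 0.\<close>
  obtain q s where qs: "pseudo_divmod ?P f = (q, s)" by (cases "pseudo_divmod ?P f")
  define c where "c = coeff f (degree f) ^ (Suc (degree ?P) - degree f)"
  have c: "c \<noteq> 0" using fnz by (simp add: c_def)
  have div: "smult c ?P = f * q + s" and s: "s = 0 \<or> degree s < degree f"
    using pseudo_divmod[OF fnz qs] by (simp_all add: c_def)
  have "ceval s \<xi> = 0"
    using arg_cong[OF div, of "\<lambda>g. ceval g \<xi>"] f(1) ceval_prime_cyclotomic[OF \<xi>] by (simp add: Q_def)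
  have "s = 0"
  proof (rule ccontr)
    assume "s \<noteq> 0"
    with s have "degree s < degree f" by simp
    moreover from this have "Q s" using \<open>s \<noteq> 0\<close> \<open>ceval s \<xi> = 0\<close> f(1) by (auto simp: Q_def)
    ultimately show False using r0(2)[of s] f(3) by simp
  qed
  then have div: "smult c ?P = f * q" using div by simp
  \<comment> \<open>Gauss's lemma: since \<open>f\<close> has content 1, the factor \<open>c\<close>
    divides the content of \<open>q\<close> and can be cancelled.\<close>
  have "content (smult c ?P) = content q" unfolding div by (simp add: content_mult f(2))
  then have "content q = normalize c * content ?P" by simp
  then have "c dvd content q" by simp
  then have "[:c:] dvd q" by (simp add: const_poly_dvd_iff_dvd_content)
  then obtain g where g: "q = smult c g" by (auto elim: dvdE)
  have "smult c (f * g - ?P) = 0" using div unfolding g by (simp add: smult_diff_right)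
  then have fg: "f * g = ?P" using c by (simp only: smult_eq_0_iff) simp
  define F G where "F = pcompose f [:1, 1:]" and "G = pcompose g [:1, 1:]"
  have FG: "coeff (F * G) i = int (p choose Suc i)" for i
    using coeff_prime_cyclotomic_shift[of p i] by (simp add: F_def G_def pcompose_mult[symmetric] fg)
  have degP: "degree ?P = p - 1" using p1 by (intro degree_prime_cyclotomic) simp
  have gnz: "g \<noteq> 0"
  proof
    assume "g = 0"
    then have "?P = 0" using fg by simp
    then show False using degP p1 by simp
  qed
  have degs: "degree f + degree g = p - 1"
    using degree_mult_eq[OF fnz gnz] unfolding fg degP by simp
  have degF: "degree F = degree f" "degree G = degree g" by (simp_all add: F_def G_def degree_pcompose)
  have degf0: "degree f > 0"
  proof (rule ccontr)
    assume "\<not> degree f > 0"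
    then obtain a where "f = [:a:]" by (metis degree_eq_zeroE gr0I)
    then show False using f(1) by (auto simp: Q_def)
  qed
  have degf1: "degree f < p - 1" using f(1) by (simp add: Q_def)
  have F0G0: "coeff F 0 * coeff G 0 = int p" using FG[of 0] by (simp add: coeff_mult)
  have FGnz: "F \<noteq> 0" "G \<noteq> 0" using F0G0 p1 by auto
  have "lead_coeff F * lead_coeff G = lead_coeff (F * G)" by (simp add: lead_coeff_mult)
  also have "\<dots> = int (p choose Suc (degree F + degree G))"
    by (simp only: FG degree_mult_eq[OF FGnz])
  also have "\<dots> = 1" using degs degF p1 by simp
  finally have lead: "lead_coeff F * lead_coeff G = 1" .
  have pi: "prime (int p)" using p by simp
  have nd: "\<not> int p dvd lead_coeff F" "\<not> int p dvd lead_coeff G"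
  proof -
    have "\<not> int p dvd 1" using p1 by simp
    then show "\<not> int p dvd lead_coeff F" "\<not> int p dvd lead_coeff G"
      using dvd_mult2[of "int p" "lead_coeff F" "lead_coeff G"] dvd_mult[of "int p" "lead_coeff G" "lead_coeff F"]
      unfolding lead by blast+
  qed
  have dv: "int p dvd coeff (F * G) i" if "i < p - 1" for i
  proof -
    have "p dvd (p choose Suc i)" by (rule dvd_choose_prime) (use that p in auto)
    then show ?thesis by (simp add: FG)
  qed
  have "int p dvd coeff F 0 * coeff G 0" using F0G0 by simp
  then have or: "int p dvd coeff F 0 \<or> int p dvd coeff G 0" using pi by (simp add: prime_dvd_mult_iff)
  \<comment> \<open>The product of the constant terms is \<open>p\<close> itself and not divisible
    by its square, so exactly one factor can play the role of \<open>F\<close> in the Eisenstein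
    step.\<close>
  have nand: "\<not> (int p dvd coeff F 0 \<and> int p dvd coeff G 0)"
  proof
    assume "int p dvd coeff F 0 \<and> int p dvd coeff G 0"
    then have "int p * int p dvd int p * 1" using mult_dvd_mono[of "int p" "coeff F 0" "int p" "coeff G 0"] F0G0 by simp
    then have "int p dvd 1" using p1 by (simp only: dvd_times_left_cancel_iff)
    then show False using p1 by simp
  qed
  from or show False
  proof
    assume "int p dvd coeff F 0"
    then show False using eisenstein_step[of "int p" F G] pi nand nd dv degF degf1 by auto
  next
    assume "int p dvd coeff G 0"
    then show False using eisenstein_step[of "int p" G F] pi nand nd dv degF degf0 degs by (auto simp: mult.commute)
  qed
qed

text \<open>The product is the norm of an element of the cyclotomic ring; Galois theory is replaced
  by symmetry. The polynomial formed from the product of all \<open>r(X^t)\<close> takes one and the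
  same value at all non-trivial \<open>p\<close>-th roots of unity, because
  \<open>t \<mapsto> s t\<close> permutes the non-zero residues. Its remainder modulo the cyclotomic
  polynomial is therefore constant, and it has integer coefficients.\<close>

lemma prod_root_of_unity_int:
  fixes r :: "int poly"
  assumes p: "prime p"
  defines "\<zeta> \<equiv> cis (2 * pi / real p)"
  shows "\<exists>z::int. (\<Prod>t\<in>{1..<p}. ceval r (\<zeta> ^ t)) = of_int z"
proof -
  have p1: "p > 1" using p by (rule prime_gt_1_nat)
  have "real p * (2 * pi / real p) = 2 * pi" using p1 by simp
  then have zp: "\<zeta> ^ p = 1" by (simp only: \<zeta>_def Complex.DeMoivre cis_2pi)
  have zmod: "\<zeta> ^ a = \<zeta> ^ (a mod p)" for a
  proof -
    have "\<zeta> ^ a = \<zeta> ^ (p * (a div p) + a mod p)" by simp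
    also have "\<dots> = \<zeta> ^ (a mod p)" by (simp only: power_add power_mult zp) simp
    finally show ?thesis .
  qed
  have inj: "inj_on (\<lambda>t. \<zeta> ^ t) {..<p}"
    using Complex.bij_betw_roots_unity[of p] p1 unfolding \<zeta>_def
    by (auto simp: bij_betw_def inj_on_def Complex.DeMoivre mult_ac)
  define \<beta> where "\<beta> = (\<Prod>t\<in>{1..<p}. ceval r (\<zeta> ^ t))"
  define F where "F = (\<Prod>t\<in>{1..<p}. pcompose r (monom 1 t))"
  let ?P = "prime_cyclotomic p"
  have degP: "degree ?P = p - 1" using p1 by (intro degree_prime_cyclotomic) simp
  have P0: "?P \<noteq> 0" using degP p1 by auto
  have cP: "coeff ?P (degree ?P) = 1" using p1 by (simp add: degP coeff_prime_cyclotomic)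
  obtain q f where qf: "pseudo_divmod F ?P = (q, f)" by (cases "pseudo_divmod F ?P")
  have F: "F = ?P * q + f" and f: "f = 0 \<or> degree f < p - 1"
    using pseudo_divmod[OF P0 qf] unfolding cP by (simp_all add: degP)
  have ev: "ceval f (\<zeta> ^ s) = \<beta>" if s: "s \<in> {1..<p}" for s
  proof -
    have "\<not> p dvd s" using s by (auto dest: dvd_imp_le)
    then have cop: "coprime s p" using p by (simp add: prime_imp_coprime coprime_commute)
    have "\<zeta> ^ s \<noteq> 1"
      using inj_onD[OF inj, of s 0] s p1 by auto
    moreover have "(\<zeta> ^ s) ^ p = 1" by (metis power_mult mult.commute zp power_one)
    ultimately have "ceval ?P (\<zeta> ^ s) = 0" using ceval_prime_cyclotomic by blast
    then have "ceval f (\<zeta> ^ s) = ceval F (\<zeta> ^ s)" by (subst F) simp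
    also have "\<dots> = (\<Prod>t\<in>{1..<p}. ceval r (\<zeta> ^ (s * t mod p)))"
      by (simp add: F_def ceval_prod ceval_pcompose power_mult[symmetric] zmod[symmetric])
    also have "\<dots> = \<beta>"
      unfolding \<beta>_def
    proof (rule prod.reindex_bij_betw)
      have maps: "s * t mod p \<in> {1..<p}" if t: "t \<in> {1..<p}" for t
      proof -
        have "\<not> p dvd s * t" using s t p by (auto simp: prime_dvd_mult_iff dest: dvd_imp_le)
        then show ?thesis using p1 by (auto simp: dvd_eq_mod_eq_0)
      qed
      have "inj_on (\<lambda>t. s * t mod p) {1..<p}"
      proof (rule inj_onI)
        fix x y assume xy: "x \<in> {1..<p}" "y \<in> {1..<p}" "s * x mod p = s * y mod p"
        then have "[s * x = s * y] (mod p)" by (simp add: cong_def)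
        then have "[x = y] (mod p)" using cop by (simp add: cong_mult_lcancel_nat)
        then show "x = y" using xy by (simp add: cong_def)
      qed
      then show "bij_betw (\<lambda>t. s * t mod p) {1..<p} {1..<p}"
        using maps by (metis bij_betw_def endo_inj_surj finite_atLeastLessThan image_subsetI)
    qed
    finally show ?thesis .
  qed
  \<comment> \<open>\<open>g\<close> has \<open>p - 1\<close> different roots but smaller degree,
    hence the remainder \<open>f\<close> is the constant \<open>\<beta>\<close>.\<close>
  define g where "g = map_poly of_int f - [:\<beta>:]"
  have "g = 0"
  proof (rule ccontr)
    assume g0: "g \<noteq> 0"
    have "(\<lambda>t. \<zeta> ^ t) ` {1..<p} \<subseteq> {x. poly g x = 0}"
      using ev by (auto simp: g_def ceval_def)
    then have cd: "card ((\<lambda>t. \<zeta> ^ t) ` {1..<p}) \<le> degree g"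
      by (rule order_trans[OF card_mono[OF poly_roots_finite[OF g0]] card_poly_roots_bound[OF g0]])
    have cd': "card ((\<lambda>t. \<zeta> ^ t) ` {1..<p}) = p - 1"
      by (subst card_image) (use inj in \<open>auto simp: inj_on_def\<close>)
    have "degree g \<le> degree f" unfolding g_def
      by (rule degree_diff_le) (simp_all add: degree_map_poly)
    with cd cd' f p1 show False by auto
  qed
  then have "coeff (map_poly of_int f) 0 = coeff [:\<beta>:] 0" by (simp add: g_def)
  then have "\<beta> = of_int (coeff f 0)" by (simp add: coeff_map_poly)
  then show ?thesis unfolding \<beta>_def by blast
qed

text \<open>Some residue must be missing among the exponents, as the sum of all powers of a
  non-trivial root of unity is 0. Moving the missing residue to \<open>p - 1\<close> lowers the
  degree below \<open>p - 1\<close>, where irreducibility forbids a root; the norm is then a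
  non-zero integer.\<close>

lemma sparse_root_of_unity_sum:
  fixes h :: "'x \<Rightarrow> int" and e :: "'x \<Rightarrow> nat"
  assumes p: "prime p" and X: "finite X" and inj: "inj_on e X" and sub: "e ` X \<subset> {..<p}"
    and h: "\<exists>x\<in>X. h x \<noteq> 0"
  defines "\<zeta> \<equiv> cis (2 * pi / real p)"
  defines "R \<equiv> (\<lambda>t. \<Sum>x\<in>X. of_int (h x) * (\<zeta> ^ t) ^ e x)"
  shows "\<forall>t\<in>{1..<p}. R t \<noteq> 0" and "(\<Prod>t\<in>{1..<p}. cmod (R t)) \<ge> 1"
proof -
  have p1: "p > 1" using p by (rule prime_gt_1_nat)
  have "real p * (2 * pi / real p) = 2 * pi" using p1 by simp
  then have zp: "\<zeta> ^ p = 1" by (simp only: \<zeta>_def Complex.DeMoivre cis_2pi)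
  have zt: "(\<zeta> ^ t) ^ p = 1" for t by (metis power_mult mult.commute zp power_one)
  have zt1: "\<zeta> ^ t \<noteq> 1" if t: "t \<in> {1..<p}" for t
  proof
    assume eq: "\<zeta> ^ t = 1"
    have "inj_on (\<lambda>t. \<zeta> ^ t) {..<p}"
      using Complex.bij_betw_roots_unity[of p] p1 unfolding \<zeta>_def
      by (auto simp: bij_betw_def inj_on_def Complex.DeMoivre mult_ac)
    from inj_onD[OF this, of t 0] eq t p1 show False by auto
  qed
  have ztmod: "(\<zeta> ^ t) ^ (a mod p) = (\<zeta> ^ t) ^ a" for a t
  proof -
    have "(\<zeta> ^ t) ^ a = (\<zeta> ^ t) ^ (p * (a div p) + a mod p)" by simp
    also have "\<dots> = (\<zeta> ^ t) ^ (a mod p)" by (simp only: power_add power_mult[of _ p] zt) simp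
    finally show ?thesis by simp
  qed
  obtain c where c: "c < p" "c \<notin> e ` X" using sub by auto
  \<comment> \<open>Multiplication by the power \<open>p - 1 - c\<close> of the root changes no
    modulus and sends the missing residue \<open>c\<close> to \<open>p - 1\<close>.\<close>
  define e' where "e' x = (e x + (p - 1 - c)) mod p" for x
  have e'l: "e' x < p - 1" if "x \<in> X" for x
  proof -
    have "e x < p" using sub that by auto
    moreover have "e x \<noteq> c" using c that by auto
    ultimately show ?thesis using c p1
      by (cases "e x < c") (auto simp: e'_def mod_if)
  qed
  have inj': "inj_on e' X"
  proof (rule inj_onI)
    fix x y assume xy: "x \<in> X" "y \<in> X" "e' x = e' y"
    then have "[e x + (p - 1 - c) = e y + (p - 1 - c)] (mod p)" by (simp add: e'_def cong_def)
    then have "[e x = e y] (mod p)" by (simp add: cong_add_rcancel_nat)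
    moreover have "e x < p" "e y < p" using sub xy by auto
    ultimately have "e x = e y" by (simp add: cong_def)
    then show "x = y" using inj xy by (auto dest: inj_onD)
  qed
  define r where "r = (\<Sum>x\<in>X. monom (h x) (e x))"
  define r' where "r' = (\<Sum>x\<in>X. monom (h x) (e' x))"
  have evr: "ceval r (\<zeta> ^ t) = R t" for t
    by (simp add: r_def R_def ceval_sum)
  have evr': "ceval r' (\<zeta> ^ t) = (\<zeta> ^ t) ^ (p - 1 - c) * R t" for t
    by (simp add: r'_def R_def ceval_sum e'_def ztmod power_add sum_distrib_left mult_ac)
  obtain x where x: "x \<in> X" "h x \<noteq> 0" using h by auto
  have "coeff r' (e' x) = (\<Sum>y\<in>X. if y = x then h y else 0)"
    unfolding r'_def coeff_sum by (intro sum.cong) (use inj' x in \<open>auto dest: inj_onD\<close>)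
  also have "\<dots> = h x" using X x by simp
  finally have "r' \<noteq> 0" using x by auto
  have "degree r' < p - 1"
  proof -
    have "degree r' \<le> p - 2" unfolding r'_def
    proof (rule degree_sum_le[OF X])
      fix y assume "y \<in> X"
      then have "e' y \<le> p - 2" using e'l[of y] by simp
      then show "degree (monom (h y) (e' y)) \<le> p - 2"
        using degree_monom_le order_trans by blast
    qed
    moreover have "p - 2 < p - 1" using p1 by simp
    ultimately show ?thesis by simp
  qed
  have nz: "R t \<noteq> 0" if t: "t \<in> {1..<p}" for t
  proof
    assume "R t = 0"
    then have "ceval r' (\<zeta> ^ t) = 0" by (simp add: evr')
    then have "r' = 0" using int_poly_root_of_unity_zero[OF p zt zt1[OF t]] \<open>degree r' < p - 1\<close> by blast
    with \<open>r' \<noteq> 0\<close> show False by simp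
  qed
  then show "\<forall>t\<in>{1..<p}. R t \<noteq> 0" by blast
  obtain z where z: "(\<Prod>t\<in>{1..<p}. R t) = of_int z"
    using prod_root_of_unity_int[OF p, of r] evr unfolding \<zeta>_def by auto
  have "(\<Prod>t\<in>{1..<p}. R t) \<noteq> 0" using nz by simp
  then have "z \<noteq> 0" using z by auto
  then have "1 \<le> cmod (of_int z)" by simp
  then show "(\<Prod>t\<in>{1..<p}. cmod (R t)) \<ge> 1" by (simp add: z[symmetric] prod_norm)
qed

section \<open>Characters of the torus\<close>

definition echar :: "nat \<Rightarrow> (nat \<Rightarrow> int) \<Rightarrow> (nat \<Rightarrow> real) \<Rightarrow> complex" where
  "echar m y \<theta> = cis (2 * pi * (\<Sum>i<m. of_int (y i) * \<theta> i))"

lemma norm_echar [simp]: "cmod (echar m y \<theta>) = 1"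
  by (simp add: echar_def)

lemma echar_zero [simp]: "echar m (\<lambda>_. 0) \<theta> = 1"
  by (simp add: echar_def)

lemma echar_add: "echar m (\<lambda>i. x i + y i) \<theta> = echar m x \<theta> * echar m y \<theta>"
  by (simp add: echar_def cis_mult distrib_right sum.distrib distrib_left)

lemma echar_uminus: "echar m (\<lambda>i. - y i) \<theta> = cnj (echar m y \<theta>)"
  by (simp add: echar_def cis_cnj sum_negf)

lemma echar_shift: "echar m y (\<lambda>i. \<theta> i + c i) = echar m y \<theta> * echar m y c"
  by (simp add: echar_def cis_mult distrib_right sum.distrib distrib_left)

lemma echar_power: "echar m y \<theta> ^ n = echar m (\<lambda>i. int n * y i) \<theta>"
  by (simp add: echar_def Complex.DeMoivre sum_distrib_left mult_ac)

text \<open>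
  The number \<open>B\<close> bounds the sum of the absolute values of the coefficients.
\<close>

inductive comb :: "nat \<Rightarrow> complex set \<Rightarrow> (nat \<Rightarrow> int) set \<Rightarrow> real \<Rightarrow> ((nat \<Rightarrow> real) \<Rightarrow> complex) \<Rightarrow> bool"
  for m K Y where
  comb_zero: "0 \<le> B \<Longrightarrow> comb m K Y B (\<lambda>_. 0)"
| comb_step: "comb m K Y B F \<Longrightarrow> c \<in> K \<Longrightarrow> y \<in> Y \<Longrightarrow> comb m K Y (B + cmod c) (\<lambda>\<theta>. F \<theta> + c * echar m y \<theta>)"

lemma comb_nonneg: "comb m K Y B F \<Longrightarrow> 0 \<le> B"
  by (induction rule: comb.induct) auto

lemma comb_mono:
  assumes "comb m K Y B F" "K \<subseteq> K'" "Y \<subseteq> Y'" "B \<le> B'"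
  shows "comb m K' Y' B' F"
  using assms
proof (induction arbitrary: B' rule: comb.induct)
  case (comb_zero B)
  then show ?case by (intro comb.comb_zero) simp
next
  case (comb_step B F c y)
  have "comb m K' Y' (B' - cmod c) F" using comb_step by simp
  then have "comb m K' Y' (B' - cmod c + cmod c) (\<lambda>\<theta>. F \<theta> + c * echar m y \<theta>)"
    using comb_step by (intro comb.comb_step) auto
  then show ?case by simp
qed

lemma comb_add:
  assumes "comb m K Y B F" "comb m K Y B' G"
  shows "comb m K Y (B + B') (\<lambda>\<theta>. F \<theta> + G \<theta>)"
  using assms(2,1)
proof (induction rule: comb.induct)
  case (comb_zero B')
  then show ?case using comb_mono[of m K Y B F K Y "B + B'"] by simp
next
  case (comb_step B' G c y)
  then have "comb m K Y (B + B' + cmod c) (\<lambda>\<theta>. F \<theta> + G \<theta> + c * echar m y \<theta>)"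
    by (intro comb.comb_step) auto
  then show ?case by (simp add: add_ac)
qed

lemma comb_monom: "c \<in> K \<Longrightarrow> y \<in> Y \<Longrightarrow> cmod c \<le> B \<Longrightarrow> comb m K Y B (\<lambda>\<theta>. c * echar m y \<theta>)"
  using comb.comb_step[OF comb.comb_zero[of "B - cmod c" m K Y], of c y] by simp

lemma comb_mult_monom:
  assumes "comb m K Y B F" "c \<in> K" "\<And>a b. a \<in> K \<Longrightarrow> b \<in> K \<Longrightarrow> a * b \<in> K"
    and "\<And>y'. y' \<in> Y \<Longrightarrow> (\<lambda>i. y' i + y i) \<in> Z"
  shows "comb m K Z (B * cmod c) (\<lambda>\<theta>. F \<theta> * (c * echar m y \<theta>))"
  using assms
proof (induction rule: comb.induct)
  case (comb_zero B)
  then show ?case using comb.comb_zero[of "B * cmod c" m K Z] by simp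
next
  case (comb_step B F d x)
  then have "comb m K Z (B * cmod c + cmod (d * c))
      (\<lambda>\<theta>. F \<theta> * (c * echar m y \<theta>) + (d * c) * echar m (\<lambda>i. x i + y i) \<theta>)"
    by (intro comb.comb_step) auto
  then show ?case by (simp add: echar_add norm_mult algebra_simps)
qed

lemma comb_mult:
  assumes "comb m K Y B F" "comb m K Y' B' G" "\<And>a b. a \<in> K \<Longrightarrow> b \<in> K \<Longrightarrow> a * b \<in> K"
    and "\<And>y y'. y \<in> Y \<Longrightarrow> y' \<in> Y' \<Longrightarrow> (\<lambda>i. y i + y' i) \<in> Z"
  shows "comb m K Z (B * B') (\<lambda>\<theta>. F \<theta> * G \<theta>)"
  using assms(2,1,3,4)
proof (induction rule: comb.induct)
  case (comb_zero B')
  then show ?case using comb.comb_zero[of "B * B'" m K Z] comb_nonneg[of m K Y B F] by simp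
next
  case (comb_step B' G c y)
  have "comb m K Z (B * B' + B * cmod c) (\<lambda>\<theta>. F \<theta> * G \<theta> + F \<theta> * (c * echar m y \<theta>))"
    by (rule comb_add) (use comb_step in \<open>auto intro!: comb_mult_monom\<close>)
  then show ?case by (simp add: algebra_simps)
qed

lemma comb_scale:
  assumes "comb m K Y B F" "c \<in> K" "\<And>a b. a \<in> K \<Longrightarrow> b \<in> K \<Longrightarrow> a * b \<in> K"
  shows "comb m K Y (B * cmod c) (\<lambda>\<theta>. c * F \<theta>)"
  using comb_mult_monom[of m K Y B F c "\<lambda>_. 0" Y] assms by (simp add: mult.commute)

lemma comb_sum:
  assumes "finite I" "\<And>i. i \<in> I \<Longrightarrow> comb m K Y (B i) (F i)"
  shows "comb m K Y (\<Sum>i\<in>I. B i) (\<lambda>\<theta>. \<Sum>i\<in>I. F i \<theta>)"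
  using assms
proof (induction I)
  case empty
  then show ?case by (simp add: comb.comb_zero)
next
  case (insert i I)
  then show ?case using comb_add[of m K Y "B i" "F i" "\<Sum>i\<in>I. B i"] by simp
qed

lemma comb_norm: "comb m K Y B F \<Longrightarrow> cmod (F \<theta>) \<le> B"
proof (induction rule: comb.induct)
  case (comb_step B F c y)
  then show ?case using norm_triangle_ineq[of "F \<theta>" "c * echar m y \<theta>"] by (simp add: norm_mult)
qed simp

text \<open>One round of substitution: each character is replaced by an approximation, and the
  coefficient bound \<open>B\<close> multiplies both the new coefficient bound and the error. The
  reduction below is iterated with it.\<close>

lemma comb_subst:
  assumes "comb m K Y B F" and K: "\<And>a b. a \<in> K \<Longrightarrow> b \<in> K \<Longrightarrow> a * b \<in> K"
    and "\<And>y. y \<in> Y \<Longrightarrow> \<exists>G. comb m K Z B1 G \<and> (\<forall>\<theta>. cmod (echar m y \<theta> - G \<theta>) \<le> e \<theta>)"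
    and e: "\<And>\<theta>. 0 \<le> e \<theta>" and B1: "B1 \<ge> 0"
  shows "\<exists>G. comb m K Z (B * B1) G \<and> (\<forall>\<theta>. cmod (F \<theta> - G \<theta>) \<le> B * e \<theta>)"
  using assms(1)
proof (induction rule: comb.induct)
  case (comb_zero B)
  then show ?case using comb.comb_zero[of "B * B1" m K Z] B1 e by (intro exI[of _ "\<lambda>_. 0"]) simp
next
  case (comb_step B F c y)
  then obtain G where G: "comb m K Z (B * B1) G" "\<And>\<theta>. cmod (F \<theta> - G \<theta>) \<le> B * e \<theta>" by auto
  from assms(3)[OF comb_step.hyps(3)] obtain G' where
    G': "comb m K Z B1 G'" "\<And>\<theta>. cmod (echar m y \<theta> - G' \<theta>) \<le> e \<theta>" by auto
  have "comb m K Z (B * B1 + B1 * cmod c) (\<lambda>\<theta>. G \<theta> + c * G' \<theta>)"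
    by (rule comb_add[OF G(1) comb_scale[OF G'(1) _ K]]) (use comb_step in auto)
  moreover have "cmod (F \<theta> + c * echar m y \<theta> - (G \<theta> + c * G' \<theta>)) \<le> (B + cmod c) * e \<theta>" for \<theta>
  proof -
    have "cmod (F \<theta> + c * echar m y \<theta> - (G \<theta> + c * G' \<theta>)) = cmod ((F \<theta> - G \<theta>) + c * (echar m y \<theta> - G' \<theta>))"
      by (simp add: algebra_simps)
    also have "\<dots> \<le> cmod (F \<theta> - G \<theta>) + cmod c * cmod (echar m y \<theta> - G' \<theta>)"
      by (metis norm_triangle_ineq norm_mult)
    also have "\<dots> \<le> B * e \<theta> + cmod c * e \<theta>"
      by (intro add_mono mult_left_mono G G') simp
    finally show ?thesis by (simp add: algebra_simps)
  qed
  ultimately show ?case by (intro exI[of _ "\<lambda>\<theta>. G \<theta> + c * G' \<theta>"]) (simp add: algebra_simps)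
qed

text \<open>A derivation of \<open>comb\<close> may use the same exponent repeatedly. Collecting
  equal exponents gives honest coefficients, each still bounded by the total
  \<open>B\<close>.\<close>

lemma comb_coeffs:
  assumes "comb m \<int> Y B F" "finite Y"
  shows "\<exists>c::(nat \<Rightarrow> int) \<Rightarrow> int. (\<forall>\<theta>. F \<theta> = (\<Sum>y\<in>Y. of_int (c y) * echar m y \<theta>)) \<and> (\<forall>y. \<bar>of_int (c y)\<bar> \<le> B)"
  using assms(1)
proof (induction rule: comb.induct)
  case (comb_zero B)
  then show ?case by (intro exI[of _ "\<lambda>_. 0"]) simp
next
  case (comb_step B F c y)
  then obtain d where d: "\<And>\<theta>. F \<theta> = (\<Sum>y\<in>Y. of_int (d y) * echar m y \<theta>)"
    "\<And>y. \<bar>of_int (d y)\<bar> \<le> B" by auto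
  from \<open>c \<in> \<int>\<close> obtain c' where c': "c = of_int c'" by (auto elim: Ints_cases)
  define d' where "d' = d(y := d y + c')"
  have "F \<theta> + c * echar m y \<theta> = (\<Sum>y\<in>Y. of_int (d' y) * echar m y \<theta>)" for \<theta>
    using \<open>y \<in> Y\<close> \<open>finite Y\<close> by (simp add: d sum.remove[of Y y] d'_def c' algebra_simps)
  moreover have "\<bar>of_int (d' x)\<bar> \<le> B + cmod c" for x
    using d(2)[of x] d(2)[of y] by (auto simp: d'_def c' norm_of_int)
  ultimately show ?case by blast
qed

section \<open>Linear forms on exponents projected to a plane\<close>

lemma cramer_bound:
  fixes l1 l2 :: real and v1 v2 w1 w2 :: int
  assumes det: "v1 * w2 \<noteq> v2 * w1"
    and v: "\<bar>l1 * v1 + l2 * v2\<bar> \<le> e" and w: "\<bar>l1 * w1 + l2 * w2\<bar> \<le> e"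
    and W: "\<bar>v1\<bar> \<le> W" "\<bar>v2\<bar> \<le> W" "\<bar>w1\<bar> \<le> W" "\<bar>w2\<bar> \<le> W"
  shows "sqrt (l1\<^sup>2 + l2\<^sup>2) \<le> 4 * real_of_int W * e"
proof -
  let ?d = "real_of_int (v1 * w2 - v2 * w1)"
  let ?v = "l1 * v1 + l2 * v2" and ?w = "l1 * w1 + l2 * w2"
  \<comment> \<open>A non-zero integer determinant has modulus at least 1, so Cramer's rule needs no
    division.\<close>
  have d1: "1 \<le> \<bar>?d\<bar>" using det by linarith
  have e: "e \<ge> 0" "real_of_int W \<ge> 0" using v W by linarith+
  have Wr: "\<bar>real_of_int v1\<bar> \<le> W" "\<bar>real_of_int v2\<bar> \<le> W" "\<bar>real_of_int w1\<bar> \<le> W" "\<bar>real_of_int w2\<bar> \<le> W"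
    using W by linarith+
  have b: "\<bar>?v * x\<bar> \<le> e * W" "\<bar>?w * x\<bar> \<le> e * W" if "\<bar>x\<bar> \<le> real_of_int W" for x
    unfolding abs_mult using that v w e by (intro mult_mono; simp)+
  have "\<bar>l1\<bar> * 1 \<le> \<bar>l1\<bar> * \<bar>?d\<bar>" by (intro mult_left_mono d1) simp
  also have "\<dots> = \<bar>?v * w2 - ?w * v2\<bar>" by (simp add: abs_mult[symmetric] algebra_simps)
  also have "\<dots> \<le> 2 * real_of_int W * e" using b(1)[OF Wr(4)] b(2)[OF Wr(2)] by (simp add: mult_ac)
  finally have 1: "\<bar>l1\<bar> \<le> 2 * real_of_int W * e" by simp
  have "\<bar>l2\<bar> * 1 \<le> \<bar>l2\<bar> * \<bar>?d\<bar>" by (intro mult_left_mono d1) simp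
  also have "\<dots> = \<bar>?w * v1 - ?v * w1\<bar>" by (simp add: abs_mult[symmetric] algebra_simps)
  also have "\<dots> \<le> 2 * real_of_int W * e" using b(2)[OF Wr(1)] b(1)[OF Wr(3)] by (simp add: mult_ac)
  finally have 2: "\<bar>l2\<bar> \<le> 2 * real_of_int W * e" by simp
  have "sqrt (l1\<^sup>2 + l2\<^sup>2) \<le> \<bar>l1\<bar> + \<bar>l2\<bar>" by (rule sqrt_sum_squares_le_sum_abs)
  with 1 2 show ?thesis by simp
qed

text \<open>
  Two indices nearly tied for the maximum of a linear form, and two nearly tied for its minimum, give
  linearly independent differences on which the form is small, so the form itself is small.
\<close>

lemma extremal_gap:
  fixes q1 q2 :: "'j::finite \<Rightarrow> int"
  assumes H4: "\<And>i j k l. distinct [i, j, k, l] \<Longrightarrow> (q1 i - q1 j) * (q2 k - q2 l) \<noteq> (q2 i - q2 j) * (q1 k - q1 l)"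
    and H3: "\<exists>i j k. (q1 i - q1 k) * (q2 j - q2 k) \<noteq> (q2 i - q2 k) * (q1 j - q1 k)"
  shows "\<exists>g>0. \<forall>(l1::real) (l2::real). \<exists>j. \<exists>\<tau>\<in>{1,-1::int}. \<forall>i. i \<noteq> j \<longrightarrow>
           g * sqrt (l1\<^sup>2 + l2\<^sup>2) \<le> \<tau> * (l1 * (q1 j - q1 i) + l2 * (q2 j - q2 i))"
proof -
  define W where "W = 1 + (\<Sum>i\<in>UNIV. \<bar>q1 i\<bar> + \<bar>q2 i\<bar>) * 2"
  have sm: "\<bar>q1 i\<bar> + \<bar>q2 i\<bar> \<le> (\<Sum>i\<in>UNIV. \<bar>q1 i\<bar> + \<bar>q2 i\<bar>)" for i
    by (rule member_le_sum) auto
  have W: "\<bar>q1 i - q1 j\<bar> \<le> W" "\<bar>q2 i - q2 j\<bar> \<le> W" for i j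
    using sm[of i] sm[of j] unfolding W_def by linarith+
  have W1: "W \<ge> 1" unfolding W_def by (simp add: sum_nonneg)
  \<comment> \<open>With this \<open>g\<close>, the bound of \<open>cramer_bound\<close> for an
    error \<open>2 * (g * N)\<close> is \<open>N / 2\<close>, which is too small for
    \<open>N > 0\<close>.\<close>
  define g where "g = 1 / (16 * real_of_int W)"
  have g: "g > 0" using W1 by (simp add: g_def)
  have "\<exists>j. \<exists>\<tau>\<in>{1,-1::int}. \<forall>i. i \<noteq> j \<longrightarrow>
           g * sqrt (l1\<^sup>2 + l2\<^sup>2) \<le> \<tau> * (l1 * (q1 j - q1 i) + l2 * (q2 j - q2 i))" for l1 l2 :: real
  proof (rule ccontr)
    assume neg: "\<not> ?thesis"
    define f where "f i = l1 * q1 i + l2 * q2 i" for i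
    define N where "N = sqrt (l1\<^sup>2 + l2\<^sup>2)"
    have fd: "l1 * (q1 j - q1 i) + l2 * (q2 j - q2 i) = f j - f i" for i j
      by (simp add: f_def algebra_simps)
    have neg': "\<exists>i. i \<noteq> j \<and> \<tau> * (f j - f i) < g * N" if "\<tau> \<in> {1,-1::int}" for j \<tau>
    proof -
      have "\<not> (\<forall>i. i \<noteq> j \<longrightarrow> g * N \<le> \<tau> * (l1 * (q1 j - q1 i) + l2 * (q2 j - q2 i)))"
        using neg that unfolding N_def by blast
      then show ?thesis unfolding fd by (simp add: not_le)
    qed
    have "Max (range f) \<in> range f" "Min (range f) \<in> range f" by (rule Max_in Min_in; simp)+
    then obtain a b where "Max (range f) = f a" "Min (range f) = f b" by (metis rangeE)
    then have a: "f i \<le> f a" and b: "f b \<le> f i" for i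
      using Max_ge[of "range f" "f i"] Min_le[of "range f" "f i"] by simp_all
    obtain i where i: "i \<noteq> a" "f a - f i < g * N" using neg'[of 1 a] by auto
    obtain k where k: "k \<noteq> b" "f k - f b < g * N" using neg'[of "-1" b] by auto
    have gN0: "0 < g * N" using i a[of i] by linarith
    then have N0: "N > 0" using g by (simp add: zero_less_mult_iff)
    have gN: "4 * real_of_int W * (2 * (g * N)) < N" using N0 W1 by (simp add: g_def)
    \<comment> \<open>A large spread keeps the near-maximal pair \<open>a\<close>, \<open>i\<close>
      apart from the near-minimal pair \<open>k\<close>, \<open>b\<close>, and \<open>H4\<close>
      applies. Otherwise all values are close together and the triple of \<open>H3\<close>
      suffices.\<close>
    show False
    proof (cases "f a - f b > 2 * (g * N)")
      case True
      have "f a \<noteq> f b" "f i \<noteq> f b" "f k \<noteq> f a" "f i \<noteq> f k" using True i k gN0 by linarith+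
      then have "a \<noteq> b" "i \<noteq> b" "k \<noteq> a" "i \<noteq> k" by auto
      with i k have dist: "distinct [a, i, k, b]" by auto
      have "N \<le> 4 * real_of_int W * (g * N)"
        unfolding N_def
      proof (rule cramer_bound[OF H4[OF dist]])
        show "\<bar>l1 * real_of_int (q1 a - q1 i) + l2 * real_of_int (q2 a - q2 i)\<bar> \<le> g * sqrt (l1\<^sup>2 + l2\<^sup>2)"
          using i a[of i] fd[of a i] by (simp add: N_def[symmetric])
        show "\<bar>l1 * real_of_int (q1 k - q1 b) + l2 * real_of_int (q2 k - q2 b)\<bar> \<le> g * sqrt (l1\<^sup>2 + l2\<^sup>2)"
          using k b[of k] fd[of k b] by (simp add: N_def[symmetric])
      qed (rule W)+
      moreover have "4 * real_of_int W * (g * N) \<le> 4 * real_of_int W * (2 * (g * N))" using g N0 W1 by (intro mult_left_mono) auto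
      ultimately show False using gN by linarith
    next
      case False
      have all: "\<bar>f x - f y\<bar> \<le> 2 * (g * N)" for x y using False a[of x] a[of y] b[of x] b[of y] by linarith
      from H3 obtain x y z where xyz: "(q1 x - q1 z) * (q2 y - q2 z) \<noteq> (q2 x - q2 z) * (q1 y - q1 z)" by auto
      have "N \<le> 4 * real_of_int W * (2 * (g * N))"
        unfolding N_def
      proof (rule cramer_bound[OF xyz])
        show "\<bar>l1 * real_of_int (q1 x - q1 z) + l2 * real_of_int (q2 x - q2 z)\<bar> \<le> 2 * (g * sqrt (l1\<^sup>2 + l2\<^sup>2))"
          using all[of x z] fd[of x z] by (simp add: N_def[symmetric])
        show "\<bar>l1 * real_of_int (q1 y - q1 z) + l2 * real_of_int (q2 y - q2 z)\<bar> \<le> 2 * (g * sqrt (l1\<^sup>2 + l2\<^sup>2))"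
          using all[of y z] fd[of y z] by (simp add: N_def[symmetric])
      qed (rule W)+
      then show False using gN by linarith
    qed
  qed
  then show ?thesis using g by blast
qed

definition ipr :: "nat \<Rightarrow> (nat \<Rightarrow> int) \<Rightarrow> (nat \<Rightarrow> int) \<Rightarrow> int" where
  "ipr m w v = (\<Sum>i<m. w i * v i)"

lemma ipr_add: "ipr m w (\<lambda>i. x i + y i) = ipr m w x + ipr m w y"
  by (simp add: ipr_def distrib_left sum.distrib)

lemma ipr_scale: "ipr m w (\<lambda>i. c * x i) = c * ipr m w x"
  by (simp add: ipr_def sum_distrib_left mult_ac)

lemma ipr_diff: "ipr m w (\<lambda>i. x i - y i) = ipr m w x - ipr m w y"
  by (simp add: ipr_def right_diff_distrib sum_subtractf)

text \<open>Functionals are taken from the moment curve \<open>(1, B, B^2, ...)\<close>. Each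
  \<open>v\<close> becomes a non-zero polynomial in \<open>B\<close>, and an integer
  \<open>B\<close> can avoid the finitely many roots of their product.\<close>

lemma ex_functional_nonzero:
  assumes "finite V" and "\<And>v. v \<in> V \<Longrightarrow> \<exists>i<m. v i \<noteq> 0"
  shows "\<exists>w. \<forall>v\<in>V. ipr m w v \<noteq> 0"
proof -
  define Q where "Q v = (\<Sum>i<m. monom (v i) i)" for v :: "nat \<Rightarrow> int"
  have cQ: "coeff (Q v) i = (if i < m then v i else 0)" for v i
    by (simp add: Q_def coeff_sum)
  have Q0: "Q v \<noteq> 0" if v: "v \<in> V" for v
  proof
    assume "Q v = 0"
    then have z: "coeff (Q v) i = 0" for i by simp
    from assms(2)[OF v] obtain i where "i < m" "v i \<noteq> 0" by auto
    with z[of i] show False by (simp add: cQ)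
  qed
  have "(\<Prod>v\<in>V. Q v) \<noteq> 0" using Q0 assms(1) by simp
  then have "finite {x. poly (\<Prod>v\<in>V. Q v) x = 0}" by (rule poly_roots_finite)
  then obtain B where "poly (\<Prod>v\<in>V. Q v) B \<noteq> 0"
    using ex_new_if_finite[OF infinite_UNIV_int] by auto
  then have B: "poly (Q v) B \<noteq> 0" if "v \<in> V" for v
    using that assms(1) by (simp add: poly_prod)
  have "ipr m (\<lambda>i. B ^ i) v = poly (Q v) B" for v
    by (simp add: ipr_def Q_def poly_sum poly_monom mult.commute)
  with B show ?thesis by metis
qed

text \<open>Once \<open>\<pi>1\<close> vanishes on no first component, the determinant is
  \<open>\<pi>2\<close> applied to \<open>\<pi>1(v) w - \<pi>1(w) v\<close>. This vector is non-zero
  by independence, so a second use of the moment curve gives \<open>\<pi>2\<close>.\<close>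

lemma ex_projection_independent:
  assumes fin: "finite VW"
    and indep: "\<And>v w \<alpha> \<beta>. (v, w) \<in> VW \<Longrightarrow> (\<alpha>, \<beta>) \<noteq> (0, 0) \<Longrightarrow> \<exists>i<m. \<alpha> * v i + \<beta> * w i \<noteq> 0"
  shows "\<exists>\<pi>1 \<pi>2. \<forall>(v, w)\<in>VW. ipr m \<pi>1 v * ipr m \<pi>2 w \<noteq> ipr m \<pi>2 v * ipr m \<pi>1 w"
proof -
  have "\<exists>\<pi>1. \<forall>v\<in>fst ` VW. ipr m \<pi>1 v \<noteq> 0"
  proof (rule ex_functional_nonzero)
    fix v assume "v \<in> fst ` VW"
    then obtain w where "(v, w) \<in> VW" by auto
    from indep[OF this, of 1 0] show "\<exists>i<m. v i \<noteq> 0" by simp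
  qed (use fin in simp)
  then obtain \<pi>1 where \<pi>1: "\<And>v w. (v, w) \<in> VW \<Longrightarrow> ipr m \<pi>1 v \<noteq> 0" by force
  define u where "u = (\<lambda>(v, w). \<lambda>i. ipr m \<pi>1 v * w i - ipr m \<pi>1 w * v i)"
  have "\<exists>\<pi>2. \<forall>v\<in>u ` VW. ipr m \<pi>2 v \<noteq> 0"
  proof (rule ex_functional_nonzero)
    fix x assume "x \<in> u ` VW"
    then obtain v w where vw: "(v, w) \<in> VW" "x = u (v, w)" by auto
    then show "\<exists>i<m. x i \<noteq> 0"
      using indep[of v w "- ipr m \<pi>1 w" "ipr m \<pi>1 v"] \<pi>1[of v w] by (auto simp: u_def algebra_simps)
  qed (use fin in simp)
  then obtain \<pi>2 where \<pi>2: "\<And>v w. (v, w) \<in> VW \<Longrightarrow> ipr m \<pi>2 (u (v, w)) \<noteq> 0" by force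
  have "ipr m \<pi>2 (u (v, w)) = ipr m \<pi>1 v * ipr m \<pi>2 w - ipr m \<pi>2 v * ipr m \<pi>1 w" for v w
    unfolding u_def by (simp add: ipr_diff ipr_scale)
  with \<pi>2 have "\<forall>(v, w)\<in>VW. ipr m \<pi>1 v * ipr m \<pi>2 w \<noteq> ipr m \<pi>2 v * ipr m \<pi>1 w" by fastforce
  then show ?thesis by blast
qed

section \<open>Reduction modulo powers of an exponential sum\<close>

definition box :: "nat \<Rightarrow> int \<Rightarrow> int \<Rightarrow> (nat \<Rightarrow> int) set" where
  "box m l h = {y. (\<forall>i<m. l \<le> y i \<and> y i \<le> h) \<and> (\<forall>i\<ge>m. y i = 0)}"

definition halfspace :: "nat \<Rightarrow> (nat \<Rightarrow> int) \<Rightarrow> (nat \<Rightarrow> int) \<Rightarrow> real \<Rightarrow> real \<Rightarrow> real \<Rightarrow> int \<Rightarrow> (nat \<Rightarrow> int) set" where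
  "halfspace m \<pi>1 \<pi>2 l1 l2 h r =
     {y. (\<forall>i\<ge>m. y i = 0) \<and> l1 * ipr m \<pi>1 y + l2 * ipr m \<pi>2 y \<le> h \<and> (\<forall>i. \<bar>y i\<bar> \<le> r)}"

lemma halfspace_add:
  assumes "y \<in> halfspace m \<pi>1 \<pi>2 l1 l2 h r" "y' \<in> halfspace m \<pi>1 \<pi>2 l1 l2 h' r'"
  shows "(\<lambda>i. y i + y' i) \<in> halfspace m \<pi>1 \<pi>2 l1 l2 (h + h') (r + r')"
proof -
  have "\<bar>y i + y' i\<bar> \<le> r + r'" for i
  proof -
    have "\<bar>y i\<bar> \<le> r" "\<bar>y' i\<bar> \<le> r'" using assms by (auto simp: halfspace_def)
    then show ?thesis by linarith
  qed
  then show ?thesis using assms by (auto simp: halfspace_def ipr_add algebra_simps)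
qed

lemma comb_halfspace_power:
  assumes "comb m \<int> (halfspace m \<pi>1 \<pi>2 l1 l2 h r) B F"
  shows "comb m \<int> (halfspace m \<pi>1 \<pi>2 l1 l2 (real n * h) (int n * r)) (B ^ n) (\<lambda>\<theta>. F \<theta> ^ n)"
proof (induction n)
  case 0
  have "comb m \<int> (halfspace m \<pi>1 \<pi>2 l1 l2 0 0) 1 (\<lambda>\<theta>. 1 * echar m (\<lambda>_. 0) \<theta>)"
    by (rule comb_monom) (auto simp: halfspace_def ipr_def)
  then show ?case by simp
next
  case (Suc n)
  have "comb m \<int> (halfspace m \<pi>1 \<pi>2 l1 l2 (h + real n * h) (r + int n * r)) (B * B ^ n) (\<lambda>\<theta>. F \<theta> * F \<theta> ^ n)"
    by (rule comb_mult[OF assms Suc]) (auto intro: halfspace_add)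
  then show ?case by (simp add: algebra_simps)
qed

text \<open>The exponents \<open>a j\<close> will be the columns of a basis matrix of the subgroup,
  with the zero column for the constant term 1. \<open>indep4\<close> is the hypothesis on the
  subgroup in these coordinates, and \<open>indep3\<close> expresses that the rank is at least
  2.\<close>

locale character_sum =
  fixes m :: nat and a :: "'j::finite \<Rightarrow> nat \<Rightarrow> int"
  assumes supp: "\<And>j i. i \<ge> m \<Longrightarrow> a j i = 0"
    and indep4: "\<And>i j k l \<alpha> \<beta>. distinct [i, j, k, l] \<Longrightarrow> (\<alpha>, \<beta>) \<noteq> (0, 0) \<Longrightarrow>
        \<exists>r<m. \<alpha> * (a i r - a j r) + \<beta> * (a k r - a l r) \<noteq> 0"
    and indep3: "\<exists>i j k. \<forall>\<alpha> \<beta>. (\<alpha>, \<beta>) \<noteq> (0, 0) \<longrightarrow>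
        (\<exists>r<m. \<alpha> * (a i r - a k r) + \<beta> * (a j r - a k r) \<noteq> 0)"
begin

definition csum :: "(nat \<Rightarrow> real) \<Rightarrow> complex" where
  "csum \<theta> = (\<Sum>j\<in>UNIV. echar m (a j) \<theta>)"

definition n1 :: real where "n1 = real CARD('j)"

lemma n1_ge1: "n1 \<ge> 1"
  unfolding n1_def by (simp add: Suc_leI)

lemma norm_csum: "cmod (csum \<theta>) \<le> n1"
  unfolding csum_def n1_def by (rule order_trans[OF norm_sum]) simp

definition amax :: int where "amax = 1 + (\<Sum>j\<in>UNIV. \<Sum>i<m. \<bar>a j i\<bar>)"

lemma amax: "\<bar>a j i\<bar> \<le> amax"
proof (cases "i < m")
  case True
  have "\<bar>a j i\<bar> \<le> (\<Sum>i<m. \<bar>a j i\<bar>)" using True by (intro member_le_sum) auto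
  also have "\<dots> \<le> (\<Sum>j\<in>UNIV. \<Sum>i<m. \<bar>a j i\<bar>)"
    by (rule member_le_sum[of j UNIV "\<lambda>j. \<Sum>i<m. \<bar>a j i\<bar>"]) (auto intro: sum_nonneg)
  finally show ?thesis by (simp add: amax_def)
next
  case False
  then show ?thesis by (simp add: supp amax_def sum_nonneg)
qed

lemma amax1: "amax \<ge> 1"
  by (simp add: amax_def sum_nonneg)

text \<open>Only finitely many pairs of differences have to stay independent, so a generic
  projection to a plane preserves the hypotheses of \<open>extremal_gap\<close>. The non-zero minor
  of the projection is kept for counting lattice points in the strip.\<close>

lemma projection_gap:
  "\<exists>\<pi>1 \<pi>2 g. g > 0 \<and> (\<exists>i<m. \<exists>j<m. \<pi>1 i * \<pi>2 j \<noteq> \<pi>1 j * \<pi>2 i) \<and>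
     (\<forall>(l1::real) (l2::real). \<exists>j. \<exists>\<tau>\<in>{1,-1::int}. \<forall>i. i \<noteq> j \<longrightarrow>
        g * sqrt (l1\<^sup>2 + l2\<^sup>2) \<le> \<tau> * (l1 * (ipr m \<pi>1 (a j) - ipr m \<pi>1 (a i)) + l2 * (ipr m \<pi>2 (a j) - ipr m \<pi>2 (a i))))"
proof -
  from indep3 obtain i0 j0 k0 where i3: "\<And>\<alpha> \<beta>. (\<alpha>, \<beta>) \<noteq> (0, 0) \<Longrightarrow>
        (\<exists>r<m. \<alpha> * (a i0 r - a k0 r) + \<beta> * (a j0 r - a k0 r) \<noteq> 0)" by blast
  define VW where "VW = insert ((\<lambda>r. a i0 r - a k0 r), (\<lambda>r. a j0 r - a k0 r))
     ((\<lambda>(i, j, k, l). ((\<lambda>r. a i r - a j r), (\<lambda>r. a k r - a l r))) ` {(i, j, k, l). distinct [i, j, k, l]})"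
  have "\<exists>\<pi>1 \<pi>2. \<forall>(v, w)\<in>VW. ipr m \<pi>1 v * ipr m \<pi>2 w \<noteq> ipr m \<pi>2 v * ipr m \<pi>1 w"
  proof (rule ex_projection_independent)
    show "finite VW" unfolding VW_def by simp
    fix v w :: "nat \<Rightarrow> int" and \<alpha> \<beta> :: int
    assume vw: "(v, w) \<in> VW" and ab: "(\<alpha>, \<beta>) \<noteq> (0, 0)"
    then consider "v = (\<lambda>r. a i0 r - a k0 r)" "w = (\<lambda>r. a j0 r - a k0 r)"
      | i j k l where "distinct [i, j, k, l]" "v = (\<lambda>r. a i r - a j r)" "w = (\<lambda>r. a k r - a l r)"
      unfolding VW_def by auto
    then show "\<exists>i<m. \<alpha> * v i + \<beta> * w i \<noteq> 0"
    proof cases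
      case 1
      then show ?thesis using i3[OF ab] by simp
    next
      case 2
      then show ?thesis using indep4[OF 2(1) ab] by simp
    qed
  qed
  then obtain \<pi>1 \<pi>2 where pp: "\<And>v w. (v, w) \<in> VW \<Longrightarrow> ipr m \<pi>1 v * ipr m \<pi>2 w \<noteq> ipr m \<pi>2 v * ipr m \<pi>1 w"
    by blast
  define q1 q2 where "q1 j = ipr m \<pi>1 (a j)" and "q2 j = ipr m \<pi>2 (a j)" for j
  have H4: "(q1 i - q1 j) * (q2 k - q2 l) \<noteq> (q2 i - q2 j) * (q1 k - q1 l)" if d: "distinct [i, j, k, l]" for i j k l
  proof -
    have "((\<lambda>r. a i r - a j r), (\<lambda>r. a k r - a l r)) \<in> VW"
      unfolding VW_def using d by (auto intro!: image_eqI[of _ _ "(i, j, k, l)"])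
    from pp[OF this] show ?thesis by (simp add: ipr_diff q1_def q2_def)
  qed
  have "((\<lambda>r. a i0 r - a k0 r), (\<lambda>r. a j0 r - a k0 r)) \<in> VW" unfolding VW_def by simp
  from pp[OF this] have H3: "(q1 i0 - q1 k0) * (q2 j0 - q2 k0) \<noteq> (q2 i0 - q2 k0) * (q1 j0 - q1 k0)"
    by (simp add: ipr_diff q1_def q2_def)
  \<comment> \<open>If all minors of the two functionals vanished, so would the determinant for
    every pair \<open>v\<close>, \<open>w\<close>, by Cauchy-Binet.\<close>
  have "\<exists>i<m. \<exists>j<m. \<pi>1 i * \<pi>2 j \<noteq> \<pi>1 j * \<pi>2 i"
  proof (rule ccontr)
    assume "\<not> ?thesis"
    then have eq: "\<pi>1 i * \<pi>2 j = \<pi>1 j * \<pi>2 i" if "i < m" "j < m" for i j using that by blast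
    have "ipr m \<pi>1 v * ipr m \<pi>2 w = ipr m \<pi>2 v * ipr m \<pi>1 w" for v w
    proof -
      have "ipr m \<pi>1 v * ipr m \<pi>2 w = (\<Sum>i<m. \<Sum>j<m. (\<pi>1 i * \<pi>2 j) * (v i * w j))"
        by (simp add: ipr_def sum_product mult_ac)
      also have "\<dots> = (\<Sum>i<m. \<Sum>j<m. (\<pi>1 j * \<pi>2 i) * (v i * w j))"
        by (intro sum.cong refl) (use eq in auto)
      also have "\<dots> = ipr m \<pi>2 v * ipr m \<pi>1 w"
        unfolding ipr_def sum_product by (simp add: mult_ac)
      finally show ?thesis .
    qed
    then show False using pp[OF \<open>_ \<in> VW\<close>] by blast
  qed
  moreover have "\<exists>g>0. \<forall>(l1::real) (l2::real). \<exists>j. \<exists>\<tau>\<in>{1,-1::int}. \<forall>i. i \<noteq> j \<longrightarrow>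
           g * sqrt (l1\<^sup>2 + l2\<^sup>2) \<le> \<tau> * (l1 * (q1 j - q1 i) + l2 * (q2 j - q2 i))"
    by (rule extremal_gap) (use H4 H3 in blast)+
  ultimately show ?thesis unfolding q1_def q2_def by blast
qed

text \<open>
  Let \<open>\<mu>\<close> be the exponent that is extremal in the direction of \<open>x\<close>, up to sign. The monomial \<open>\<mu>\<close> equals \<open>P - L\<close>
  with shorter \<open>L\<close>, and in the expansion of \<open>(P - L)\<^bsup>2k\<^esup>\<close> every term either contains \<open>P\<^sup>k\<close> or at least \<open>k\<close>
  factors \<open>L\<close>.
\<close>

lemma reduction_step:
  fixes \<pi>1 \<pi>2 :: "nat \<Rightarrow> int" and g cp :: real and k :: nat
  defines "nrm y \<equiv> sqrt ((real_of_int (ipr m \<pi>1 y))\<^sup>2 + (real_of_int (ipr m \<pi>2 y))\<^sup>2)"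
  assumes g: "g > 0" and gap: "\<forall>(l1::real) (l2::real). \<exists>j. \<exists>\<tau>\<in>{1,-1::int}. \<forall>i. i \<noteq> j \<longrightarrow>
        g * sqrt (l1\<^sup>2 + l2\<^sup>2) \<le> \<tau> * (l1 * (ipr m \<pi>1 (a j) - ipr m \<pi>1 (a i)) + l2 * (ipr m \<pi>2 (a j) - ipr m \<pi>2 (a i)))"
    and cp: "\<And>y r. (\<And>i. \<bar>y i\<bar> \<le> r) \<Longrightarrow> nrm y \<le> cp * real_of_int r"
    and x0: "\<And>i. i \<ge> m \<Longrightarrow> x i = 0" and xD: "\<And>i. \<bar>x i\<bar> \<le> D"
    and big: "nrm x \<ge> real k * g" "nrm x * g \<ge> real k * (4 * amax * cp)\<^sup>2"
  shows "\<exists>F. comb m \<int> {y. (\<forall>i\<ge>m. y i = 0) \<and> nrm y \<le> nrm x - g * k / 2 \<and> (\<forall>i. \<bar>y i\<bar> \<le> D + 4 * int k * amax)}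
          ((4 * n1\<^sup>2) ^ k) F \<and> (\<forall>\<theta>. cmod (echar m x \<theta> - F \<theta>) \<le> (4 * n1\<^sup>2) ^ k * cmod (csum \<theta>) ^ k)"
proof -
  define l1 l2 where "l1 = real_of_int (ipr m \<pi>1 x)" and "l2 = real_of_int (ipr m \<pi>2 x)"
  define X where "X = nrm x"
  have X: "X = sqrt (l1\<^sup>2 + l2\<^sup>2)" by (simp add: X_def nrm_def l1_def l2_def)
  have X0: "X \<ge> 0" by (simp add: X)
  from spec[OF spec[OF gap, of l1], of l2] obtain j \<tau> where j: "\<tau> \<in> {1,-1::int}" "\<And>i. i \<noteq> j \<Longrightarrow>
      g * X \<le> \<tau> * (l1 * (ipr m \<pi>1 (a j) - ipr m \<pi>1 (a i)) + l2 * (ipr m \<pi>2 (a j) - ipr m \<pi>2 (a i)))"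
    unfolding X by blast
  define b where "b i = (\<lambda>r. \<tau> * a i r)" for i
  define \<mu> where "\<mu> = b j"
  define h where "h = l1 * ipr m \<pi>1 \<mu> + l2 * ipr m \<pi>2 \<mu>"
  define P L where "P \<theta> = (\<Sum>i\<in>UNIV. echar m (b i) \<theta>)" and "L \<theta> = (\<Sum>i\<in>-{j}. echar m (b i) \<theta>)" for \<theta>
  let ?H = "halfspace m \<pi>1 \<pi>2 l1 l2"
  \<comment> \<open>A gap at the minimum (\<open>\<tau> = -1\<close>) is treated with negated
    exponents. This replaces the sum by its conjugate and leaves the modulus alone.\<close>
  have normP: "cmod (P \<theta>) = cmod (csum \<theta>)" for \<theta>
  proof (cases "\<tau> = 1")
    case True
    then show ?thesis by (simp add: P_def csum_def b_def)
  next
    case False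
    then have "P \<theta> = cnj (csum \<theta>)" using j(1) by (simp add: P_def csum_def b_def echar_uminus)
    then show ?thesis by simp
  qed
  have PL: "echar m \<mu> \<theta> = P \<theta> - L \<theta>" for \<theta>
    by (simp add: P_def L_def \<mu>_def Compl_eq_Diff_UNIV sum_diff1)
  have hb: "l1 * ipr m \<pi>1 (b i) + l2 * ipr m \<pi>2 (b i) \<le> h - g * X" if "i \<noteq> j" for i
    using j(2)[OF that] by (simp add: h_def \<mu>_def b_def ipr_scale algebra_simps)
  have bsupp: "b i r = 0" if "r \<ge> m" for i r using supp that by (simp add: b_def)
  have bb: "\<bar>b i r\<bar> \<le> amax" for i r using amax[of i r] j(1) by (auto simp: b_def abs_mult)
  have gX: "g * X \<ge> 0" using g X0 by simp
  have bH: "b i \<in> ?H h amax" for i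
    using hb[of i] gX bsupp bb by (cases "i = j") (auto simp: halfspace_def h_def \<mu>_def)
  have bHL: "b i \<in> ?H (h - g * X) amax" if "i \<noteq> j" for i
    using hb[OF that] bsupp bb by (auto simp: halfspace_def)
  have e1: "comb m \<int> (?H h' r) 1 (\<lambda>\<theta>. echar m y \<theta>)" if "y \<in> ?H h' r" for h' r y
    using comb_monom[of 1 \<int> y "?H h' r" 1 m] that by simp
  have cP: "comb m \<int> (?H h amax) n1 P"
    using comb_sum[of UNIV m \<int> "?H h amax" "\<lambda>_. 1" "\<lambda>i. echar m (b i)"] e1 bH
    by (simp add: P_def[abs_def] n1_def)
  have cL: "comb m \<int> (?H (h - g * X) amax) n1 L"
  proof -
    have "comb m \<int> (?H (h - g * X) amax) (\<Sum>i\<in>-{j}. 1) L"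
      unfolding L_def[abs_def] by (rule comb_sum) (use e1 bHL in auto)
    then show ?thesis by (rule comb_mono) (auto simp: n1_def intro!: card_mono)
  qed
  have normL: "cmod (L \<theta>) \<le> n1" for \<theta> using comb_norm[OF cL] .
  define c where "c i = of_nat (2 * k choose i) * (-1 :: complex) ^ (2 * k - i)" for i
  have cZ: "c i \<in> \<int>" for i by (simp add: c_def)
  have normc: "cmod (c i) = real (2 * k choose i)" for i by (simp add: c_def norm_mult norm_power)
  define G where "G = (\<lambda>\<theta>. \<Sum>i<k. c i * (P \<theta> ^ i * L \<theta> ^ (2 * k - i)))"
  define G' where "G' = (\<lambda>\<theta>. \<Sum>i=k..2*k. c i * (P \<theta> ^ i * L \<theta> ^ (2 * k - i)))"
  have expand: "echar m \<mu> \<theta> ^ (2 * k) = G \<theta> + G' \<theta>" for \<theta>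
  proof -
    have "echar m \<mu> \<theta> ^ (2 * k) = (P \<theta> + - L \<theta>) ^ (2 * k)" by (simp add: PL)
    also have "\<dots> = (\<Sum>i\<le>2*k. of_nat (2 * k choose i) * P \<theta> ^ i * (- L \<theta>) ^ (2 * k - i))"
      by (rule binomial_ring)
    also have "\<dots> = (\<Sum>i\<le>2*k. c i * (P \<theta> ^ i * L \<theta> ^ (2 * k - i)))"
      by (intro sum.cong refl) (subst power_minus, simp add: c_def mult_ac)
    also have "{..2*k} = {..<k} \<union> {k..2*k}" by auto
    also have "(\<Sum>i\<in>{..<k} \<union> {k..2*k}. c i * (P \<theta> ^ i * L \<theta> ^ (2 * k - i))) = G \<theta> + G' \<theta>"
      unfolding G_def G'_def by (rule sum.union_disjoint) auto
    finally show ?thesis .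
  qed
  have bin: "(\<Sum>i\<in>I. real (2 * k choose i)) \<le> 4 ^ k" if "I \<subseteq> {..2*k}" for I
  proof -
    have "(\<Sum>i\<in>I. real (2 * k choose i)) \<le> (\<Sum>i\<le>2*k. real (2 * k choose i))"
      using that by (intro sum_mono2) auto
    also have "\<dots> = real (\<Sum>i\<le>2*k. 2 * k choose i)" by simp
    also have "\<dots> = 4 ^ k" by (simp only: choose_row_sum) (simp add: power_mult)
    finally show ?thesis .
  qed
  have cG: "comb m \<int> (?H (2 * real k * h - real k * (g * X)) (2 * int k * amax)) ((4 * n1\<^sup>2) ^ k) G"
  proof -
    have "comb m \<int> (?H (2 * real k * h - real k * (g * X)) (2 * int k * amax)) (\<Sum>i<k. n1 ^ (2 * k) * cmod (c i)) G"
      unfolding G_def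
    proof (rule comb_sum, simp, rule comb_scale[OF _ cZ])
      fix i assume "i \<in> {..<k}"
      then have i: "i < k" by simp
      have r: "real (2 * k - i) = 2 * real k - real i" "int (2 * k - i) = 2 * int k - int i" using i by auto
      have "comb m \<int> (?H (2 * real k * h - real k * (g * X)) (2 * int k * amax)) (n1 ^ i * n1 ^ (2 * k - i))
              (\<lambda>\<theta>. P \<theta> ^ i * L \<theta> ^ (2 * k - i))"
      proof (rule comb_mult[OF comb_halfspace_power[OF cP, of i] comb_halfspace_power[OF cL, of "2 * k - i"]])
        fix y y' assume "y \<in> ?H (real i * h) (int i * amax)"
          "y' \<in> ?H (real (2 * k - i) * (h - g * X)) (int (2 * k - i) * amax)"
        then have "(\<lambda>r. y r + y' r) \<in> ?H (real i * h + real (2 * k - i) * (h - g * X)) (int i * amax + int (2 * k - i) * amax)"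
          by (rule halfspace_add)
        moreover have "int i * amax + int (2 * k - i) * amax = 2 * int k * amax"
          unfolding r by (simp add: algebra_simps)
        \<comment> \<open>Every factor \<open>L\<close> lowers the linear form by
          \<open>g * X\<close>, and for \<open>i < k\<close> there are more than \<open>k\<close>
          such factors.\<close>
        moreover have "real i * h + real (2 * k - i) * (h - g * X) \<le> 2 * real k * h - real k * (g * X)"
        proof -
          have "real k * (g * X) \<le> (2 * real k - real i) * (g * X)" using gX i by (intro mult_right_mono) auto
          then show ?thesis unfolding r by (simp add: algebra_simps)
        qed
        ultimately show "(\<lambda>r. y r + y' r) \<in> ?H (2 * real k * h - real k * (g * X)) (2 * int k * amax)"
          by (auto simp: halfspace_def)
      qed auto
      then show "comb m \<int> (?H (2 * real k * h - real k * (g * X)) (2 * int k * amax)) (n1 ^ (2 * k))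
              (\<lambda>\<theta>. P \<theta> ^ i * L \<theta> ^ (2 * k - i))"
        using i by (simp add: power_add[symmetric])
    qed auto
    moreover have "(\<Sum>i<k. n1 ^ (2 * k) * cmod (c i)) \<le> (4 * n1\<^sup>2) ^ k"
    proof -
      have "(\<Sum>i<k. n1 ^ (2 * k) * cmod (c i)) = n1 ^ (2 * k) * (\<Sum>i<k. real (2 * k choose i))"
        by (simp add: normc sum_distrib_left)
      also have "\<dots> \<le> n1 ^ (2 * k) * 4 ^ k" using n1_ge1 by (intro mult_left_mono bin) auto
      also have "\<dots> = (4 * n1\<^sup>2) ^ k" by (simp add: power_mult power_mult_distrib)
      finally show ?thesis .
    qed
    ultimately show ?thesis by (rule comb_mono[OF _ order_refl order_refl])
  qed
  have bG': "cmod (G' \<theta>) \<le> (4 * n1\<^sup>2) ^ k * cmod (csum \<theta>) ^ k" for \<theta>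
  proof -
    have tm: "cmod (c i * (P \<theta> ^ i * L \<theta> ^ (2 * k - i))) \<le> real (2 * k choose i) * (n1 ^ k * cmod (csum \<theta>) ^ k)"
      if "i \<in> {k..2*k}" for i
    proof -
      define d where "d = i - k"
      have d: "i = k + d" using that by (simp add: d_def)
      have dk: "d + (2 * k - i) = k" using that d by auto
      have "cmod (P \<theta> ^ i * L \<theta> ^ (2 * k - i)) = cmod (csum \<theta>) ^ k * (cmod (csum \<theta>) ^ d * cmod (L \<theta>) ^ (2 * k - i))"
        by (simp add: norm_mult norm_power normP d power_add)
      also have "\<dots> \<le> cmod (csum \<theta>) ^ k * (n1 ^ d * n1 ^ (2 * k - i))"
        using n1_ge1 by (intro mult_left_mono mult_mono power_mono norm_csum normL) auto
      also have "\<dots> = n1 ^ k * cmod (csum \<theta>) ^ k" by (simp add: power_add[symmetric] dk)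
      finally show ?thesis by (simp add: norm_mult normc mult_left_mono)
    qed
    have "cmod (G' \<theta>) \<le> (\<Sum>i=k..2*k. real (2 * k choose i) * (n1 ^ k * cmod (csum \<theta>) ^ k))"
      unfolding G'_def by (rule order_trans[OF norm_sum]) (intro sum_mono tm)
    also have "\<dots> = (\<Sum>i=k..2*k. real (2 * k choose i)) * (n1 ^ k * cmod (csum \<theta>) ^ k)"
      by (simp add: sum_distrib_right)
    also have "\<dots> \<le> 4 ^ k * (n1 ^ k * cmod (csum \<theta>) ^ k)"
      using n1_ge1 by (intro mult_right_mono bin) auto
    also have "\<dots> \<le> 4 ^ k * (n1 ^ (2 * k) * cmod (csum \<theta>) ^ k)"
      using n1_ge1 by (intro mult_left_mono mult_right_mono power_increasing) auto
    also have "n1 ^ (2 * k) = (n1\<^sup>2) ^ k" by (rule power_mult)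
    finally show ?thesis by (simp only: power_mult_distrib mult.assoc)
  qed
  \<comment> \<open>The monomial \<open>x\<close> is split as the power \<open>2 k\<close> of
    \<open>\<mu>\<close> times \<open>y0\<close>, and only the power of \<open>\<mu>\<close> is
    rewritten.\<close>
  define y0 where "y0 = (\<lambda>r. x r - 2 * int k * \<mu> r)"
  define F where "F = (\<lambda>\<theta>. G \<theta> * (1 * echar m y0 \<theta>))"
  have ex: "echar m x \<theta> = echar m \<mu> \<theta> ^ (2 * k) * echar m y0 \<theta>" for \<theta>
    by (simp add: echar_power echar_add[symmetric] y0_def)
  have "echar m x \<theta> - F \<theta> = G' \<theta> * echar m y0 \<theta>" for \<theta>
    unfolding ex expand F_def by (simp add: algebra_simps)
  then have err: "cmod (echar m x \<theta> - F \<theta>) \<le> (4 * n1\<^sup>2) ^ k * cmod (csum \<theta>) ^ k" for \<theta>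
    using bG'[of \<theta>] by (simp add: norm_mult)
  have "comb m \<int> {y. (\<forall>i\<ge>m. y i = 0) \<and> nrm y \<le> nrm x - g * k / 2 \<and> (\<forall>i. \<bar>y i\<bar> \<le> D + 4 * int k * amax)}
          ((4 * n1\<^sup>2) ^ k * cmod 1) F"
    unfolding F_def
  proof (rule comb_mult_monom[OF cG])
    fix z assume z: "z \<in> ?H (2 * real k * h - real k * (g * X)) (2 * int k * amax)"
    define w where "w = (\<lambda>r. z r - 2 * int k * \<mu> r)"
    have zw: "(\<lambda>r. z r + y0 r) = (\<lambda>r. x r + w r)" by (auto simp: w_def y0_def)
    have \<mu>b: "\<bar>\<mu> r\<bar> \<le> amax" for r by (simp add: \<mu>_def bb)
    have wb: "\<bar>w r\<bar> \<le> 4 * int k * amax" for r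
    proof -
      have "\<bar>z r\<bar> \<le> 2 * int k * amax" using z by (simp add: halfspace_def)
      moreover have "\<bar>2 * int k * \<mu> r\<bar> \<le> 2 * int k * amax"
        unfolding abs_mult using \<mu>b[of r] by (simp add: mult_left_mono)
      ultimately show ?thesis unfolding w_def by linarith
    qed
    have wm: "w r = 0" if "r \<ge> m" for r using z that bsupp by (simp add: halfspace_def w_def \<mu>_def)
    define w1 w2 where "w1 = real_of_int (ipr m \<pi>1 w)" and "w2 = real_of_int (ipr m \<pi>2 w)"
    have lw: "l1 * w1 + l2 * w2 \<le> - (real k * (g * X))"
    proof -
      have iw: "ipr m \<pi> w = ipr m \<pi> z - 2 * int k * ipr m \<pi> \<mu>" for \<pi>
        unfolding w_def ipr_diff ipr_scale ..
      have "l1 * w1 + l2 * w2 = l1 * ipr m \<pi>1 z + l2 * ipr m \<pi>2 z - 2 * real k * h"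
        unfolding w1_def w2_def iw by (simp add: h_def algebra_simps)
      then show ?thesis using z by (simp add: halfspace_def)
    qed
    have nw: "sqrt (w1\<^sup>2 + w2\<^sup>2) \<le> real k * (4 * amax * cp)"
      using cp[of w "4 * int k * amax"] wb by (simp add: nrm_def w1_def w2_def mult_ac)
    have "w1\<^sup>2 + w2\<^sup>2 \<le> (real k * (4 * amax * cp))\<^sup>2"
      using nw by (simp add: real_sqrt_le_iff' sqrt_le_D)
    also have "\<dots> = real k * (real k * (4 * amax * cp)\<^sup>2)" by (simp add: power2_eq_square mult_ac)
    also have "\<dots> \<le> real k * (X * g)" using big(2) by (intro mult_left_mono) (auto simp: X_def)
    finally have ww: "w1\<^sup>2 + w2\<^sup>2 \<le> real k * (X * g)" .
    \<comment> \<open>The linear term gains \<open>2 k g X\<close>. The displacement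
      \<open>w\<close> has length \<open>O(k)\<close>, and the second part of \<open>big\<close>
      makes its square cost at most \<open>k g X\<close>, so half of the gain survives.\<close>
    have "(l1 + w1)\<^sup>2 + (l2 + w2)\<^sup>2 = X\<^sup>2 + 2 * (l1 * w1 + l2 * w2) + (w1\<^sup>2 + w2\<^sup>2)"
      by (simp add: X power2_eq_square algebra_simps)
    also have "\<dots> \<le> X\<^sup>2 - real k * (X * g)" using lw ww by (simp add: mult_ac)
    also have "\<dots> = (X - g * k / 2)\<^sup>2 - (g * k / 2)\<^sup>2" by (simp add: power2_eq_square algebra_simps)
    also have "\<dots> \<le> (X - g * k / 2)\<^sup>2" by simp
    finally have "sqrt ((l1 + w1)\<^sup>2 + (l2 + w2)\<^sup>2) \<le> sqrt ((X - g * k / 2)\<^sup>2)"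
      by (rule real_sqrt_le_mono)
    moreover have "X - g * k / 2 \<ge> 0"
    proof -
      have "real k * g \<ge> 0" using g by simp
      moreover have "g * real k = real k * g" by (rule mult.commute)
      ultimately show ?thesis using big(1) unfolding X_def by linarith
    qed
    ultimately have "nrm (\<lambda>r. x r + w r) \<le> X - g * k / 2"
      by (simp add: nrm_def ipr_add l1_def l2_def w1_def w2_def)
    moreover have "\<bar>x r + w r\<bar> \<le> D + 4 * int k * amax" for r
      using xD[of r] wb[of r] by linarith
    ultimately show "(\<lambda>r. z r + y0 r) \<in> {y. (\<forall>i\<ge>m. y i = 0) \<and> nrm y \<le> nrm x - g * k / 2 \<and> (\<forall>i. \<bar>y i\<bar> \<le> D + 4 * int k * amax)}"
      unfolding zw using x0 wm by (simp add: X_def)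
  qed auto
  with err show ?thesis by auto
qed

end

lemma finite_card_box: "finite (box m l h)" "card (box m l h) = nat (h - l + 1) ^ m"
proof -
  have b: "bij_betw (\<lambda>y. restrict y {..<m}) (box m l h) (PiE {..<m} (\<lambda>_. {l..h}))"
  proof (rule bij_betwI[where g = "\<lambda>f i. if i < m then f i else 0"])
    show "(\<lambda>y. restrict y {..<m}) \<in> box m l h \<rightarrow> (PiE {..<m} (\<lambda>_. {l..h}))"
      by (auto simp: box_def)
    show "(\<lambda>f i. if i < m then f i else 0) \<in> (PiE {..<m} (\<lambda>_. {l..h})) \<rightarrow> box m l h"
      by (auto simp: box_def PiE_iff)
    show "(\<lambda>i. if i < m then restrict x {..<m} i else 0) = x" if "x \<in> box m l h" for x
      using that by (auto simp: box_def)
    show "restrict (\<lambda>i. if i < m then y i else 0) {..<m} = y" if "y \<in> (PiE {..<m} (\<lambda>_. {l..h}))" for y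
      using that by (auto simp: PiE_iff extensional_def restrict_def)
  qed
  have "card (PiE {..<m} (\<lambda>_. {l..h})) = nat (h - l + 1) ^ m"
    by (simp add: card_PiE)
  then show "finite (box m l h)" "card (box m l h) = nat (h - l + 1) ^ m"
    using bij_betw_finite[OF b] bij_betw_same_card[OF b] by (auto simp: finite_PiE)
qed

text \<open>The non-zero minor at \<open>i0\<close>, \<open>j0\<close> recovers these two
  coordinates from the two projections and the remaining \<open>m - 2\<close> coordinates. Two
  factors \<open>D\<close> are thus traded for two factors \<open>R\<close>, which will be much
  smaller.\<close>

lemma card_strip:
  fixes \<pi>1 \<pi>2 :: "nat \<Rightarrow> int" and R D :: nat
  assumes ij: "i0 < m" "j0 < m" and det: "\<pi>1 i0 * \<pi>2 j0 \<noteq> \<pi>1 j0 * \<pi>2 i0"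
  defines "Y \<equiv> {y. (\<forall>i\<ge>m. y i = 0) \<and> \<bar>ipr m \<pi>1 y\<bar> \<le> int R \<and> \<bar>ipr m \<pi>2 y\<bar> \<le> int R \<and> (\<forall>i. \<bar>y i\<bar> \<le> int D)}"
  shows "finite Y \<and> card Y \<le> (2 * R + 1)\<^sup>2 * (2 * D + 1) ^ (m - 2)"
proof -
  define S where "S = {..<m} - {i0, j0}"
  have ne: "i0 \<noteq> j0" using det by auto
  have cS: "card S = m - 2" "finite S" using ij ne by (auto simp: S_def card_Diff_subset)
  define f where "f y = (ipr m \<pi>1 y, ipr m \<pi>2 y, restrict y S)" for y :: "nat \<Rightarrow> int"
  let ?T = "{- int R..int R} \<times> {- int R..int R} \<times> (PiE S (\<lambda>_. {- int D..int D}))"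
  have inj: "inj_on f Y"
  proof (rule inj_onI)
    fix y y' assume y: "y \<in> Y" "y' \<in> Y" "f y = f y'"
    define z where "z = (\<lambda>i. y i - y' i)"
    have zS: "z i = 0" if "i \<in> S" for i
    proof -
      have "restrict y S i = restrict y' S i" using y(3) by (simp add: f_def)
      then show ?thesis using that by (simp add: z_def)
    qed
    have p: "ipr m \<pi> z = \<pi> i0 * z i0 + \<pi> j0 * z j0" for \<pi>
    proof -
      have "ipr m \<pi> z = (\<Sum>i\<in>{i0, j0}. \<pi> i * z i)"
        unfolding ipr_def by (rule sum.mono_neutral_right) (use ij zS in \<open>auto simp: S_def\<close>)
      then show ?thesis using ne by simp
    qed
    have 1: "\<pi>1 i0 * z i0 + \<pi>1 j0 * z j0 = 0" "\<pi>2 i0 * z i0 + \<pi>2 j0 * z j0 = 0"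
      unfolding p[symmetric] using y(3) by (simp_all add: z_def ipr_diff f_def)
    have "(\<pi>1 i0 * \<pi>2 j0 - \<pi>1 j0 * \<pi>2 i0) * z i0 = \<pi>2 j0 * (\<pi>1 i0 * z i0 + \<pi>1 j0 * z j0) - \<pi>1 j0 * (\<pi>2 i0 * z i0 + \<pi>2 j0 * z j0)"
      by (simp add: algebra_simps)
    then have zi: "z i0 = 0" using det 1 by simp
    have "(\<pi>1 i0 * \<pi>2 j0 - \<pi>1 j0 * \<pi>2 i0) * z j0 = \<pi>1 i0 * (\<pi>2 i0 * z i0 + \<pi>2 j0 * z j0) - \<pi>2 i0 * (\<pi>1 i0 * z i0 + \<pi>1 j0 * z j0)"
      by (simp add: algebra_simps)
    then have zj: "z j0 = 0" using det 1 by simp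
    have "z i = 0" for i
    proof (cases "i < m")
      case True
      then show ?thesis using zi zj zS[of i] by (auto simp: S_def)
    next
      case False
      then show ?thesis using y by (simp add: Y_def z_def)
    qed
    then show "y = y'" by (auto simp: z_def)
  qed
  have sub: "f ` Y \<subseteq> ?T" by (auto simp: f_def Y_def abs_le_iff PiE_iff minus_le_iff)
  have fT: "finite ?T" using cS by (intro finite_cartesian_product finite_PiE) auto
  have cI: "card {- int n..int n} = 2 * n + 1" for n
    unfolding card_atLeastAtMost_int by linarith
  have "card ?T = (2 * R + 1)\<^sup>2 * (2 * D + 1) ^ (m - 2)"
    using cS by (simp only: card_cartesian_product card_PiE power2_eq_square cI prod_constant mult.assoc)
  then show ?thesis
    using card_inj_on_le[OF inj sub fT] inj_on_finite[OF inj sub fT] by simp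
qed

section \<open>Iterated reduction and the auxiliary polynomial\<close>

context character_sum
begin

text \<open>Each round shortens by \<open>g k / 2\<close> until the length falls below
  \<open>C2 k\<close>, where the largeness assumptions of \<open>reduction_step\<close> may fail. A
  round multiplies the coefficients by at most \<open>(4 n1^2)^k\<close>, so \<open>O(k)\<close>
  rounds cost only \<open>C^(k^2)\<close>.\<close>

lemma reduction_iterate:
  fixes \<pi>1 \<pi>2 :: "nat \<Rightarrow> int" and g cp C2 :: real and k :: nat
  defines "nrm y \<equiv> sqrt ((real_of_int (ipr m \<pi>1 y))\<^sup>2 + (real_of_int (ipr m \<pi>2 y))\<^sup>2)"
  assumes g: "g > 0" and gap: "\<forall>(l1::real) (l2::real). \<exists>j. \<exists>\<tau>\<in>{1,-1::int}. \<forall>i. i \<noteq> j \<longrightarrow>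
        g * sqrt (l1\<^sup>2 + l2\<^sup>2) \<le> \<tau> * (l1 * (ipr m \<pi>1 (a j) - ipr m \<pi>1 (a i)) + l2 * (ipr m \<pi>2 (a j) - ipr m \<pi>2 (a i)))"
    and cp: "\<And>y r. (\<And>i. \<bar>y i\<bar> \<le> r) \<Longrightarrow> nrm y \<le> cp * real_of_int r"
    and C2: "C2 \<ge> g" "C2 * g \<ge> (4 * amax * cp)\<^sup>2"
  shows "(\<And>i. i \<ge> m \<Longrightarrow> x i = 0) \<Longrightarrow> (\<And>i. \<bar>x i\<bar> \<le> D) \<Longrightarrow> nrm x \<le> C2 * k + real s * (g * k / 2) \<Longrightarrow>
    \<exists>F. comb m \<int> {y. (\<forall>i\<ge>m. y i = 0) \<and> nrm y \<le> C2 * k \<and> (\<forall>i. \<bar>y i\<bar> \<le> D + int s * (4 * int k * amax))}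
          (((4 * n1\<^sup>2) ^ k) ^ s) F \<and> (\<forall>\<theta>. cmod (echar m x \<theta> - F \<theta>) \<le> (2 * (4 * n1\<^sup>2) ^ k) ^ s * cmod (csum \<theta>) ^ k)"
proof (induction s arbitrary: x D)
  case 0
  have "comb m \<int> {y. (\<forall>i\<ge>m. y i = 0) \<and> nrm y \<le> C2 * k \<and> (\<forall>i. \<bar>y i\<bar> \<le> D)} 1 (\<lambda>\<theta>. 1 * echar m x \<theta>)"
    by (rule comb_monom) (use 0 in auto)
  then show ?case by (intro exI[of _ "echar m x"]) simp
next
  case (Suc s)
  let ?M = "(4 * n1\<^sup>2) ^ k"
  have M1: "?M \<ge> 1"
  proof -
    have "1 \<le> n1\<^sup>2" using n1_ge1 by simp
    then show ?thesis by (intro one_le_power) linarith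
  qed
  let ?Y = "\<lambda>D. {y. (\<forall>i\<ge>m. y i = 0) \<and> nrm y \<le> C2 * k \<and> (\<forall>i. \<bar>y i\<bar> \<le> D)}"
  show ?case
  proof (cases "nrm x \<le> C2 * k")
    case True
    have "\<bar>x i\<bar> \<le> D + int (Suc s) * (4 * int k * amax)" for i
    proof -
      have "0 \<le> int (Suc s) * (4 * int k * amax)" using amax1 by simp
      with Suc.prems(2)[of i] show ?thesis by linarith
    qed
    then have "comb m \<int> (?Y (D + int (Suc s) * (4 * int k * amax))) (?M ^ Suc s) (\<lambda>\<theta>. 1 * echar m x \<theta>)"
      by (intro comb_monom) (use Suc True M1 in \<open>auto intro: one_le_power simp del: power_Suc\<close>)
    moreover have "0 \<le> (2 * ?M) ^ Suc s * cmod (csum \<theta>) ^ k" for \<theta> using M1 by (intro mult_nonneg_nonneg) auto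
    ultimately show ?thesis by (intro exI[of _ "echar m x"]) auto
  next
    case False
    have k0: "real k \<ge> 0" by simp
    have "real k * g \<le> real k * C2" by (rule mult_left_mono[OF C2(1) k0])
    also have "\<dots> = C2 * k" by (rule mult.commute)
    finally have "real k * g \<le> C2 * k" .
    then have big1: "nrm x \<ge> real k * g" using False by linarith
    have "real k * (4 * amax * cp)\<^sup>2 \<le> real k * (C2 * g)" by (rule mult_left_mono[OF C2(2) k0])
    also have "\<dots> = (C2 * k) * g" by simp
    also have "\<dots> \<le> nrm x * g" using False g by (intro mult_right_mono) auto
    finally have big2: "nrm x * g \<ge> real k * (4 * amax * cp)\<^sup>2" .
    obtain F where F: "comb m \<int> {y. (\<forall>i\<ge>m. y i = 0) \<and> nrm y \<le> nrm x - g * k / 2 \<and> (\<forall>i. \<bar>y i\<bar> \<le> D + 4 * int k * amax)} ?M F"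
      "\<And>\<theta>. cmod (echar m x \<theta> - F \<theta>) \<le> ?M * cmod (csum \<theta>) ^ k"
      using reduction_step[of g \<pi>1 \<pi>2 cp x D k, folded nrm_def, OF g gap cp Suc.prems(1,2) big1 big2] by auto
    have "\<exists>G. comb m \<int> (?Y (D + int (Suc s) * (4 * int k * amax))) (?M * ?M ^ s) G \<and>
        (\<forall>\<theta>. cmod (F \<theta> - G \<theta>) \<le> ?M * ((2 * ?M) ^ s * cmod (csum \<theta>) ^ k))"
    proof (rule comb_subst[OF F(1)])
      fix y assume "y \<in> {y. (\<forall>i\<ge>m. y i = 0) \<and> nrm y \<le> nrm x - g * k / 2 \<and> (\<forall>i. \<bar>y i\<bar> \<le> D + 4 * int k * amax)}"
      then have y: "\<And>i. i \<ge> m \<Longrightarrow> y i = 0" "\<And>i. \<bar>y i\<bar> \<le> D + 4 * int k * amax" "nrm y \<le> nrm x - g * k / 2" by auto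
      have "nrm y \<le> C2 * k + real s * (g * k / 2)" using y(3) Suc.prems(3) by (simp add: algebra_simps add_divide_distrib)
      from Suc.IH[OF y(1,2) this] obtain G where
        G: "comb m \<int> (?Y (D + 4 * int k * amax + int s * (4 * int k * amax))) (?M ^ s) G"
           "\<forall>\<theta>. cmod (echar m y \<theta> - G \<theta>) \<le> (2 * ?M) ^ s * cmod (csum \<theta>) ^ k" by auto
      have "D + 4 * int k * amax + int s * (4 * int k * amax) = D + int (Suc s) * (4 * int k * amax)"
        by (simp add: algebra_simps)
      with G show "\<exists>G. comb m \<int> (?Y (D + int (Suc s) * (4 * int k * amax))) (?M ^ s) G \<and>
           (\<forall>\<theta>. cmod (echar m y \<theta> - G \<theta>) \<le> (2 * ?M) ^ s * cmod (csum \<theta>) ^ k)" by auto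
    qed (use M1 in \<open>auto intro!: mult_nonneg_nonneg\<close>)
    then obtain G where G: "comb m \<int> (?Y (D + int (Suc s) * (4 * int k * amax))) (?M * ?M ^ s) G"
        "\<And>\<theta>. cmod (F \<theta> - G \<theta>) \<le> ?M * ((2 * ?M) ^ s * cmod (csum \<theta>) ^ k)" by auto
    have "cmod (echar m x \<theta> - G \<theta>) \<le> (2 * ?M) ^ Suc s * cmod (csum \<theta>) ^ k" for \<theta>
    proof -
      let ?c = "cmod (csum \<theta>) ^ k"
      have "cmod (echar m x \<theta> - G \<theta>) \<le> cmod (echar m x \<theta> - F \<theta>) + cmod (F \<theta> - G \<theta>)"
        using norm_triangle_ineq[of "echar m x \<theta> - F \<theta>" "F \<theta> - G \<theta>"] by simp
      also have "\<dots> \<le> ?M * ?c + ?M * ((2 * ?M) ^ s * ?c)" by (intro add_mono F G)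
      \<comment> \<open>The error of the current round is dominated by the bound for the later ones;
        this doubling is the reason for the factor 2 in the error constant.\<close>
      also have "\<dots> \<le> ?M * ((2 * ?M) ^ s * ?c) + ?M * ((2 * ?M) ^ s * ?c)"
      proof -
        have "1 * ?c \<le> (2 * ?M) ^ s * ?c" using M1 by (intro mult_right_mono one_le_power) auto
        then show ?thesis using M1 by (intro add_mono mult_left_mono) auto
      qed
      also have "\<dots> = (2 * ?M) ^ Suc s * ?c" by simp
      finally show ?thesis .
    qed
    with G(1) show ?thesis by auto
  qed
qed

lemma m_ge_2: "m \<ge> 2"
proof -
  from projection_gap obtain \<pi>1 \<pi>2 :: "nat \<Rightarrow> int" and i j where
    "i < m" "j < m" "\<pi>1 i * \<pi>2 j \<noteq> \<pi>1 j * \<pi>2 i" by blast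
  then have "i \<noteq> j" "i < m" "j < m" by auto
  then show ?thesis by linarith
qed

text \<open>
  Thue--Siegel: with exponents in a box of side \<open>k\<^sup>2\<close> and bounded coefficients there are more integer
  Laurent polynomials than there are remainders modulo the \<open>k\<close>-th powers of \<open>P\<close> and its conjugate.
\<close>

lemma auxiliary_polynomial:
  "\<exists>C\<ge>1. \<exists>H::int. \<exists>k0. \<forall>k\<ge>k0. \<exists>h::(nat \<Rightarrow> int) \<Rightarrow> int.
     (\<exists>x\<in>box m 0 (int (k\<^sup>2)). h x \<noteq> 0) \<and> (\<forall>x\<in>box m 0 (int (k\<^sup>2)). \<bar>h x\<bar> \<le> H) \<and>
     (\<forall>\<theta>. cmod (\<Sum>x\<in>box m 0 (int (k\<^sup>2)). of_int (h x) * echar m x \<theta>) \<le> C ^ k\<^sup>2 * cmod (csum \<theta>) ^ k)"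
proof -
  from projection_gap obtain \<pi>1 \<pi>2 :: "nat \<Rightarrow> int" and g :: real and i0 j0 where g: "g > 0"
    and ij: "i0 < m" "j0 < m" "\<pi>1 i0 * \<pi>2 j0 \<noteq> \<pi>1 j0 * \<pi>2 i0"
    and gap: "\<forall>(l1::real) (l2::real). \<exists>j. \<exists>\<tau>\<in>{1,-1::int}. \<forall>i. i \<noteq> j \<longrightarrow>
        g * sqrt (l1\<^sup>2 + l2\<^sup>2) \<le> \<tau> * (l1 * (ipr m \<pi>1 (a j) - ipr m \<pi>1 (a i)) + l2 * (ipr m \<pi>2 (a j) - ipr m \<pi>2 (a i)))"
    by blast
  define nrm where "nrm y = sqrt ((real_of_int (ipr m \<pi>1 y))\<^sup>2 + (real_of_int (ipr m \<pi>2 y))\<^sup>2)" for y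
  define cp where "cp = real_of_int (\<Sum>i<m. \<bar>\<pi>1 i\<bar> + \<bar>\<pi>2 i\<bar>)"
  have cp0: "cp \<ge> 0" by (simp add: cp_def sum_nonneg)
  have cp: "nrm y \<le> cp * real_of_int r" if "\<And>i. \<bar>y i\<bar> \<le> r" for y :: "nat \<Rightarrow> int" and r
  proof -
    have b: "\<bar>ipr m \<pi> y\<bar> \<le> (\<Sum>i<m. \<bar>\<pi> i\<bar>) * r" for \<pi>
    proof -
      have "\<bar>ipr m \<pi> y\<bar> \<le> (\<Sum>i<m. \<bar>\<pi> i * y i\<bar>)" unfolding ipr_def by (rule sum_abs)
      also have "\<dots> \<le> (\<Sum>i<m. \<bar>\<pi> i\<bar> * r)" using that by (intro sum_mono) (simp add: abs_mult mult_left_mono)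
      finally show ?thesis by (simp add: sum_distrib_right)
    qed
    have "nrm y \<le> \<bar>real_of_int (ipr m \<pi>1 y)\<bar> + \<bar>real_of_int (ipr m \<pi>2 y)\<bar>"
      unfolding nrm_def by (rule sqrt_sum_squares_le_sum_abs)
    also have "\<dots> = real_of_int (\<bar>ipr m \<pi>1 y\<bar> + \<bar>ipr m \<pi>2 y\<bar>)" by simp
    also have "\<dots> \<le> real_of_int ((\<Sum>i<m. \<bar>\<pi>1 i\<bar>) * r + (\<Sum>i<m. \<bar>\<pi>2 i\<bar>) * r)"
      by (rule of_int_le_iff[THEN iffD2], rule add_mono[OF b b])
    also have "\<dots> = cp * r" by (simp add: cp_def sum.distrib algebra_simps)
    finally show ?thesis .
  qed
  \<comment> \<open>An integer that meets both threshold conditions at once, so that the strip can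
    be counted with integral width.\<close>
  define C2 where "C2 = real (nat \<lceil>g + (4 * amax * cp)\<^sup>2 / g\<rceil>)"
  have C2': "C2 \<ge> g + (4 * amax * cp)\<^sup>2 / g" unfolding C2_def by (rule real_nat_ceiling_ge)
  have q0: "(4 * amax * cp)\<^sup>2 / g \<ge> 0" using g by simp
  have C2: "C2 \<ge> g" "C2 * g \<ge> (4 * amax * cp)\<^sup>2"
  proof -
    show "C2 \<ge> g" using C2' q0 by linarith
    have "(4 * amax * cp)\<^sup>2 / g \<le> C2" using C2' g by linarith
    then show "C2 * g \<ge> (4 * amax * cp)\<^sup>2" using g by (simp add: pos_divide_le_eq)
  qed
  define c2 where "c2 = nat \<lceil>g + (4 * amax * cp)\<^sup>2 / g\<rceil>"
  have C2c: "C2 = real c2" by (simp add: C2_def c2_def)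
  \<comment> \<open>Exponents in a box of side \<open>k^2\<close> have length at most
    \<open>cp k^2\<close>, and each round removes \<open>g k / 2\<close>; hence
    \<open>sN * k\<close> rounds suffice.\<close>
  define sN where "sN = nat \<lceil>2 * cp / g\<rceil>"
  have sN: "cp \<le> real sN * (g / 2)"
  proof -
    have "2 * cp / g \<le> real sN" unfolding sN_def by (rule real_nat_ceiling_ge)
    then show ?thesis using g by (simp add: field_simps)
  qed
  define A where "A = nat amax"
  have A: "int A = amax" using amax1 by (simp add: A_def)
  define M where "M = 4 * CARD('j)\<^sup>2"
  have Mr: "real M = 4 * n1\<^sup>2" by (simp add: M_def n1_def)
  define C4 where "C4 = 1 + 4 * sN * A"
  define Q where "Q = (2 * M) ^ sN"
  define C5 where "C5 = (2 * c2 + 1)\<^sup>2 * (2 * C4 + 1) ^ (m - 2)"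
  define Q' where "Q' = 3 * 2 ^ m * Q"
  \<comment> \<open>Each of the at most \<open>C5 N^(m-1)\<close> remainder coefficients takes at
    most \<open>Q'^(2 N)\<close> values. There are thus at most
    \<open>Q'^(2 C5 N^m) = H^(N^m)\<close> images, fewer than the \<open>(H + 1)^((N + 1)^m)\<close>
    coefficient vectors in the box. This \<open>H\<close> does not depend on
    \<open>k\<close>.\<close>
  define H where "H = Q' ^ (2 * C5)"
  have M1: "M \<ge> 1" by (simp add: M_def Suc_leI)
  have Q1: "Q \<ge> 1" using M1 by (simp add: Q_def)
  have Q'1: "Q' \<ge> 1" using Q1 by (simp add: Q'_def)
  have H1: "H \<ge> 1" using Q'1 by (simp add: H_def)
  have main: "\<exists>h::(nat \<Rightarrow> int) \<Rightarrow> int. (\<exists>x\<in>box m 0 (int (k\<^sup>2)). h x \<noteq> 0) \<and> (\<forall>x\<in>box m 0 (int (k\<^sup>2)). \<bar>h x\<bar> \<le> int H) \<and>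
     (\<forall>\<theta>. cmod (\<Sum>x\<in>box m 0 (int (k\<^sup>2)). of_int (h x) * echar m x \<theta>) \<le> real (H * Q') ^ k\<^sup>2 * cmod (csum \<theta>) ^ k)"
    if k: "k \<ge> 2 * C5 + 1" for k
  proof -
    define N where "N = k\<^sup>2"
    let ?B = "box m 0 (int N)"
    define s where "s = sN * k"
    have k1: "k \<ge> 1" using k by simp
    have kN: "k \<le> N" unfolding N_def using k1 by (simp add: power2_eq_square)
    have N1: "N \<ge> 1" "2 * C5 \<le> N" using kN k by simp_all
    define D where "D = C4 * N"
    define Y where "Y = {y. (\<forall>i\<ge>m. y i = 0) \<and> \<bar>ipr m \<pi>1 y\<bar> \<le> int (c2 * k) \<and> \<bar>ipr m \<pi>2 y\<bar> \<le> int (c2 * k) \<and> (\<forall>i. \<bar>y i\<bar> \<le> int D)}"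
    have fB: "finite ?B" and cB: "card ?B = (N + 1) ^ m"
      using finite_card_box[of m 0 "int N"] by (simp_all add: nat_add_distrib)
    have Yc: "finite Y" "card Y \<le> (2 * (c2 * k) + 1)\<^sup>2 * (2 * D + 1) ^ (m - 2)"
      using card_strip[OF ij, of "c2 * k" D] unfolding Y_def by auto
    \<comment> \<open>The strip has width \<open>O(k)\<close> in two directions, which contributes
      only one factor \<open>N = k^2\<close> instead of two.\<close>
    have cY: "card Y \<le> C5 * N ^ (m - 1)"
    proof -
      have "2 * (c2 * k) + 1 \<le> (2 * c2 + 1) * k" using k1 by (simp add: algebra_simps)
      then have 1: "(2 * (c2 * k) + 1)\<^sup>2 \<le> (2 * c2 + 1)\<^sup>2 * N"
        using power_mono[of "2 * (c2 * k) + 1" "(2 * c2 + 1) * k" 2] by (simp only: N_def power_mult_distrib)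
      have "2 * D + 1 \<le> (2 * C4 + 1) * N" using N1 by (simp add: D_def algebra_simps)
      then have 2: "(2 * D + 1) ^ (m - 2) \<le> (2 * C4 + 1) ^ (m - 2) * N ^ (m - 2)"
        using power_mono[of "2 * D + 1" "(2 * C4 + 1) * N" "m - 2"] by (simp only: power_mult_distrib)
      have "card Y \<le> (2 * c2 + 1)\<^sup>2 * N * ((2 * C4 + 1) ^ (m - 2) * N ^ (m - 2))"
        by (rule order_trans[OF Yc(2) mult_mono[OF 1 2]]) auto
      also have "\<dots> = C5 * N ^ Suc (m - 2)" by (simp add: C5_def)
      also have "Suc (m - 2) = m - 1" using m_ge_2 by simp
      finally show ?thesis .
    qed
    have Qk: "(2 * M ^ k) ^ s \<le> Q ^ N" "(M ^ k) ^ s \<le> Q ^ N"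
    proof -
      have "2 * M ^ k \<le> (2 * M) ^ k"
      proof -
        have "2 ^ 1 \<le> (2::nat) ^ k" using k1 by (intro power_increasing) auto
        then show ?thesis by (simp add: power_mult_distrib)
      qed
      then have "(2 * M ^ k) ^ s \<le> ((2 * M) ^ k) ^ s" by (rule power_mono) simp
      also have "\<dots> = Q ^ N" by (simp only: Q_def s_def N_def power_mult[symmetric] power2_eq_square mult_ac)
      finally show 1: "(2 * M ^ k) ^ s \<le> Q ^ N" .
      have "(M ^ k) ^ s \<le> (2 * M ^ k) ^ s" by (rule power_mono) auto
      with 1 show "(M ^ k) ^ s \<le> Q ^ N" by linarith
    qed
    have red: "\<exists>c::(nat \<Rightarrow> int) \<Rightarrow> int. (\<forall>y. \<bar>c y\<bar> \<le> int (Q ^ N)) \<and>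
       (\<forall>\<theta>. cmod (echar m x \<theta> - (\<Sum>y\<in>Y. of_int (c y) * echar m y \<theta>)) \<le> real (Q ^ N) * cmod (csum \<theta>) ^ k)"
      if x: "x \<in> ?B" for x
    proof -
      have x0: "x i = 0" if "i \<ge> m" for i using x that by (simp add: box_def)
      have xD: "\<bar>x i\<bar> \<le> int N" for i using x by (cases "i < m") (auto simp: box_def)
      have "nrm x \<le> cp * real N" using cp[of x "int N"] xD by simp
      also have "\<dots> \<le> real sN * (g / 2) * real N" using sN by (intro mult_right_mono) auto
      also have "\<dots> = real s * (g * k / 2)" by (simp add: s_def N_def power2_eq_square)
      also have "\<dots> \<le> C2 * k + real s * (g * k / 2)" using C2(1) g by simp
      finally have "nrm x \<le> C2 * k + real s * (g * k / 2)" .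
      from reduction_iterate[of g \<pi>1 \<pi>2 cp C2 x "int N" k s, folded nrm_def, OF g gap cp C2 x0 xD this]
      obtain F where F: "comb m \<int> {y. (\<forall>i\<ge>m. y i = 0) \<and> nrm y \<le> C2 * k \<and> (\<forall>i. \<bar>y i\<bar> \<le> int N + int s * (4 * int k * amax))}
          (((4 * n1\<^sup>2) ^ k) ^ s) F" "\<And>\<theta>. cmod (echar m x \<theta> - F \<theta>) \<le> (2 * (4 * n1\<^sup>2) ^ k) ^ s * cmod (csum \<theta>) ^ k"
        by blast
      have "comb m \<int> Y (real (Q ^ N)) F"
      proof (rule comb_mono[OF F(1) order_refl])
        show "((4 * n1\<^sup>2) ^ k) ^ s \<le> real (Q ^ N)"
          using of_nat_mono[OF Qk(2), where 'a = real] by (simp add: Mr)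
        show "{y. (\<forall>i\<ge>m. y i = 0) \<and> nrm y \<le> C2 * k \<and> (\<forall>i. \<bar>y i\<bar> \<le> int N + int s * (4 * int k * amax))} \<subseteq> Y"
        proof safe
          fix y assume y: "\<forall>i\<ge>m. y i = 0" "nrm y \<le> C2 * k" "\<forall>i. \<bar>y i\<bar> \<le> int N + int s * (4 * int k * amax)"
          have "\<bar>real_of_int (ipr m \<pi>1 y)\<bar> \<le> nrm y" "\<bar>real_of_int (ipr m \<pi>2 y)\<bar> \<le> nrm y"
            by (simp_all add: nrm_def)
          then have "\<bar>real_of_int (ipr m \<pi>1 y)\<bar> \<le> real (c2 * k)" "\<bar>real_of_int (ipr m \<pi>2 y)\<bar> \<le> real (c2 * k)"
            using y(2) by (simp_all add: C2c)
          then have "\<bar>ipr m \<pi>1 y\<bar> \<le> int (c2 * k)" "\<bar>ipr m \<pi>2 y\<bar> \<le> int (c2 * k)" by linarith+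
          moreover have "int N + int s * (4 * int k * amax) = int D"
            by (simp add: A[symmetric] s_def D_def C4_def N_def power2_eq_square algebra_simps)
          ultimately show "y \<in> Y" using y by (simp add: Y_def)
        qed
      qed
      from comb_coeffs[OF this Yc(1)] obtain c :: "(nat \<Rightarrow> int) \<Rightarrow> int" where
        c: "\<And>\<theta>. F \<theta> = (\<Sum>y\<in>Y. of_int (c y) * echar m y \<theta>)" "\<And>y. \<bar>real_of_int (c y)\<bar> \<le> real (Q ^ N)" by auto
      have "\<bar>c y\<bar> \<le> int (Q ^ N)" for y using c(2)[of y] by linarith
      moreover have "cmod (echar m x \<theta> - (\<Sum>y\<in>Y. of_int (c y) * echar m y \<theta>)) \<le> real (Q ^ N) * cmod (csum \<theta>) ^ k" for \<theta>
      proof -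
        have "(2 * (4 * n1\<^sup>2) ^ k) ^ s \<le> real (Q ^ N)"
          using of_nat_mono[OF Qk(1), where 'a = real] by (simp add: Mr)
        then have "(2 * (4 * n1\<^sup>2) ^ k) ^ s * cmod (csum \<theta>) ^ k \<le> real (Q ^ N) * cmod (csum \<theta>) ^ k"
          by (intro mult_right_mono) auto
        with F(2)[of \<theta>] show ?thesis by (simp only: c(1)[symmetric])
      qed
      ultimately show ?thesis by blast
    qed
    obtain c where c: "\<And>x y. x \<in> ?B \<Longrightarrow> \<bar>c x y\<bar> \<le> int (Q ^ N)"
      "\<And>x \<theta>. x \<in> ?B \<Longrightarrow> cmod (echar m x \<theta> - (\<Sum>y\<in>Y. of_int (c x y) * echar m y \<theta>)) \<le> real (Q ^ N) * cmod (csum \<theta>) ^ k"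
    proof -
      define c where "c x = (SOME c::(nat \<Rightarrow> int) \<Rightarrow> int. (\<forall>y. \<bar>c y\<bar> \<le> int (Q ^ N)) \<and>
       (\<forall>\<theta>. cmod (echar m x \<theta> - (\<Sum>y\<in>Y. of_int (c y) * echar m y \<theta>)) \<le> real (Q ^ N) * cmod (csum \<theta>) ^ k))" for x
      show ?thesis
        by (rule that[of c]) (use someI_ex[OF red, folded c_def] in blast)+
    qed
    define Dm where "Dm = H * (N + 1) ^ m * Q ^ N"
    define \<Phi> where "\<Phi> h = restrict (\<lambda>y. \<Sum>x\<in>?B. h x * c x y) Y" for h :: "(nat \<Rightarrow> int) \<Rightarrow> int"
    let ?S = "PiE ?B (\<lambda>_. {0..int H})" and ?T = "PiE Y (\<lambda>_. {- int Dm..int Dm})"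
    have \<Phi>T: "\<Phi> ` ?S \<subseteq> ?T"
    proof (rule image_subsetI)
      fix h assume h: "h \<in> ?S"
      have "\<bar>\<Sum>x\<in>?B. h x * c x y\<bar> \<le> int Dm" for y
      proof -
        have "\<bar>\<Sum>x\<in>?B. h x * c x y\<bar> \<le> (\<Sum>x\<in>?B. \<bar>h x * c x y\<bar>)" by (rule sum_abs)
        also have "\<dots> \<le> (\<Sum>x\<in>?B. int H * int (Q ^ N))"
          unfolding abs_mult using h c(1) by (intro sum_mono mult_mono) (auto simp: PiE_iff)
        also have "\<dots> = int Dm" by (simp add: cB Dm_def mult_ac)
        finally show ?thesis .
      qed
      then show "\<Phi> h \<in> ?T" by (auto simp: \<Phi>_def abs_le_iff minus_le_iff)
    qed
    have "card ?T < card ?S"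
    proof -
      have pow2: "(N + 1) ^ m \<le> (2 ^ m) ^ N"
      proof -
        have "N + 1 \<le> 2 ^ N" by (induction N) auto
        then have "(N + 1) ^ m \<le> (2 ^ N) ^ m" by (rule power_mono) simp
        then show ?thesis by (simp add: power_mult[symmetric] mult.commute)
      qed
      have "2 * Dm + 1 \<le> 3 * Dm" using H1 Q1 by (simp add: Dm_def)
      also have "\<dots> \<le> 3 ^ N * (H * (2 ^ m) ^ N * Q ^ N)"
        unfolding Dm_def using pow2 N1 self_le_power[of 3 N] by (intro mult_mono) auto
      also have "\<dots> = H * Q' ^ N" by (simp add: Q'_def power_mult_distrib)
      also have "\<dots> = Q' ^ (2 * C5 + N)" by (simp add: H_def power_add)
      also have "\<dots> \<le> Q' ^ (2 * N)" using N1 Q'1 by (intro power_increasing) auto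
      finally have T: "2 * Dm + 1 \<le> Q' ^ (2 * N)" .
      have "card {- int Dm..int Dm} = 2 * Dm + 1"
        unfolding card_atLeastAtMost_int by linarith
      then have "card ?T = (2 * Dm + 1) ^ card Y"
        using Yc(1) by (simp only: card_PiE prod_constant)
      also have "\<dots> \<le> (Q' ^ (2 * N)) ^ card Y" by (rule power_mono[OF T]) simp
      also have "\<dots> \<le> (Q' ^ (2 * N)) ^ (C5 * N ^ (m - 1))" using Q'1 cY by (intro power_increasing) auto
      also have "\<dots> = Q' ^ (2 * C5 * (N * N ^ (m - 1)))" by (simp add: power_mult[symmetric] mult_ac)
      also have "N * N ^ (m - 1) = N ^ m" using m_ge_2 by (simp add: power_eq_if)
      also have "Q' ^ (2 * C5 * N ^ m) = H ^ (N ^ m)" by (simp add: H_def power_mult)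
      also have "\<dots> < (H + 1) ^ (N ^ m)" using N1 by (intro power_strict_mono) auto
      also have "\<dots> \<le> (H + 1) ^ ((N + 1) ^ m)" by (intro power_increasing power_mono) auto
      also have "\<dots> = card ?S" using fB by (simp add: card_PiE cB nat_add_distrib)
      finally show ?thesis .
    qed
    moreover have "finite ?T" using Yc(1) by (intro finite_PiE) auto
    ultimately have "\<not> inj_on \<Phi> ?S"
      using card_inj_on_le[OF _ \<Phi>T] by (meson not_le)
    then obtain h1 h2 where h: "h1 \<in> ?S" "h2 \<in> ?S" "\<Phi> h1 = \<Phi> h2" "h1 \<noteq> h2" unfolding inj_on_def by blast
    define h where "h x = h1 x - h2 x" for x
    have "\<exists>x\<in>?B. h x \<noteq> 0"
    proof (rule ccontr)
      assume "\<not> ?thesis"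
      then have "h1 x = h2 x" if "x \<in> ?B" for x using that by (auto simp: h_def)
      then have "h1 = h2" by (rule PiE_ext[OF h(1,2)])
      with h(4) show False by simp
    qed
    moreover have hH: "\<bar>h x\<bar> \<le> int H" if "x \<in> ?B" for x
    proof -
      have "h1 x \<in> {0..int H}" "h2 x \<in> {0..int H}" using h(1,2) that by auto
      then show ?thesis by (auto simp: h_def)
    qed
    moreover have "cmod (\<Sum>x\<in>?B. of_int (h x) * echar m x \<theta>) \<le> real (H * Q') ^ k\<^sup>2 * cmod (csum \<theta>) ^ k" for \<theta>
    proof -
      let ?F = "\<lambda>x. \<Sum>y\<in>Y. of_int (c x y) * echar m y \<theta>"
      have z: "(\<Sum>x\<in>?B. h x * c x y) = 0" if "y \<in> Y" for y
      proof -
        have "\<Phi> h1 y = \<Phi> h2 y" using h(3) by simp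
        then show ?thesis using that by (simp add: \<Phi>_def h_def left_diff_distrib sum_subtractf)
      qed
      \<comment> \<open>The remainders cancel because \<open>h1\<close> and \<open>h2\<close> have
        the same image. What is left of the polynomial is the sum of the reduction errors, each of
        which carries the factor \<open>|csum|^k\<close>.\<close>
      have "(\<Sum>x\<in>?B. of_int (h x) * ?F x) = (\<Sum>x\<in>?B. \<Sum>y\<in>Y. of_int (h x * c x y) * echar m y \<theta>)"
        by (simp add: sum_distrib_left mult_ac)
      also have "\<dots> = (\<Sum>y\<in>Y. \<Sum>x\<in>?B. of_int (h x * c x y) * echar m y \<theta>)" by (rule sum.swap)
      also have "\<dots> = (\<Sum>y\<in>Y. of_int (\<Sum>x\<in>?B. h x * c x y) * echar m y \<theta>)"
        by (simp only: sum_distrib_right of_int_sum)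
      also have "\<dots> = 0" using z by (intro sum.neutral) simp
      finally have "(\<Sum>x\<in>?B. of_int (h x) * echar m x \<theta>) = (\<Sum>x\<in>?B. of_int (h x) * (echar m x \<theta> - ?F x))"
        by (simp add: right_diff_distrib sum_subtractf)
      also have "cmod \<dots> \<le> (\<Sum>x\<in>?B. real H * (real (Q ^ N) * cmod (csum \<theta>) ^ k))"
      proof (rule order_trans[OF norm_sum], rule sum_mono)
        fix x assume x: "x \<in> ?B"
        have "cmod (of_int (h x)) \<le> real H" using hH[OF x] by simp
        then show "cmod (of_int (h x) * (echar m x \<theta> - ?F x)) \<le> real H * (real (Q ^ N) * cmod (csum \<theta>) ^ k)"
          unfolding norm_mult using c(2)[OF x] by (intro mult_mono) auto
      qed
      also have "\<dots> = real Dm * cmod (csum \<theta>) ^ k" by (simp add: cB Dm_def mult_ac)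
      also have "\<dots> \<le> real (H * Q') ^ N * cmod (csum \<theta>) ^ k"
      proof (rule mult_right_mono)
        have pow2: "(N + 1) ^ m \<le> (2 ^ m) ^ N"
        proof -
          have "N + 1 \<le> 2 ^ N" by (induction N) auto
          then have "(N + 1) ^ m \<le> (2 ^ N) ^ m" by (rule power_mono) simp
          then show ?thesis by (simp add: power_mult[symmetric] mult.commute)
        qed
        have "Dm \<le> H ^ N * (2 ^ m) ^ N * Q ^ N"
          unfolding Dm_def using pow2 N1 H1 self_le_power[of H N] by (intro mult_mono) auto
        also have "\<dots> \<le> 3 ^ N * (H ^ N * (2 ^ m) ^ N * Q ^ N)" by simp
        also have "\<dots> = (H * Q') ^ N" by (simp add: Q'_def power_mult_distrib)
        finally have "real Dm \<le> real ((H * Q') ^ N)" by (rule of_nat_mono)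
        then show "real Dm \<le> real (H * Q') ^ N" by simp
      qed simp
      finally show ?thesis by (simp only: N_def)
    qed
    ultimately show ?thesis unfolding N_def by blast
  qed
  have "real (H * Q') \<ge> 1"
  proof -
    have "1 * 1 \<le> H * Q'" by (rule mult_mono[OF H1 Q'1]) auto
    then have "real 1 \<le> real (H * Q')" by (intro of_nat_mono) simp
    then show ?thesis by simp
  qed
  with main show ?thesis by blast
qed

end

section \<open>Integration over the torus\<close>

text \<open>A fundamental cube stands for the quotient group. Its invariance under translation is
  not geometric and is recovered through the orthogonality of characters.\<close>

definition torus :: "nat \<Rightarrow> (nat \<Rightarrow> real) measure" where
  "torus m = restrict_space (\<Pi>\<^sub>M i\<in>{..<m}. lborel) ({..<m} \<rightarrow>\<^sub>E {0..1})"

lemma cube_sets: "({..<m} \<rightarrow>\<^sub>E {0..1::real}) \<in> sets (\<Pi>\<^sub>M i\<in>{..<m::nat}. lborel)"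
  by (rule sets_PiM_I_finite) auto

lemma integral_torus:
  fixes f :: "(nat \<Rightarrow> real) \<Rightarrow> 'b::{banach, second_countable_topology}"
  shows "integral\<^sup>L (torus m) f = (LINT x:({..<m} \<rightarrow>\<^sub>E {0..1})|(\<Pi>\<^sub>M i\<in>{..<m}. lborel). f x)"
  unfolding torus_def set_lebesgue_integral_def
  by (rule integral_restrict_space) (use cube_sets[of m] sets.sets_into_space in \<open>auto intro!: sets.Int\<close>)

lemma measurable_echar [measurable]: "echar m y \<in> borel_measurable (\<Pi>\<^sub>M i\<in>{..<m}. lborel)"
proof -
  have "(\<lambda>\<theta>. \<Sum>i<m. of_int (y i) * \<theta> i) \<in> borel_measurable (\<Pi>\<^sub>M i\<in>{..<m}. lborel :: real measure)"
  proof (rule borel_measurable_sum)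
    fix i assume "i \<in> {..<m}"
    from measurable_component_singleton[OF this, of "\<lambda>_. lborel :: real measure"]
    have "(\<lambda>\<theta>. \<theta> i) \<in> borel_measurable (\<Pi>\<^sub>M i\<in>{..<m}. lborel :: real measure)" by simp
    then show "(\<lambda>\<theta>. of_int (y i) * \<theta> i) \<in> borel_measurable (\<Pi>\<^sub>M i\<in>{..<m}. lborel :: real measure)"
      by (intro borel_measurable_times borel_measurable_const)
  qed
  then have "(\<lambda>\<theta>. 2 * pi * (\<Sum>i<m. of_int (y i) * \<theta> i)) \<in> borel_measurable (\<Pi>\<^sub>M i\<in>{..<m}. lborel)" by simp
  then show ?thesis unfolding echar_def[abs_def]
    by (rule measurable_compose[of _ _ borel]) (intro borel_measurable_continuous_onI continuous_intros)
qed

lemma measurable_echar_torus [measurable]: "echar m y \<in> borel_measurable (torus m)"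
  unfolding torus_def by (rule measurable_restrict_space1) measurable

interpretation lborel_product: product_sigma_finite "\<lambda>_::nat. lborel :: real measure"
  by standard

lemma emeasure_torus: "emeasure (torus m) (space (torus m)) = 1"
proof -
  have s: "({..<m} \<rightarrow>\<^sub>E {0..1::real}) \<inter> space (\<Pi>\<^sub>M i\<in>{..<m::nat}. lborel) = ({..<m} \<rightarrow>\<^sub>E {0..1})"
    using sets.sets_into_space[OF cube_sets[of m]] by auto
  have "emeasure (torus m) (space (torus m)) = emeasure (\<Pi>\<^sub>M i\<in>{..<m}. lborel) ({..<m} \<rightarrow>\<^sub>E {0..1::real})"
    unfolding torus_def space_restrict_space s
    by (rule emeasure_restrict_space) (use cube_sets[of m] s in auto)
  also have "\<dots> = 1" by (subst lborel_product.emeasure_PiM) auto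
  finally show ?thesis .
qed

lemma finite_measure_torus: "finite_measure (torus m)"
  by (rule finite_measureI) (simp add: emeasure_torus)

lemma integral_cis_period:
  "(\<integral>x. indicator {0..1} x *\<^sub>R cis (2 * pi * (of_int n * x)) \<partial>lborel) = (if n = 0 then 1 else 0)"
proof (cases "n = 0")
  case True
  then show ?thesis by simp
next
  case False
  define F where "F x = cis (2 * pi * (of_int n * x)) / (2 * pi * \<i> * of_int n)" for x :: real
  have "(\<integral>x. indicator {0..1} x *\<^sub>R cis (2 * pi * (of_int n * x)) \<partial>lborel) = F 1 - F 0"
  proof (rule integral_FTC_atLeastAtMost)
    fix x :: real
    have "((\<lambda>x. exp (\<i> * of_real (2 * pi * of_int n) * of_real x)) has_vector_derivative
        (\<i> * of_real (2 * pi * of_int n)) * exp (\<i> * of_real (2 * pi * of_int n) * of_real x)) (at x within {0..1})"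
      by (auto intro!: derivative_eq_intros has_vector_derivative_real_field)
    then have "((\<lambda>x. exp (\<i> * of_real (2 * pi * of_int n) * of_real x) / (2 * pi * \<i> * of_int n)) has_vector_derivative
        (\<i> * of_real (2 * pi * of_int n)) * exp (\<i> * of_real (2 * pi * of_int n) * of_real x) / (2 * pi * \<i> * of_int n)) (at x within {0..1})"
      by (rule has_vector_derivative_divide)
    then show "(F has_vector_derivative cis (2 * pi * (of_int n * x))) (at x within {0..1})"
      using False by (simp add: F_def[abs_def] cis_conv_exp mult_ac)
  qed (auto intro!: continuous_intros)
  also have "cis (2 * pi * of_int n) = 1" by simp
  then have "F 1 - F 0 = 0" by (simp add: F_def)
  finally show ?thesis using False by simp
qed

lemma integral_echar:
  "(\<integral>\<theta>. echar m y \<theta> \<partial>torus m) = (if \<forall>i<m. y i = 0 then 1 else 0)"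
proof -
  let ?f = "\<lambda>i x. indicator {0..1} x *\<^sub>R cis (2 * pi * (of_int (y i) * x))"
  have "(\<integral>\<theta>. echar m y \<theta> \<partial>torus m) = (\<integral>\<theta>. indicator ({..<m} \<rightarrow>\<^sub>E {0..1}) \<theta> *\<^sub>R echar m y \<theta> \<partial>(\<Pi>\<^sub>M i\<in>{..<m}. lborel))"
    by (simp add: integral_torus set_lebesgue_integral_def)
  also have "\<dots> = (\<integral>\<theta>. (\<Prod>i\<in>{..<m}. ?f i (\<theta> i)) \<partial>(\<Pi>\<^sub>M i\<in>{..<m}. lborel))"
  proof (rule Bochner_Integration.integral_cong[OF refl])
    fix \<theta> :: "nat \<Rightarrow> real" assume "\<theta> \<in> space (\<Pi>\<^sub>M i\<in>{..<m}. lborel)"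
    then have ext: "\<theta> \<in> extensional {..<m}" by (auto simp: space_PiM PiE_iff)
    have e: "echar m y \<theta> = (\<Prod>i<m. cis (2 * pi * (of_int (y i) * \<theta> i)))"
    proof -
      have "cis (\<Sum>i\<in>I. g i) = (\<Prod>i\<in>I. cis (g i))" if "finite I" for I :: "nat set" and g
        using that by (induction I) (simp_all add: cis_mult[symmetric])
      then show ?thesis by (simp add: echar_def sum_distrib_left)
    qed
    show "indicator ({..<m} \<rightarrow>\<^sub>E {0..1}) \<theta> *\<^sub>R echar m y \<theta> = (\<Prod>i\<in>{..<m}. ?f i (\<theta> i))"
    proof (cases "\<theta> \<in> {..<m} \<rightarrow>\<^sub>E {0..1}")
      case True
      then show ?thesis by (auto simp: e PiE_iff intro!: prod.cong)
    next
      case False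
      then obtain i where "i < m" "\<theta> i \<notin> {0..1}" using ext by (auto simp: PiE_iff)
      then have "(\<Prod>i\<in>{..<m}. ?f i (\<theta> i)) = 0" by (intro prod_zero) (auto intro!: bexI[of _ i])
      with False show ?thesis by simp
    qed
  qed
  also have "\<dots> = (\<Prod>i\<in>{..<m}. integral\<^sup>L lborel (?f i))"
  proof (rule lborel_product.product_integral_prod)
    show "integrable lborel (?f i)" for i
      by (rule borel_integrable_compact) (auto intro!: continuous_intros)
  qed simp
  also have "\<dots> = (\<Prod>i\<in>{..<m}. if y i = 0 then 1 else 0)" by (simp only: integral_cis_period)
  also have "\<dots> = (if \<forall>i<m. y i = 0 then 1 else 0)" by auto
  finally show ?thesis .
qed

lemma integrable_echar: "integrable (torus m) (echar m y)"
proof -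
  interpret finite_measure "torus m" by (rule finite_measure_torus)
  show ?thesis by (rule integrable_const_bound[of _ 1]) auto
qed

lemma comb_integrable: "comb m K Y B F \<Longrightarrow> integrable (torus m) F"
  by (induction rule: comb.induct) (simp_all add: integrable_echar)

text \<open>A translation multiplies a character by a constant: this constant is 1 for the trivial
  character, and the integral of any other character is 0 anyway.\<close>

lemma comb_shift_integral:
  assumes "comb m K Y B F" "Y \<subseteq> {y. \<forall>i\<ge>m. y i = 0}"
  shows "integrable (torus m) (\<lambda>\<theta>. F (\<lambda>i. \<theta> i + c i)) \<and>
    (\<integral>\<theta>. F (\<lambda>i. \<theta> i + c i) \<partial>torus m) = (\<integral>\<theta>. F \<theta> \<partial>torus m)"
  using assms(1)
proof (induction rule: comb.induct)
  case (comb_step B F d y)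
  have i: "integrable (torus m) F" using comb_step(1) by (rule comb_integrable)
  have "(\<integral>\<theta>. echar m y (\<lambda>i. \<theta> i + c i) \<partial>torus m) = (\<integral>\<theta>. echar m y \<theta> \<partial>torus m)"
  proof (cases "\<forall>i<m. y i = 0")
    case True
    then have "echar m y c = 1" by (simp add: echar_def)
    then show ?thesis by (simp add: echar_shift)
  next
    case False
    then have "(\<integral>\<theta>. echar m y \<theta> \<partial>torus m) = 0" by (simp only: integral_echar if_False)
    then show ?thesis by (simp add: echar_shift)
  qed
  with comb_step i integrable_echar[of m y] show ?case
    by (simp add: echar_shift)
qed simp

lemma sum_roots_of_unity_dvd:
  assumes "p > 0"
  shows "(\<Sum>t<p. cis (2 * pi * real t * of_int n / real p)) = (if int p dvd n then of_nat p else 0)"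
proof -
  define w where "w = cis (2 * pi * of_int n / real p)"
  have e: "cis (2 * pi * real t * of_int n / real p) = w ^ t" for t
    by (simp add: w_def Complex.DeMoivre mult_ac)
  have "real p * (2 * pi * of_int n / real p) = 2 * pi * of_int n" using assms by simp
  then have wp: "w ^ p = 1" by (simp only: w_def Complex.DeMoivre cis_multiple_2pi[OF Ints_of_int])
  show ?thesis
  proof (cases "int p dvd n")
    case True
    then obtain k where k: "n = int p * k" by (auto elim: dvdE)
    have "2 * pi * real_of_int (int p * k) / real p = 2 * pi * of_int k" using assms by simp
    then have "w = cis (2 * pi * of_int k)" unfolding w_def k by (rule arg_cong)
    then have "w = 1" by (simp only: cis_multiple_2pi[OF Ints_of_int])
    then show ?thesis using True by (simp add: e)
  next
    case False
    have "w \<noteq> 1"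
    proof
      assume "w = 1"
      then have "cos (2 * pi * of_int n / real p) = 1" by (metis w_def cis.sel(1) one_complex.sel(1))
      then obtain k :: int where "2 * pi * of_int n / real p = of_int k * 2 * pi"
        using cos_one_2pi_int by blast
      then have "real_of_int n = of_int (int p * k)" using assms by (simp add: field_simps)
      then have "n = int p * k" by (simp only: of_int_eq_iff)
      with False show False by simp
    qed
    then have "(\<Sum>t<p. w ^ t) = 0" using wp by (simp add: geometric_sum)
    then show ?thesis using False by (simp add: e)
  qed
qed

text \<open>The orbit is an exact quadrature rule: averaging a character over it gives 1 or 0
  according to divisibility by \<open>p\<close>, and the condition on \<open>Y\<close> makes this
  agree with the integral.\<close>

lemma comb_orbit_mean:
  assumes "comb m K Y B F" "p > 0" "Y \<subseteq> {y. \<forall>i\<ge>m. y i = 0}"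
    and "\<And>y. y \<in> Y \<Longrightarrow> \<exists>i<m. y i \<noteq> 0 \<Longrightarrow> \<not> int p dvd ipr m y u"
  shows "(\<Sum>t<p. F (\<lambda>i. real t * of_int (u i) / real p)) = of_nat p * (\<integral>\<theta>. F \<theta> \<partial>torus m)"
  using assms(1)
proof (induction rule: comb.induct)
  case (comb_step B F d y)
  have i: "integrable (torus m) F" using comb_step(1) by (rule comb_integrable)
  have "echar m y (\<lambda>i. real t * of_int (u i) / real p) = cis (2 * pi * real t * of_int (ipr m y u) / real p)" for t
    by (simp add: echar_def ipr_def sum_distrib_left sum_divide_distrib mult_ac)
  then have "(\<Sum>t<p. echar m y (\<lambda>i. real t * of_int (u i) / real p)) = (if int p dvd ipr m y u then of_nat p else 0)"
    using sum_roots_of_unity_dvd[OF assms(2), of "ipr m y u"] by simp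
  also have "\<dots> = of_nat p * (\<integral>\<theta>. echar m y \<theta> \<partial>torus m)"
    using assms(4)[OF comb_step(3)] by (auto simp: integral_echar ipr_def)
  finally show ?case using comb_step i integrable_echar[of m y]
    by (simp add: sum.distrib sum_distrib_left[symmetric] algebra_simps)
qed simp

section \<open>Real trigonometric polynomials of bounded degree\<close>

definition trig_poly :: "nat \<Rightarrow> int \<Rightarrow> ((nat \<Rightarrow> real) \<Rightarrow> real) \<Rightarrow> bool" where
  "trig_poly m D f \<longleftrightarrow> (\<exists>B. comb m UNIV (box m (- D) D) B (\<lambda>\<theta>. complex_of_real (f \<theta>)))"

lemma trig_poly_mono: "trig_poly m D f \<Longrightarrow> D \<le> D' \<Longrightarrow> trig_poly m D' f"
  unfolding trig_poly_def by (erule exE, rule exI, erule comb_mono) (auto simp: box_def)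

lemma trig_poly_const: "D \<ge> 0 \<Longrightarrow> trig_poly m D (\<lambda>_. c)"
  unfolding trig_poly_def
  using comb_monom[of "complex_of_real c" UNIV "\<lambda>_. 0" "box m (- D) D" "\<bar>c\<bar>" m] by (auto simp: box_def)

lemma trig_poly_add: "trig_poly m D f \<Longrightarrow> trig_poly m D g \<Longrightarrow> trig_poly m D (\<lambda>\<theta>. f \<theta> + g \<theta>)"
  unfolding trig_poly_def by (auto dest: comb_add)

lemma trig_poly_mult:
  assumes "trig_poly m D f" "trig_poly m D' g"
  shows "trig_poly m (D + D') (\<lambda>\<theta>. f \<theta> * g \<theta>)"
proof -
  from assms obtain B B' where B: "comb m UNIV (box m (- D) D) B (\<lambda>\<theta>. complex_of_real (f \<theta>))"
    "comb m UNIV (box m (- D') D') B' (\<lambda>\<theta>. complex_of_real (g \<theta>))" by (auto simp: trig_poly_def)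
  have "comb m UNIV (box m (- (D + D')) (D + D')) (B * B') (\<lambda>\<theta>. complex_of_real (f \<theta>) * complex_of_real (g \<theta>))"
    by (rule comb_mult[OF B]) (fastforce simp: box_def)+
  then show ?thesis unfolding trig_poly_def by auto
qed

lemma trig_poly_scale: "trig_poly m D f \<Longrightarrow> trig_poly m D (\<lambda>\<theta>. c * f \<theta>)"
  using trig_poly_mult[OF trig_poly_const[of 0 m c], of D f] by simp

lemma trig_poly_sum:
  assumes "finite I" "\<And>i. i \<in> I \<Longrightarrow> trig_poly m D (f i)" "D \<ge> 0"
  shows "trig_poly m D (\<lambda>\<theta>. \<Sum>i\<in>I. f i \<theta>)"
  using assms(1,2) by (induction I) (auto intro: trig_poly_const[OF assms(3)] trig_poly_add)

lemma trig_poly_integrable: "trig_poly m D f \<Longrightarrow> integrable (torus m) f"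
  unfolding trig_poly_def by (auto dest!: comb_integrable dest: integrable_Re)

lemma trig_poly_shift:
  assumes "trig_poly m D f"
  shows "(\<integral>\<theta>. f (\<lambda>i. \<theta> i + c i) \<partial>torus m) = (\<integral>\<theta>. f \<theta> \<partial>torus m)"
proof -
  from assms obtain B where B: "comb m UNIV (box m (- D) D) B (\<lambda>\<theta>. complex_of_real (f \<theta>))"
    by (auto simp: trig_poly_def)
  have "box m (- D) D \<subseteq> {y. \<forall>i\<ge>m. y i = 0}" by (auto simp: box_def)
  from comb_shift_integral[OF B this, of c]
  have "complex_of_real (\<integral>\<theta>. f (\<lambda>i. \<theta> i + c i) \<partial>torus m) = complex_of_real (\<integral>\<theta>. f \<theta> \<partial>torus m)"
    by (simp add: integral_complex_of_real)
  then show ?thesis by (simp only: of_real_eq_iff)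
qed

lemma trig_poly_orbit_mean:
  assumes "trig_poly m D f" "p > 0"
    and "\<And>y. y \<in> box m (- D) D \<Longrightarrow> \<exists>i<m. y i \<noteq> 0 \<Longrightarrow> \<not> int p dvd ipr m y u"
  shows "(\<Sum>t<p. f (\<lambda>i. real t * of_int (u i) / real p)) = real p * (\<integral>\<theta>. f \<theta> \<partial>torus m)"
proof -
  from assms obtain B where B: "comb m UNIV (box m (- D) D) B (\<lambda>\<theta>. complex_of_real (f \<theta>))"
    by (auto simp: trig_poly_def)
  have "box m (- D) D \<subseteq> {y. \<forall>i\<ge>m. y i = 0}" by (auto simp: box_def)
  from comb_orbit_mean[OF B assms(2) this assms(3)]
  have "complex_of_real (\<Sum>t<p. f (\<lambda>i. real t * of_int (u i) / real p)) = complex_of_real (real p * (\<integral>\<theta>. f \<theta> \<partial>torus m))"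
    by (simp add: integral_complex_of_real)
  then show ?thesis by (simp only: of_real_eq_iff)
qed

text \<open>The function is the Chebyshev polynomial \<open>T_k\<close> evaluated at
  \<open>f\<close>, and \<open>T_(k+2) = 2 f T_(k+1) - T_k\<close> raises the degree by
  \<open>D\<close> at each step.\<close>

lemma trig_poly_cos_arccos:
  assumes f: "trig_poly m D f" "D \<ge> 0" and b: "\<And>\<theta>. \<bar>f \<theta>\<bar> \<le> 1"
  shows "trig_poly m (int k * D) (\<lambda>\<theta>. cos (real k * arccos (f \<theta>)))"
proof (induction k rule: induct_nat_012)
  case 0
  then show ?case using trig_poly_const[of 0 m 1] by simp
next
  case 1
  then show ?case using f b by (simp add: abs_le_iff minus_le_iff)
next
  case (ge2 k)
  have e: "cos (real (Suc (Suc k)) * arccos (f \<theta>)) = 2 * (f \<theta> * cos (real (Suc k) * arccos (f \<theta>))) + (-1) * cos (real k * arccos (f \<theta>))" for \<theta>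
  proof -
    let ?a = "arccos (f \<theta>)"
    have "cos ((real (Suc k) * ?a) + ?a) + cos ((real (Suc k) * ?a) - ?a) = 2 * cos ?a * cos (real (Suc k) * ?a)"
      by (simp add: cos_add cos_diff)
    moreover have "cos ?a = f \<theta>" using b[of \<theta>] by (simp add: abs_le_iff minus_le_iff)
    moreover have "real (Suc k) * ?a + ?a = real (Suc (Suc k)) * ?a" "real (Suc k) * ?a - ?a = real k * ?a"
      by (simp_all add: algebra_simps)
    ultimately show ?thesis by (simp add: algebra_simps)
  qed
  have 1: "trig_poly m (int (Suc (Suc k)) * D) (\<lambda>\<theta>. 2 * (f \<theta> * cos (real (Suc k) * arccos (f \<theta>))))"
    using trig_poly_scale[OF trig_poly_mult[OF f(1) ge2(2)], of 2] by (simp add: algebra_simps)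
  have "int k * D \<le> int (Suc (Suc k)) * D" using f(2) by (intro mult_right_mono) auto
  then have 2: "trig_poly m (int (Suc (Suc k)) * D) (\<lambda>\<theta>. (-1) * cos (real k * arccos (f \<theta>)))"
    by (intro trig_poly_scale trig_poly_mono[OF ge2(1)])
  show ?case using trig_poly_add[OF 1 2] unfolding e .
qed

section \<open>Chebyshev expansions\<close>

lemma geometric_tail_bound:
  fixes g :: "nat \<Rightarrow> real"
  assumes r: "0 < r" "r < 1" and g: "g sums S" and b: "\<And>n. \<bar>g n\<bar> \<le> r ^ n"
  shows "\<bar>S - (\<Sum>n<K. g n)\<bar> \<le> r ^ K / (1 - r)"
proof -
  have t: "(\<lambda>n. g (n + K)) sums (S - (\<Sum>n<K. g n))" by (rule sums_split_initial_segment[OF g])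
  have "(\<lambda>n. r ^ K * r ^ n) sums (r ^ K * (1 / (1 - r)))"
    by (intro sums_mult geometric_sums) (use r in auto)
  then have rs: "(\<lambda>n. r ^ (n + K)) sums (r ^ K / (1 - r))" by (simp add: power_add mult.commute)
  have "norm (suminf (\<lambda>n. g (n + K))) \<le> (suminf (\<lambda>n. r ^ (n + K)))"
    by (rule norm_suminf_le) (use rs b in \<open>auto simp: sums_iff\<close>)
  then show ?thesis using t rs by (simp add: sums_iff)
qed

lemma norm_one_minus_rcis:
  fixes r y :: real
  assumes "\<bar>y\<bar> \<le> 1"
  shows "(cmod (1 - of_real r * cis (arccos y)))\<^sup>2 = 1 - 2 * r * y + r\<^sup>2"
proof -
  have c: "cos (arccos y) = y" using assms by (simp add: abs_le_iff minus_le_iff)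
  have alg: "(1 - r * C)\<^sup>2 + (r * S)\<^sup>2 = 1 - 2 * r * C + r\<^sup>2 * (S\<^sup>2 + C\<^sup>2)" for S C :: real
    by (simp add: power2_eq_square algebra_simps)
  have "(cmod (1 - of_real r * cis (arccos y)))\<^sup>2 = (1 - r * cos (arccos y))\<^sup>2 + (r * sin (arccos y))\<^sup>2"
    by (simp add: cmod_power2)
  also have "\<dots> = 1 - 2 * r * cos (arccos y) + r\<^sup>2 * ((sin (arccos y))\<^sup>2 + (cos (arccos y))\<^sup>2)"
    by (rule alg)
  also have "\<dots> = 1 - 2 * r * cos (arccos y) + r\<^sup>2" by (simp only: sin_cos_squared_add mult_1_right)
  also have "\<dots> = 1 - 2 * r * y + r\<^sup>2" by (simp only: c)
  finally show ?thesis .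
qed

lemma one_minus_rcis_pos:
  fixes r y :: real
  assumes "\<bar>y\<bar> \<le> 1" "0 < r" "r < 1"
  shows "1 - 2 * r * y + r\<^sup>2 > 0"
proof -
  have "r * y \<le> r * 1" using assms by (intro mult_left_mono) auto
  then have "1 - 2 * r * y + r\<^sup>2 \<ge> (1 - r)\<^sup>2" by (simp add: power2_eq_square algebra_simps)
  moreover have "(1 - r)\<^sup>2 > 0" using assms by simp
  ultimately show ?thesis by linarith
qed

text \<open>For \<open>y = cos \<phi>\<close> and \<open>w = r e^(i \<phi>)\<close> the argument of
  the logarithm is \<open>|1 - w|^2\<close>, so the expansion is twice the real part of the series
  of \<open>Ln (1 - w)\<close>. The term \<open>n = 0\<close> is 0, since division by zero yields
  0.\<close>

lemma log_chebyshev_expansion: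
  fixes r y :: real
  assumes r: "0 < r" "r < 1" and y: "\<bar>y\<bar> \<le> 1"
  shows "\<bar>ln (1 - 2 * r * y + r\<^sup>2) - (\<Sum>n<K. - 2 * r ^ n / real n * cos (real n * arccos y))\<bar> \<le> 2 * r ^ K / (1 - r)"
proof -
  define w where "w = of_real r * cis (arccos y)"
  have nw: "cmod (- w) < 1" using r by (simp add: w_def norm_mult)
  have wn: "w ^ n = of_real (r ^ n) * cis (real n * arccos y)" for n
    by (simp add: w_def power_mult_distrib Complex.DeMoivre)
  have "(\<lambda>n. - ((- (- w)) ^ n) / of_nat n) sums ln (1 + - w)" by (rule Ln_series'[OF nw])
  then have "(\<lambda>n. Re (- (w ^ n) / of_nat n)) sums Re (ln (1 - w))" using sums_Re by fastforce
  moreover have "Re (- (w ^ n) / of_nat n) = - (r ^ n) / real n * cos (real n * arccos y)" for n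
    unfolding wn by (cases "n = 0") (simp_all add: Re_divide_of_nat)
  ultimately have s: "(\<lambda>n. - (r ^ n) / real n * cos (real n * arccos y)) sums Re (ln (1 - w))" by (simp only:)
  have pos: "1 - 2 * r * y + r\<^sup>2 > 0" by (rule one_minus_rcis_pos[OF y r])
  have sq: "(cmod (1 - w))\<^sup>2 = 1 - 2 * r * y + r\<^sup>2" unfolding w_def by (rule norm_one_minus_rcis[OF y])
  then have nz: "1 - w \<noteq> 0" using pos by auto
  have "ln (1 - 2 * r * y + r\<^sup>2) = 2 * ln (cmod (1 - w))"
    unfolding sq[symmetric] using nz by (simp add: ln_realpow)
  then have L: "ln (1 - 2 * r * y + r\<^sup>2) = 2 * Re (ln (1 - w))" using nz by simp
  have "\<bar>Re (ln (1 - w)) - (\<Sum>n<K. - (r ^ n) / real n * cos (real n * arccos y))\<bar> \<le> r ^ K / (1 - r)"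
  proof (rule geometric_tail_bound[OF r s])
    fix n
    show "\<bar>- (r ^ n) / real n * cos (real n * arccos y)\<bar> \<le> r ^ n"
    proof (cases "n = 0")
      case False
      have "\<bar>- (r ^ n) / real n * cos (real n * arccos y)\<bar> = r ^ n / real n * \<bar>cos (real n * arccos y)\<bar>"
        using r by (simp add: abs_mult)
      also have "\<dots> \<le> r ^ n / real n * 1" using r by (intro mult_left_mono) auto
      also have "\<dots> \<le> r ^ n" using False r by (simp add: divide_le_eq mult_le_cancel_left1)
      finally show ?thesis .
    qed simp
  qed
  moreover have "(\<Sum>n<K. - 2 * r ^ n / real n * cos (real n * arccos y)) = 2 * (\<Sum>n<K. - (r ^ n) / real n * cos (real n * arccos y))"
    by (simp add: sum_distrib_left mult.assoc)
  ultimately show ?thesis unfolding L by (simp only: right_diff_distrib[symmetric] abs_mult) simp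
qed

text \<open>The left-hand fraction is the Poisson kernel, which equals
  \<open>2 Re (1 / (1 - w)) - 1\<close> for the same \<open>w\<close>; the geometric series gives
  its coefficients.\<close>

lemma poisson_chebyshev_expansion:
  fixes r y :: real
  assumes r: "0 < r" "r < 1" and y: "\<bar>y\<bar> \<le> 1"
  shows "\<bar>(1 - r\<^sup>2) / (1 - 2 * r * y + r\<^sup>2) - (2 * (\<Sum>n<K. r ^ n * cos (real n * arccos y)) - 1)\<bar> \<le> 2 * r ^ K / (1 - r)"
proof -
  define w where "w = of_real r * cis (arccos y)"
  have nw: "cmod w < 1" using r by (simp add: w_def norm_mult)
  have wn: "w ^ n = of_real (r ^ n) * cis (real n * arccos y)" for n
    by (simp add: w_def power_mult_distrib Complex.DeMoivre)
  have "(\<lambda>n. Re (w ^ n)) sums Re (1 / (1 - w))" using sums_Re[OF geometric_sums[OF nw]] .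
  then have s: "(\<lambda>n. r ^ n * cos (real n * arccos y)) sums Re (1 / (1 - w))" by (simp add: wn)
  have c: "cos (arccos y) = y" using y by (simp add: abs_le_iff minus_le_iff)
  have sq: "(cmod (1 - w))\<^sup>2 = 1 - 2 * r * y + r\<^sup>2" unfolding w_def by (rule norm_one_minus_rcis[OF y])
  have pos: "1 - 2 * r * y + r\<^sup>2 > 0" by (rule one_minus_rcis_pos[OF y r])
  have "Re (1 / (1 - w)) = (1 - r * y) / (1 - 2 * r * y + r\<^sup>2)"
    unfolding sq[symmetric] by (simp add: Re_divide cmod_power2 w_def c)
  then have R: "(1 - r\<^sup>2) / (1 - 2 * r * y + r\<^sup>2) = 2 * Re (1 / (1 - w)) - 1"
    using pos by (simp add: field_simps)
  have "\<bar>Re (1 / (1 - w)) - (\<Sum>n<K. r ^ n * cos (real n * arccos y))\<bar> \<le> r ^ K / (1 - r)"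
  proof (rule geometric_tail_bound[OF r s])
    fix n show "\<bar>r ^ n * cos (real n * arccos y)\<bar> \<le> r ^ n"
      using r mult_left_mono[OF abs_cos_le_one[of "real n * arccos y"], of "r ^ n"] by (simp add: abs_mult)
  qed
  then show ?thesis unfolding R by linarith
qed

section \<open>Sublevel sets of exponential sums\<close>

text \<open>Sublevel sets are measured by coverings: under unions the counts simply add, and the
  induction on the order of the derivative meets no question of measurability.\<close>

definition covered :: "nat \<Rightarrow> real \<Rightarrow> real set \<Rightarrow> bool" where
  "covered N L X \<longleftrightarrow> (\<exists>S. finite S \<and> card S \<le> N \<and> X \<subseteq> (\<Union>s\<in>S. {s..s + L}))"

lemma covered_mono: "covered N L X \<Longrightarrow> N \<le> N' \<Longrightarrow> L \<le> L' \<Longrightarrow> Y \<subseteq> X \<Longrightarrow> covered N' L' Y"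
  unfolding covered_def by (elim exE, intro exI conjI) (auto intro: order_trans, fastforce)

lemma covered_Un: "covered N L X \<Longrightarrow> covered N' L Y \<Longrightarrow> covered (N + N') L (X \<union> Y)"
  unfolding covered_def
proof (elim exE conjE)
  fix S T assume S: "finite S" "card S \<le> N" "X \<subseteq> (\<Union>s\<in>S. {s..s + L})"
    and T: "finite T" "card T \<le> N'" "Y \<subseteq> (\<Union>s\<in>T. {s..s + L})"
  show "\<exists>S. finite S \<and> card S \<le> N + N' \<and> X \<union> Y \<subseteq> (\<Union>s\<in>S. {s..s + L})"
    by (rule exI[of _ "S \<union> T"]) (use S T card_Un_le[of S T] in auto)
qed

lemma covered_UN:
  assumes "finite I" "\<And>i. i \<in> I \<Longrightarrow> covered N L (X i)"
  shows "covered (card I * N) L (\<Union>i\<in>I. X i)"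
  using assms
proof (induction I)
  case empty
  then show ?case by (auto simp: covered_def)
next
  case (insert i I)
  then have "covered (N + card I * N) L (X i \<union> (\<Union>i\<in>I. X i))" by (intro covered_Un) auto
  then show ?case using insert by simp
qed

text \<open>Two intervals, one on each side of an arbitrary point of the set, spare the choice of an
  infimum.\<close>

lemma covered_diameter:
  assumes "\<And>x y. x \<in> X \<Longrightarrow> y \<in> X \<Longrightarrow> x \<le> y \<Longrightarrow> y - x \<le> L"
  shows "covered 2 L X"
proof (cases "X = {}")
  case True
  then show ?thesis by (auto simp: covered_def)
next
  case False
  then obtain x where x: "x \<in> X" by auto
  have "X \<subseteq> (\<Union>s\<in>{x - L, x}. {s..s + L})"
  proof
    fix y assume "y \<in> X"
    then show "y \<in> (\<Union>s\<in>{x - L, x}. {s..s + L})"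
      using assms[OF x, of y] assms[of y x] x by (cases "x \<le> y") auto
  qed
  moreover have "card {x - L, x} \<le> 2" by (simp add: card_insert_le_m1)
  ultimately show ?thesis unfolding covered_def by (intro exI[of _ "{x - L, x}"]) auto
qed

lemma covered_emeasure:
  assumes "covered N L X" "X \<in> sets borel" "L \<ge> 0"
  shows "emeasure lborel X \<le> ennreal (real N * L)"
proof -
  from assms(1) obtain S where S: "finite S" "card S \<le> N" "X \<subseteq> (\<Union>s\<in>S. {s..s + L})" by (auto simp: covered_def)
  have "emeasure lborel X \<le> emeasure lborel (\<Union>s\<in>S. {s..s + L})" using S by (intro emeasure_mono) auto
  also have "\<dots> \<le> (\<Sum>s\<in>S. emeasure lborel {s..s + L})" using S by (intro emeasure_subadditive_finite) auto
  also have "\<dots> = ennreal (real (card S) * L)" using assms(3) by (simp add: ennreal_mult ennreal_of_nat_eq_real_of_nat)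
  also have "\<dots> \<le> ennreal (real N * L)" using S assms(3) by (intro ennreal_leI mult_right_mono) auto
  finally show ?thesis .
qed

lemma increasing_of_deriv_ge:
  fixes f f' :: "real \<Rightarrow> real"
  assumes I: "is_interval I" and d: "\<And>x. x \<in> I \<Longrightarrow> (f has_real_derivative f' x) (at x)"
    and c: "\<And>x. x \<in> I \<Longrightarrow> f' x \<ge> c" and xy: "x \<in> I" "y \<in> I" "x \<le> y"
  shows "c * (y - x) \<le> f y - f x"
proof (cases "x = y")
  case False
  then have lt: "x < y" using xy by simp
  have sub: "z \<in> I" if "x \<le> z" "z \<le> y" for z
    using I xy(1,2) that unfolding is_interval_1 by blast
  from MVT2[OF lt, of f f'] sub d obtain z where z: "x < z" "z < y" "f y - f x = (y - x) * f' z" by blast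
  have "(y - x) * c \<le> (y - x) * f' z" using z c sub lt by (intro mult_left_mono) auto
  then show ?thesis using z by (simp add: mult.commute)
qed simp

text \<open>
  As in van der Corput's lemma: away from a short interval the next lower derivative is bounded below
  in absolute value, and one descends to the function itself.
\<close>

lemma sublevel_covered:
  fixes g :: "nat \<Rightarrow> real \<Rightarrow> real"
  assumes "is_interval I" and "\<And>i x. (g i has_real_derivative g (Suc i) x) (at x)"
    and "\<And>x. x \<in> I \<Longrightarrow> g (Suc k) x \<ge> c" and "c > 0" "\<delta> > 0"
  shows "covered (2 ^ (k + 2) - 2) (2 * (\<delta> / c) powr (1 / real (Suc k))) {x \<in> I. \<bar>g 0 x\<bar> < \<delta>}"
  using assms
proof (induction k arbitrary: I c g)
  case 0
  have "covered 2 (2 * (\<delta> / c)) {x \<in> I. \<bar>g 0 x\<bar> < \<delta>}"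
  proof (rule covered_diameter)
    fix x y assume xy: "x \<in> {x \<in> I. \<bar>g 0 x\<bar> < \<delta>}" "y \<in> {x \<in> I. \<bar>g 0 x\<bar> < \<delta>}" "x \<le> y"
    have "c * (y - x) \<le> g 0 y - g 0 x"
      by (rule increasing_of_deriv_ge[OF 0(1), of _ "g (Suc 0)"]) (use 0 xy in auto)
    also have "\<dots> \<le> 2 * \<delta>" using xy by auto
    finally show "y - x \<le> 2 * (\<delta> / c)" using 0(4) by (simp add: field_simps)
  qed
  then show ?case using 0 by simp
next
  case (Suc k)
  define q where "q = \<delta> / c"
  have q: "q > 0" using Suc by (simp add: q_def)
  \<comment> \<open>This \<open>\<eta>\<close> balances the two contributions: the set where the
    lower derivative is below \<open>\<eta>\<close> and the intervals supplied by induction outside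
    it get the same length \<open>L\<close>.\<close>
  define \<eta> where "\<eta> = c * q powr (1 / real (Suc (Suc k)))"
  have \<eta>: "\<eta> > 0" using Suc q by (simp add: \<eta>_def)
  define L where "L = 2 * q powr (1 / real (Suc (Suc k)))"
  have inc: "c * (y - x) \<le> g (Suc k) y - g (Suc k) x" if "x \<in> I" "y \<in> I" "x \<le> y" for x y
    by (rule increasing_of_deriv_ge[OF Suc.prems(1), of _ "g (Suc (Suc k))"]) (use Suc that in auto)
  have mono: "g (Suc k) x \<le> g (Suc k) y" if "x \<in> I" "y \<in> I" "x \<le> y" for x y
  proof -
    have "0 \<le> c * (y - x)" using Suc.prems(4) that by simp
    with inc[OF that] show ?thesis by linarith
  qed
  have len: "2 * (\<delta> / \<eta>) powr (1 / real (Suc k)) = L"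
  proof -
    have "\<delta> / \<eta> = q powr (1 - 1 / real (Suc (Suc k)))"
      using q Suc.prems(4,5) by (simp add: powr_diff \<eta>_def q_def)
    then have "(\<delta> / \<eta>) powr (1 / real (Suc k)) = q powr ((1 - 1 / real (Suc (Suc k))) * (1 / real (Suc k)))"
      by (simp add: powr_powr)
    also have "(1 - 1 / real (Suc (Suc k))) * (1 / real (Suc k)) = 1 / real (Suc (Suc k))"
      by (simp add: field_simps)
    finally show ?thesis by (simp add: L_def)
  qed
  have mid: "covered 2 L {x \<in> I. \<bar>g (Suc k) x\<bar> < \<eta>}"
  proof (rule covered_diameter)
    fix x y assume xy: "x \<in> {x \<in> I. \<bar>g (Suc k) x\<bar> < \<eta>}" "y \<in> {x \<in> I. \<bar>g (Suc k) x\<bar> < \<eta>}" "x \<le> y"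
    then have "c * (y - x) \<le> 2 * \<eta>" using inc[of x y] by auto
    then have "y - x \<le> 2 * \<eta> / c" using Suc.prems(4) by (simp add: field_simps)
    also have "\<dots> = L" using Suc.prems(4) by (simp add: \<eta>_def L_def)
    finally show "y - x \<le> L" .
  qed
  \<comment> \<open>\<open>g (Suc k)\<close> increases on \<open>I\<close>, so \<open>U\<close> and
    \<open>V\<close> are intervals; induction applies to \<open>g\<close> on the first and to
    \<open>- g\<close> on the second.\<close>
  define U where "U = {x \<in> I. g (Suc k) x \<ge> \<eta>}"
  define V where "V = {x \<in> I. - g (Suc k) x \<ge> \<eta>}"
  have iU: "is_interval U"
    unfolding is_interval_1
  proof safe
    fix a b x assume ab: "a \<in> U" "b \<in> U" "a \<le> x" "x \<le> b"
    then have "a \<in> I" "b \<in> I" by (auto simp: U_def)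
    then have "x \<in> I" using Suc.prems(1) ab(3,4) unfolding is_interval_1 by blast
    then show "x \<in> U" using ab mono[of a x] by (auto simp: U_def)
  qed
  have iV: "is_interval V"
    unfolding is_interval_1
  proof safe
    fix a b x assume ab: "a \<in> V" "b \<in> V" "a \<le> x" "x \<le> b"
    then have "a \<in> I" "b \<in> I" by (auto simp: V_def)
    then have "x \<in> I" using Suc.prems(1) ab(3,4) unfolding is_interval_1 by blast
    then show "x \<in> V" using ab mono[of x b] by (auto simp: V_def)
  qed
  have cU: "covered (2 ^ (k + 2) - 2) L {x \<in> U. \<bar>g 0 x\<bar> < \<delta>}"
    unfolding len[symmetric]
  proof (rule Suc.IH[of U g \<eta>])
    show "(g i has_real_derivative g (Suc i) x) (at x)" for i x by (rule Suc.prems(2))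
  qed (use iU \<eta> Suc.prems(5) in \<open>auto simp: U_def\<close>)
  have cV': "covered (2 ^ (k + 2) - 2) L {x \<in> V. \<bar>- g 0 x\<bar> < \<delta>}"
    unfolding len[symmetric]
  proof (rule Suc.IH[of V "\<lambda>i x. - g i x" \<eta>])
    show "((\<lambda>x. - g i x) has_real_derivative - g (Suc i) x) (at x)" for i x
      by (rule DERIV_minus) (rule Suc.prems(2))
  qed (use iV \<eta> Suc.prems(5) in \<open>auto simp: V_def\<close>)
  have cV: "covered (2 ^ (k + 2) - 2) L {x \<in> V. \<bar>g 0 x\<bar> < \<delta>}"
    using cV' by simp
  have "covered (2 + ((2 ^ (k + 2) - 2) + (2 ^ (k + 2) - 2))) L
     ({x \<in> I. \<bar>g (Suc k) x\<bar> < \<eta>} \<union> ({x \<in> U. \<bar>g 0 x\<bar> < \<delta>} \<union> {x \<in> V. \<bar>g 0 x\<bar> < \<delta>}))"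
    by (intro covered_Un mid cU cV)
  \<comment> \<open>The count satisfies \<open>N(k+1) = 2 + 2 N(k)\<close> with
    \<open>N(0) = 2\<close>.\<close>
  moreover have "2 + ((2 ^ (k + 2) - 2) + (2 ^ (k + 2) - 2)) \<le> 2 ^ (Suc k + 2) - (2::nat)"
  proof -
    obtain e where "(2::nat) ^ k = Suc e" by (cases "(2::nat) ^ k") auto
    then show ?thesis by simp
  qed
  ultimately show ?case
    by (rule covered_mono) (auto simp: L_def q_def U_def V_def)
qed

text \<open>
  The differential operator with characteristic roots \<open>B j\<close>, \<open>j \<noteq> j0\<close>, annihilates all terms but one, so
  that at every point some derivative of order at most \<open>n\<close> is bounded below.
\<close>

lemma exponential_sum_sublevel:
  fixes b :: "'j::finite \<Rightarrow> int"
  assumes inj: "inj b" and card: "CARD('j) = Suc n" and n: "n \<ge> 1"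
  shows "\<exists>C\<ge>0. \<exists>N. \<forall>w::'j \<Rightarrow> complex. (\<forall>j. cmod (w j) = 1) \<longrightarrow> (\<forall>\<delta>>0.
     covered N (C * \<delta> powr (1 / real n)) {x \<in> {0..1}. cmod (\<Sum>j\<in>UNIV. w j * cis (2 * pi * of_int (b j) * x)) < \<delta>})"
proof -
  define B where "B j = \<i> * of_real (2 * pi * of_int (b j))" for j
  have injB: "inj B"
    using inj by (auto simp: inj_def B_def)
  obtain j0 :: 'j where True by simp
  define l where "l = (\<Prod>j\<in>-{j0}. [:- B j, 1:])"
  have degl: "degree l = n"
  proof -
    have "degree l = (\<Sum>j\<in>-{j0}. degree [:- B j, 1:])" unfolding l_def by (rule degree_prod_eq_sum_degree) auto
    also have "\<dots> = card (-{j0} :: 'j set)" by simp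
    also have "\<dots> = n" using card by (simp add: Compl_eq_Diff_UNIV card_Diff_subset)
    finally show ?thesis .
  qed
  have l0: "poly l (B j) = 0" if "j \<noteq> j0" for j
    unfolding l_def poly_prod by (rule prod_zero) (use that in auto)
  have l1: "poly l (B j0) \<noteq> 0"
    unfolding l_def poly_prod using injB by (auto simp: inj_def)
  define \<Lambda> where "\<Lambda> = (\<Sum>i\<le>n. cmod (coeff l i))"
  \<comment> \<open>If all derivatives up to order \<open>n\<close> were below \<open>c0\<close> at
    a point, the operator \<open>l\<close> would have a value of modulus less than
    \<open>|l(B j0)|\<close>, although the only term it does not annihilate has exactly this
    modulus. The cap at 1 keeps \<open>2 / c0\<close> above 1.\<close>
  define c0 where "c0 = min 1 (cmod (poly l (B j0)) / (\<Lambda> + 1))"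
  have \<Lambda>0: "\<Lambda> \<ge> 0" by (simp add: \<Lambda>_def sum_nonneg)
  have c0: "c0 > 0" "c0 \<le> 1" using l1 \<Lambda>0 by (auto simp: c0_def)
  define f where "f w i x = (\<Sum>j\<in>UNIV. w j * B j ^ i * cis (2 * pi * of_int (b j) * x))" for w :: "'j \<Rightarrow> complex" and i x
  have ecis: "cis (2 * pi * of_int (b j) * x) = exp (B j * of_real x)" for j x
    by (simp add: B_def cis_conv_exp mult_ac)
  have fd: "(f w i has_vector_derivative f w (Suc i) x) (at x)" for w i x
    unfolding f_def ecis
    by (auto intro!: derivative_eq_intros has_vector_derivative_real_field simp: mult_ac)
  have big: "\<exists>i\<le>n. cmod (f w i x) \<ge> c0" if w: "\<And>j. cmod (w j) = 1" for w x
  proof (rule ccontr)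
    assume "\<not> ?thesis"
    then have sm: "cmod (f w i x) < c0" if "i \<le> n" for i using that by auto
    have "(\<Sum>i\<le>n. coeff l i * f w i x) = (\<Sum>i\<le>n. \<Sum>j\<in>UNIV. w j * cis (2 * pi * of_int (b j) * x) * (coeff l i * B j ^ i))"
      by (simp add: f_def sum_distrib_left mult_ac)
    also have "\<dots> = (\<Sum>j\<in>UNIV. w j * cis (2 * pi * of_int (b j) * x) * poly l (B j))"
      by (subst sum.swap) (simp add: poly_altdef degl sum_distrib_left)
    also have "\<dots> = (\<Sum>j\<in>{j0}. w j * cis (2 * pi * of_int (b j) * x) * poly l (B j))"
      by (rule sum.mono_neutral_right) (auto simp: l0)
    finally have "cmod (poly l (B j0)) = cmod (\<Sum>i\<le>n. coeff l i * f w i x)"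
      by (simp add: norm_mult w)
    also have "\<dots> \<le> (\<Sum>i\<le>n. cmod (coeff l i) * c0)"
      by (rule order_trans[OF norm_sum]) (auto simp: norm_mult intro!: sum_mono mult_left_mono less_imp_le[OF sm])
    also have "\<dots> = \<Lambda> * c0" by (simp add: \<Lambda>_def sum_distrib_right)
    also have "\<dots> < (\<Lambda> + 1) * c0" using c0 by simp
    also have "\<dots> \<le> (\<Lambda> + 1) * (cmod (poly l (B j0)) / (\<Lambda> + 1))" using \<Lambda>0 by (intro mult_left_mono) (auto simp: c0_def)
    also have "\<dots> = cmod (poly l (B j0))" using \<Lambda>0 by simp
    finally show False by simp
  qed
  define W where "W = 1 + (\<Sum>i\<le>Suc n. \<Sum>j\<in>UNIV. cmod (B j) ^ i)"
  have "0 \<le> (\<Sum>i\<le>Suc n. \<Sum>j\<in>UNIV. cmod (B j) ^ i)" by (intro sum_nonneg) auto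
  then have W1: "W \<ge> 1" by (simp only: W_def)
  have fW: "cmod (f w i x) \<le> W" if "\<And>j. cmod (w j) = 1" "i \<le> Suc n" for w i x
  proof -
    have "cmod (f w i x) \<le> (\<Sum>j\<in>UNIV. cmod (B j) ^ i)" unfolding f_def
      by (rule order_trans[OF norm_sum]) (simp add: norm_mult that norm_power)
    also have "\<dots> \<le> (\<Sum>i\<le>Suc n. \<Sum>j\<in>UNIV. cmod (B j) ^ i)"
      by (rule member_le_sum[of i _ "\<lambda>i. \<Sum>j\<in>UNIV. cmod (B j) ^ i"]) (use that in \<open>auto intro!: sum_nonneg\<close>)
    finally show ?thesis by (simp add: W_def)
  qed
  have lip: "cmod (f w i x - f w i y) \<le> W * \<bar>x - y\<bar>" if w: "\<And>j. cmod (w j) = 1" and i: "i \<le> n" for w i x y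
  proof -
    have "norm (f w i x - f w i y) \<le> W * norm (x - y)"
    proof (rule differentiable_bound[of UNIV "f w i" "\<lambda>x h. h *\<^sub>R f w (Suc i) x"])
      fix x :: real
      show "(f w i has_derivative (\<lambda>h. h *\<^sub>R f w (Suc i) x)) (at x within UNIV)"
        using fd[of w i x] by (simp add: has_vector_derivative_def)
      show "onorm (\<lambda>h. h *\<^sub>R f w (Suc i) x) \<le> W"
      proof (rule onorm_bound)
        fix h :: real
        have "\<bar>h\<bar> * cmod (f w (Suc i) x) \<le> \<bar>h\<bar> * W"
          using fW[of w "Suc i" x, OF w] i by (intro mult_left_mono) auto
        then show "norm (h *\<^sub>R f w (Suc i) x) \<le> W * norm h" by (simp add: mult.commute)
      qed (use W1 in simp)
    qed auto
    then show ?thesis by simp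
  qed
  \<comment> \<open>\<open>W\<close> is a common Lipschitz constant of the derivatives in question.
    On an interval of length \<open>1 / Q\<close> they vary by at most \<open>c0 / 2\<close>, so one
    that is at least \<open>c0\<close> at the left end stays above \<open>c0 / 2\<close>.\<close>
  define Q where "Q = nat \<lceil>2 * W / c0\<rceil>"
  have Q: "real Q \<ge> 2 * W / c0" unfolding Q_def by (rule real_nat_ceiling_ge)
  have "2 * W / c0 > 0" using W1 c0 by simp
  then have Q0: "real Q > 0" using Q by linarith
  define C where "C = 2 * (2 / c0) powr (1 / real n)"
  have C2: "C \<ge> 2"
  proof -
    have "(2 / c0) powr (1 / real n) \<ge> 1" using c0 by (intro ge_one_powr_ge_zero) (auto simp: field_simps)
    then show ?thesis by (simp add: C_def)
  qed
  have main: "covered (Suc Q * 2 ^ (n + 2)) (C * \<delta> powr (1 / real n)) {x \<in> {0..1}. cmod (f w 0 x) < \<delta>}"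
    if w: "\<And>j. cmod (w j) = 1" and \<delta>: "\<delta> > 0" for w \<delta>
  proof (cases "\<delta> \<le> c0 / 2")
    case False
    have "1 \<le> (2 * \<delta> / c0) powr (1 / real n)"
      using False c0 by (intro ge_one_powr_ge_zero) (auto simp: field_simps)
    also have "(2 * \<delta> / c0) powr (1 / real n) = (2 / c0) powr (1 / real n) * \<delta> powr (1 / real n)"
      using c0 \<delta> by (simp add: powr_mult[symmetric])
    also have "\<dots> \<le> C * \<delta> powr (1 / real n)" by (simp add: C_def)
    finally have "1 \<le> C * \<delta> powr (1 / real n)" .
    then show ?thesis unfolding covered_def by (intro exI[of _ "{0}"]) (auto simp: Suc_le_eq)
  next
    case True
    define I where "I q = {real q / real Q..(real q + 1) / real Q}" for q :: nat
    have cov1: "covered (2 ^ (n + 2)) (C * \<delta> powr (1 / real n)) {x \<in> I q. cmod (f w 0 x) < \<delta>}" for q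
    proof -
      define y where "y = real q / real Q"
      obtain i where i: "i \<le> n" "cmod (f w i y) \<ge> c0" using big[of w y, OF w] by blast
      \<comment> \<open>Rotation by \<open>u\<close> makes the selected derivative at
        \<open>y\<close> real and positive, so that its real part keeps the lower bound and real
        calculus applies.\<close>
      define u where "u = cnj (f w i y) / cmod (f w i y)"
      have nz: "cmod (f w i y) > 0" using i c0 by linarith
      have u1: "cmod u = 1" using nz by (simp add: u_def norm_divide)
      have ufy: "u * f w i y = of_real (cmod (f w i y))"
        using nz by (simp add: u_def complex_norm_square[symmetric] power2_eq_square mult.commute)
      define g where "g k x = Re (u * f w k x)" for k x
      have gd: "(g k has_real_derivative g (Suc k) x) (at x)" for k x
      proof -
        have "((\<lambda>x. Re (u * f w k x)) has_vector_derivative Re (u * f w (Suc k) x)) (at x)"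
          by (rule bounded_linear.has_vector_derivative[OF bounded_linear_Re has_vector_derivative_mult_right[OF fd]])
        then show ?thesis by (simp add: g_def[abs_def] has_real_derivative_iff_has_vector_derivative)
      qed
      have gi: "g i x \<ge> c0 / 2" if x: "x \<in> I q" for x
      proof -
        have "\<bar>x - y\<bar> \<le> 1 / real Q" using x Q0 by (auto simp: I_def y_def add_divide_distrib)
        also have "\<dots> \<le> c0 / (2 * W)"
        proof -
          have "2 * W \<le> real Q * c0" using Q c0 by (simp add: pos_divide_le_eq)
          then show ?thesis using Q0 W1 by (simp add: field_simps)
        qed
        finally have xy: "\<bar>x - y\<bar> \<le> c0 / (2 * W)" .
        have "cmod (f w i x - f w i y) \<le> W * \<bar>x - y\<bar>" by (rule lip[of w i x y, OF w i(1)])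
        also have "\<dots> \<le> W * (c0 / (2 * W))" using xy W1 by (intro mult_left_mono) auto
        also have "\<dots> = c0 / 2" using W1 by simp
        finally have d: "cmod (f w i x - f w i y) \<le> c0 / 2" .
        have "cmod (u * (f w i y - f w i x)) \<le> c0 / 2" using d by (simp add: norm_mult u1 norm_minus_commute)
        then have "Re (u * (f w i y - f w i x)) \<le> c0 / 2" using complex_Re_le_cmod order_trans by blast
        moreover have "Re (u * (f w i y - f w i x)) = cmod (f w i y) - g i x"
          by (simp only: right_diff_distrib ufy g_def minus_complex.simps Re_complex_of_real)
        ultimately show ?thesis using i by linarith
      qed
      have sub: "{x \<in> I q. cmod (f w 0 x) < \<delta>} \<subseteq> {x \<in> I q. \<bar>g 0 x\<bar> < \<delta>}"
      proof safe
        fix x assume "cmod (f w 0 x) < \<delta>"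
        moreover have "\<bar>g 0 x\<bar> \<le> cmod (f w 0 x)"
          using abs_Re_le_cmod[of "u * f w 0 x"] by (simp add: g_def norm_mult u1)
        ultimately show "\<bar>g 0 x\<bar> < \<delta>" by linarith
      qed
      show ?thesis
      proof (cases i)
        case 0
        have "{x \<in> I q. cmod (f w 0 x) < \<delta>} = {}"
        proof -
          have "\<bar>g 0 x\<bar> \<ge> \<delta>" if "x \<in> I q" for x using gi[OF that] True 0 by simp
          then show ?thesis using sub by fastforce
        qed
        then show ?thesis by (simp add: covered_def) (rule exI[of _ "{}"], simp)
      next
        case (Suc k)
        have int: "is_interval (I q)" by (simp add: I_def is_interval_cc)
        have "covered (2 ^ (k + 2) - 2) (2 * (\<delta> / (c0 / 2)) powr (1 / real (Suc k))) {x \<in> I q. \<bar>g 0 x\<bar> < \<delta>}"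
        proof (rule sublevel_covered[of "I q" g])
          show "(g i has_real_derivative g (Suc i) x) (at x)" for i x by (rule gd)
        qed (use int gi Suc c0 \<delta> in auto)
        moreover have "2 ^ (k + 2) - 2 \<le> (2::nat) ^ (n + 2)"
        proof -
          have "(2::nat) ^ (k + 2) \<le> 2 ^ (n + 2)" using Suc i by (intro power_increasing) auto
          then show ?thesis by linarith
        qed
        moreover have "2 * (\<delta> / (c0 / 2)) powr (1 / real (Suc k)) \<le> C * \<delta> powr (1 / real n)"
        proof -
          \<comment> \<open>Since \<open>2 * \<delta> / c0\<close> is at most 1, order
            \<open>n\<close> gives the weakest of the possible bounds.\<close>
          have "(2 * \<delta> / c0) powr (1 / real (Suc k)) \<le> (2 * \<delta> / c0) powr (1 / real n)"
            using True c0 \<delta> Suc i by (intro powr_mono') (auto simp: field_simps)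
          also have "(2 * \<delta> / c0) powr (1 / real n) = (2 / c0) powr (1 / real n) * \<delta> powr (1 / real n)"
            using c0 \<delta> by (simp add: powr_mult[symmetric])
          finally show ?thesis by (simp add: C_def mult.commute)
        qed
        ultimately show ?thesis using sub by (rule covered_mono)
      qed
    qed
    have "{x \<in> {0..1}. cmod (f w 0 x) < \<delta>} \<subseteq> (\<Union>q\<in>{..Q}. {x \<in> I q. cmod (f w 0 x) < \<delta>})"
    proof
      fix x assume x: "x \<in> {x \<in> {0..1}. cmod (f w 0 x) < \<delta>}"
      define q where "q = nat \<lfloor>x * real Q\<rfloor>"
      have xq: "real q \<le> x * real Q" "x * real Q \<le> real q + 1"
        using x Q0 by (auto simp: q_def)
      have "x * real Q \<le> 1 * real Q" using x by (intro mult_right_mono) auto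
      then have "real q \<le> real Q" using xq(1) by linarith
      moreover have "x \<in> I q" using xq Q0 by (simp add: I_def field_simps)
      ultimately show "x \<in> (\<Union>q\<in>{..Q}. {x \<in> I q. cmod (f w 0 x) < \<delta>})" using x by auto
    qed
    note sub = this
    have "covered (card {..Q} * 2 ^ (n + 2)) (C * \<delta> powr (1 / real n)) (\<Union>q\<in>{..Q}. {x \<in> I q. cmod (f w 0 x) < \<delta>})"
      by (rule covered_UN[OF _ cov1]) simp
    from covered_mono[OF this _ order_refl sub] show ?thesis by simp
  qed
  have "covered (Suc Q * 2 ^ (n + 2)) (C * \<delta> powr (1 / real n)) {x \<in> {0..1}. cmod (\<Sum>j\<in>UNIV. w j * cis (2 * pi * of_int (b j) * x)) < \<delta>}"
    if "\<forall>j. cmod (w j) = 1" "\<delta> > 0" for w \<delta>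
    using main[of w \<delta>] that by (simp add: f_def)
  then show ?thesis using C2 by (intro exI[of _ C] conjI exI[of _ "Suc Q * 2 ^ (n + 2)"]) auto
qed

section \<open>The logarithmic integral\<close>

text \<open>On the set where \<open>f\<close> has size about \<open>2^(-i)\<close>, the integrand is
  at most \<open>g^(i+1)\<close>, while the measure decays like \<open>2^(-i / n)\<close>. The
  contributions form a geometric series of ratio \<open>2^(\<gamma> - 1/n)\<close>.\<close>

lemma dyadic_nn_integral_bound:
  fixes N n :: nat
  assumes n: "n \<ge> 1" and \<gamma>: "0 < \<gamma>" "\<gamma> < 1 / real n" and C: "C \<ge> 0"
  shows "\<exists>K\<ge>0. \<forall>f \<phi> M. f \<in> borel_measurable borel \<longrightarrow> (\<forall>x. 0 \<le> f x \<and> f x \<le> 1) \<longrightarrow>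
     (\<forall>\<delta>>0. covered N (C * \<delta> powr (1 / real n)) {x \<in> {0..1}. f x < \<delta>}) \<longrightarrow>
     (\<forall>x. \<phi> x \<le> M) \<longrightarrow> (\<forall>x. f x > 0 \<longrightarrow> \<phi> x \<le> f x powr (- \<gamma>)) \<longrightarrow>
     (\<integral>\<^sup>+x. ennreal (\<phi> x) * indicator {0..1} x \<partial>lborel) \<le> ennreal K"
proof -
  define g where "g = 2 powr \<gamma>"
  have g1: "g > 1" using \<gamma> by (simp add: g_def)
  define \<sigma> where "\<sigma> = g * (1 / 2) powr (1 / real n)"
  have \<sigma>e: "\<sigma> = 2 powr (\<gamma> - 1 / real n)"
    by (simp add: \<sigma>_def g_def powr_diff powr_divide)
  have \<sigma>: "0 < \<sigma>" "\<sigma> < 1"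
  proof -
    show "0 < \<sigma>" by (simp add: \<sigma>e)
    have "2 powr (\<gamma> - 1 / real n) < 2 powr 0" using \<gamma> by (intro powr_less_mono) auto
    then show "\<sigma> < 1" by (simp add: \<sigma>e)
  qed
  define A where "A = g * (real N * (C * 2 powr (1 / real n)))"
  have A0: "A \<ge> 0" using C g1 by (simp add: A_def)
  define K where "K = A / (1 - \<sigma>)"
  have K0: "K \<ge> 0" using A0 \<sigma> by (simp add: K_def)
  have "(\<integral>\<^sup>+x. ennreal (\<phi> x) * indicator {0..1} x \<partial>lborel) \<le> ennreal K"
    if f: "f \<in> borel_measurable borel" "\<And>x. 0 \<le> f x" "\<And>x. f x \<le> 1"
      and cov: "\<And>\<delta>. \<delta> > 0 \<Longrightarrow> covered N (C * \<delta> powr (1 / real n)) {x \<in> {0..1}. f x < \<delta>}"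
      and \<phi>M: "\<And>x. \<phi> x \<le> M" and \<phi>f: "\<And>x. f x > 0 \<Longrightarrow> \<phi> x \<le> f x powr (- \<gamma>)" for f \<phi> M
  proof -
    define E where "E i = {x \<in> {0..1}. f x < 2 * (1 / 2) ^ i}" for i :: nat
    have Eb: "E i \<in> sets borel" for i
    proof -
      have "E i = {0..1} \<inter> {x \<in> space borel. f x < 2 * (1 / 2) ^ i}" by (auto simp: E_def)
      then show ?thesis using f(1) by simp
    qed
    have pw: "\<exists>i. \<phi> x \<le> g ^ Suc i \<and> f x < 2 * (1 / 2) ^ i" for x
    proof (cases "f x > 0")
      case True
      define P where "P i \<longleftrightarrow> (1 / 2) ^ Suc i < f x" for i
      obtain i0 where "(1 / 2) ^ i0 < f x" using real_arch_pow_inv[OF True, of "1/2"] by auto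
      then have "P i0" unfolding P_def by (simp add: field_simps)
      define i where "i = (LEAST i. P i)"
      have Pi: "P i" unfolding i_def by (rule LeastI) fact
      have fi: "f x \<le> (1 / 2) ^ i"
      proof (cases i)
        case 0
        then show ?thesis using f(3) by simp
      next
        case (Suc j)
        then have "\<not> P j" using not_less_Least[of j P] by (simp add: i_def)
        then show ?thesis by (simp add: P_def Suc)
      qed
      have "\<phi> x \<le> f x powr (- \<gamma>)" by (rule \<phi>f[OF True])
      also have "\<dots> \<le> ((1 / 2) ^ Suc i) powr (- \<gamma>)"
        by (rule powr_mono2') (use Pi \<gamma> in \<open>auto simp: P_def\<close>)
      also have "\<dots> = g ^ Suc i"
      proof -
        have "((1 / 2) ^ Suc i) powr (- \<gamma>) = ((2::real) powr (- real (Suc i))) powr (- \<gamma>)"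
          by (simp add: powr_minus powr_realpow power_divide inverse_eq_divide del: of_nat_Suc power_Suc)
        also have "\<dots> = (2 powr \<gamma>) powr real (Suc i)" by (simp only: powr_powr) (simp add: algebra_simps)
        also have "\<dots> = g ^ Suc i" using g1 by (simp add: g_def powr_realpow del: of_nat_Suc power_Suc)
        finally show ?thesis .
      qed
      finally have "\<phi> x \<le> g ^ Suc i" .
      moreover have "(1 / 2 :: real) ^ i < 2 * (1 / 2) ^ i" by simp
      then have "f x < 2 * (1 / 2) ^ i" using fi by linarith
      ultimately show ?thesis by blast
    next
      case False
      \<comment> \<open>A zero of \<open>f\<close> in the unit interval lies in every
        \<open>E i\<close>, so some level with \<open>g^i > M\<close> takes care of it. The constant
        \<open>K\<close> therefore does not depend on \<open>M\<close>, which will be the unbounded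
        quantity \<open>q^(-\<gamma>)\<close>.\<close>
      then have "f x = 0" using f(2)[of x] by simp
      moreover obtain i where "M < g ^ i" using real_arch_pow[OF g1] by blast
      moreover have "g ^ i \<le> g ^ Suc i" using g1 by simp
      ultimately show ?thesis using \<phi>M[of x] by (intro exI[of _ i]) auto
    qed
    have "(\<integral>\<^sup>+x. ennreal (\<phi> x) * indicator {0..1} x \<partial>lborel)
        \<le> (\<integral>\<^sup>+x. (suminf (\<lambda>i. ennreal (g ^ Suc i) * indicator (E i) x)) \<partial>lborel)"
    proof (rule nn_integral_mono)
      fix x :: real
      show "ennreal (\<phi> x) * indicator {0..1} x \<le> (suminf (\<lambda>i. ennreal (g ^ Suc i) * indicator (E i) x))"
      proof (cases "x \<in> {0..1}")
        case True
        obtain i where i: "\<phi> x \<le> g ^ Suc i" "f x < 2 * (1 / 2) ^ i" using pw by blast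
        have "ennreal (\<phi> x) * indicator {0..1} x \<le> ennreal (g ^ Suc i) * indicator (E i) x"
          using True i by (simp add: E_def ennreal_leI)
        also have "\<dots> \<le> (suminf (\<lambda>i. ennreal (g ^ Suc i) * indicator (E i) x))"
        proof -
          define F where "F k = ennreal (g ^ Suc k) * indicator (E k) x" for k
          have "sum F {i} \<le> suminf F" by (rule sum_le_suminf) auto
          then have "F i \<le> suminf F" by simp
          then show ?thesis unfolding F_def .
        qed
        finally show ?thesis .
      qed simp
    qed
    also have "\<dots> = (suminf (\<lambda>i. \<integral>\<^sup>+x. ennreal (g ^ Suc i) * indicator (E i) x \<partial>lborel))"
      by (rule nn_integral_suminf) (use Eb in measurable)
    also have "\<dots> = (suminf (\<lambda>i. ennreal (g ^ Suc i) * emeasure lborel (E i)))"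
      using Eb by (intro suminf_cong nn_integral_cmult_indicator) simp
    also have "\<dots> \<le> (suminf (\<lambda>i. ennreal (A * \<sigma> ^ i)))"
    proof (rule suminf_le)
      fix i
      have "emeasure lborel (E i) \<le> ennreal (real N * (C * (2 * (1 / 2) ^ i) powr (1 / real n)))"
      proof (rule covered_emeasure)
        have "2 * (1 / 2) ^ i > (0::real)" by simp
        from cov[OF this] show "covered N (C * (2 * (1 / 2) ^ i) powr (1 / real n)) (E i)" unfolding E_def .
        show "0 \<le> C * (2 * (1 / 2) ^ i) powr (1 / real n)" using C by (intro mult_nonneg_nonneg) simp_all
      qed (rule Eb)
      then have "ennreal (g ^ Suc i) * emeasure lborel (E i) \<le> ennreal (g ^ Suc i) * ennreal (real N * (C * (2 * (1 / 2) ^ i) powr (1 / real n)))"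
        by (rule mult_left_mono) simp
      also have "\<dots> = ennreal (g ^ Suc i * (real N * (C * (2 * (1 / 2) ^ i) powr (1 / real n))))"
        using g1 C by (simp add: ennreal_mult)
      also have "g ^ Suc i * (real N * (C * (2 * (1 / 2) ^ i) powr (1 / real n))) = A * \<sigma> ^ i"
      proof -
        have "(2 * (1 / 2) ^ i) powr (1 / real n) = 2 powr (1 / real n) * ((1/2) powr (1 / real n)) ^ i"
        proof -
          have "((1/2) ^ i) powr (1 / real n) = ((1/2::real) powr real i) powr (1 / real n)"
            by (simp add: powr_realpow)
          also have "\<dots> = ((1/2) powr (1 / real n)) powr real i" by (simp only: powr_powr mult.commute)
          also have "\<dots> = ((1/2) powr (1 / real n)) ^ i" by (simp add: powr_realpow)
          finally show ?thesis by (simp add: powr_mult)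
        qed
        then show ?thesis by (simp add: A_def \<sigma>_def power_mult_distrib)
      qed
      finally show "ennreal (g ^ Suc i) * emeasure lborel (E i) \<le> ennreal (A * \<sigma> ^ i)" .
    qed auto
    also have "\<dots> = ennreal (suminf (\<lambda>i. A * \<sigma> ^ i))"
      by (rule suminf_ennreal2) (use A0 \<sigma> in \<open>auto intro!: summable_mult summable_geometric\<close>)
    also have "(suminf (\<lambda>i. A * \<sigma> ^ i)) = K"
      using \<sigma> by (simp add: suminf_mult suminf_geometric K_def summable_geometric)
    finally show ?thesis .
  qed
  then show ?thesis using K0 by (intro exI[of _ K]) blast
qed

text \<open>For \<open>y > 1\<close> the logarithm is split as \<open>ln 2 + ln y\<close>; applying
  \<open>ln z \<le> z - 1\<close> to \<open>z = y powr \<gamma>\<close> leaves a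
  \<open>- 1 / \<gamma>\<close> that pays for \<open>ln 2\<close>.\<close>

lemma ln_one_plus_le_powr:
  fixes y \<gamma> :: real
  assumes "y \<ge> 0" "0 < \<gamma>" "\<gamma> \<le> 1"
  shows "ln (1 + y) \<le> y powr \<gamma> / \<gamma>"
proof (cases "y \<le> 1")
  case True
  show ?thesis
  proof (cases "y = 0")
    case False
    then have y: "y > 0" using assms by simp
    have "ln (1 + y) \<le> y" using assms by (intro ln_add_one_self_le_self) auto
    also have "\<dots> = y powr 1" using y by simp
    also have "\<dots> \<le> y powr \<gamma>" using y True assms by (intro powr_mono') auto
    also have "\<dots> \<le> y powr \<gamma> / \<gamma>" using assms by (simp add: le_divide_eq mult_left_le)
    finally show ?thesis .
  qed simp
next
  case False
  then have y: "y > 1" by simp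
  have "ln (1 + y) \<le> ln (2 * y)" using y by simp
  also have "\<dots> = ln 2 + ln y" using y by (simp add: ln_mult)
  also have "\<dots> \<le> 1 / \<gamma> + (y powr \<gamma> - 1) / \<gamma>"
  proof (rule add_mono)
    have "ln 2 \<le> (1::real)" using ln_2_less_1 by simp
    also have "\<dots> \<le> 1 / \<gamma>" using assms by simp
    finally show "ln 2 \<le> 1 / \<gamma>" .
    have "\<gamma> * ln y = ln (y powr \<gamma>)" using y by (simp add: ln_powr)
    also have "\<dots> \<le> y powr \<gamma> - 1" using y by (intro ln_le_minus_one) auto
    finally show "ln y \<le> (y powr \<gamma> - 1) / \<gamma>" using assms by (simp add: field_simps)
  qed
  also have "\<dots> = y powr \<gamma> / \<gamma>" by (simp add: diff_divide_distrib)
  finally show ?thesis .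
qed

section \<open>Averaging over lines in the torus, and the smoothed logarithm\<close>

context character_sum
begin

text \<open>The squared modulus is a trigonometric polynomial. The normalisation to
  \<open>[0, 1]\<close> puts \<open>1 - 2 * sq\<close> into \<open>[-1, 1]\<close>, where Chebyshev
  polynomials live.\<close>

definition sq :: "(nat \<Rightarrow> real) \<Rightarrow> real" where
  "sq \<theta> = (cmod (csum \<theta>))\<^sup>2 / n1\<^sup>2"

lemma sq_eq: "sq \<theta> = (cmod (csum \<theta>) / n1)\<^sup>2"
  by (simp add: sq_def power_divide)

lemma sq_bounds: "0 \<le> sq \<theta>" "sq \<theta> \<le> 1"
proof -
  have "cmod (csum \<theta>) / n1 \<le> 1" using norm_csum[of \<theta>] n1_ge1 by simp
  then show "sq \<theta> \<le> 1" unfolding sq_eq using n1_ge1 by (intro power_le_one) auto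
qed (simp add: sq_def)

lemma csum_eq_0_iff: "csum \<theta> = 0 \<longleftrightarrow> sq \<theta> = 0"
  using n1_ge1 by (simp add: sq_def)

lemma amax_box: "a j \<in> box m (- amax) amax" "(\<lambda>i. - a j i) \<in> box m (- amax) amax"
  using amax[of j] supp by (auto simp: box_def abs_le_iff minus_le_iff)

lemma trig_poly_sq: "trig_poly m (2 * amax) sq"
proof -
  let ?Y = "box m (- amax) amax"
  have e: "comb m UNIV ?Y 1 (echar m y)" if "y \<in> ?Y" for y
    using comb_monom[of 1 UNIV y ?Y 1 m] that by simp
  have c: "comb m UNIV ?Y n1 csum"
    using comb_sum[of UNIV m UNIV ?Y "\<lambda>_. 1" "\<lambda>j. echar m (a j)"] e amax_box
    by (simp add: csum_def[abs_def] n1_def)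
  have "(\<lambda>\<theta>. cnj (csum \<theta>)) = (\<lambda>\<theta>. \<Sum>j\<in>UNIV. echar m (\<lambda>i. - a j i) \<theta>)"
    by (simp add: csum_def echar_uminus)
  then have c': "comb m UNIV ?Y n1 (\<lambda>\<theta>. cnj (csum \<theta>))"
    using comb_sum[of UNIV m UNIV ?Y "\<lambda>_. 1" "\<lambda>j. echar m (\<lambda>i. - a j i)"] e amax_box
    by (simp add: n1_def)
  have "comb m UNIV (box m (- (2 * amax)) (2 * amax)) (n1 * n1) (\<lambda>\<theta>. csum \<theta> * cnj (csum \<theta>))"
    by (rule comb_mult[OF c c']) (fastforce simp: box_def)+
  then have "trig_poly m (2 * amax) (\<lambda>\<theta>. (cmod (csum \<theta>))\<^sup>2)"
    unfolding trig_poly_def complex_norm_square by blast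
  from trig_poly_scale[OF this, of "1 / n1\<^sup>2"] show ?thesis by (simp add: sq_def[abs_def])
qed

lemma measurable_csum [measurable]: "csum \<in> borel_measurable (torus m)"
  unfolding csum_def[abs_def] by measurable

lemma measurable_sq [measurable]: "sq \<in> borel_measurable (torus m)"
  unfolding sq_def[abs_def] by measurable

lemma trig_poly_polynomial_sq: "\<exists>D. trig_poly m D (\<lambda>\<theta>. \<Sum>k\<le>N. c k * (sq \<theta> ^ k * (1 - sq \<theta>) ^ (N - k)))"
proof -
  have pw: "trig_poly m (int k * D) (\<lambda>\<theta>. f \<theta> ^ k)" if "trig_poly m D f" for D k and f :: "(nat \<Rightarrow> real) \<Rightarrow> real"
  proof (induction k)
    case 0
    then show ?case using trig_poly_const[of 0 m 1] by simp
  next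
    case (Suc k)
    then show ?case using trig_poly_mult[OF that Suc] by (simp add: algebra_simps)
  qed
  have m1: "trig_poly m (2 * amax) (\<lambda>\<theta>. 1 - sq \<theta>)"
    using trig_poly_add[OF trig_poly_const[of "2 * amax" m 1] trig_poly_scale[OF trig_poly_sq, of "-1"]] amax1 by simp
  have "trig_poly m (int N * (2 * amax)) (\<lambda>\<theta>. \<Sum>k\<le>N. c k * (sq \<theta> ^ k * (1 - sq \<theta>) ^ (N - k)))"
  proof (rule trig_poly_sum)
    fix k assume "k \<in> {..N}"
    then have "int k * (2 * amax) + int (N - k) * (2 * amax) = int N * (2 * amax)"
      by (simp add: distrib_right[symmetric] of_nat_diff)
    then show "trig_poly m (int N * (2 * amax)) (\<lambda>\<theta>. c k * (sq \<theta> ^ k * (1 - sq \<theta>) ^ (N - k)))"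
      using trig_poly_scale[OF trig_poly_mult[OF pw[OF trig_poly_sq, of k] pw[OF m1, of "N - k"]], of "c k"] by simp
  qed (use amax1 in auto)
  then show ?thesis by blast
qed

lemma integrable_continuous_sq:
  fixes \<phi> :: "real \<Rightarrow> real"
  assumes "continuous_on {0..1} \<phi>"
  shows "integrable (torus m) (\<lambda>\<theta>. \<phi> (sq \<theta>))"
proof -
  interpret finite_measure "torus m" by (rule finite_measure_torus)
  obtain B where B: "\<And>x. x \<in> {0..1} \<Longrightarrow> \<bar>\<phi> x\<bar> \<le> B"
    using compact_imp_bounded[OF compact_continuous_image[OF assms compact_Icc]]
    by (force simp: bounded_iff)
  have meas: "(\<lambda>\<theta>. \<phi> (sq \<theta>)) \<in> borel_measurable (torus m)"
  proof -
    have "\<phi> \<in> borel_measurable (restrict_space borel {0..1})"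
      by (rule borel_measurable_continuous_on_restrict[OF assms])
    moreover have "sq \<in> measurable (torus m) (restrict_space borel {0..1})"
      by (rule measurable_restrict_space2) (use sq_bounds in auto)
    ultimately show ?thesis by (rule measurable_compose[rotated])
  qed
  show ?thesis
    by (rule integrable_const_bound[of _ B]) (use B sq_bounds meas in auto)
qed

text \<open>Bernstein polynomials in \<open>sq\<close> are trigonometric polynomials, for which
  translation invariance is known; uniform approximation extends it to continuous functions of
  \<open>sq\<close>, without a change of variables on the cube.\<close>

lemma continuous_sq_shift:
  fixes \<phi> :: "real \<Rightarrow> real"
  assumes cont: "continuous_on {0..1} \<phi>"
    and int: "integrable (torus m) (\<lambda>\<theta>. \<phi> (sq (\<lambda>i. \<theta> i + c i)))"
  shows "(\<integral>\<theta>. \<phi> (sq (\<lambda>i. \<theta> i + c i)) \<partial>torus m) = (\<integral>\<theta>. \<phi> (sq \<theta>) \<partial>torus m)"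
proof -
  interpret finite_measure "torus m" by (rule finite_measure_torus)
  have one: "measure (torus m) (space (torus m)) = 1" by (simp add: measure_def emeasure_torus)
  have "\<bar>(\<integral>\<theta>. \<phi> (sq (\<lambda>i. \<theta> i + c i)) \<partial>torus m) - (\<integral>\<theta>. \<phi> (sq \<theta>) \<partial>torus m)\<bar> \<le> e" if e: "e > 0" for e
  proof -
    from Bernstein_Weierstrass[OF cont, of "e / 2"] e obtain N where
      N: "\<And>x. x \<in> {0..1} \<Longrightarrow> \<bar>\<phi> x - (\<Sum>k\<le>N. \<phi> (k / N) * Bernstein N k x)\<bar> < e / 2" by auto
    define P where "P \<theta> = (\<Sum>k\<le>N. (\<phi> (k / N) * real (N choose k)) * (sq \<theta> ^ k * (1 - sq \<theta>) ^ (N - k)))" for \<theta>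
    have PB: "\<bar>\<phi> (sq \<theta>) - P \<theta>\<bar> \<le> e / 2" for \<theta>
      using N[of "sq \<theta>"] sq_bounds[of \<theta>] by (simp add: P_def Bernstein_def mult_ac)
    from trig_poly_polynomial_sq[where N = N and c = "\<lambda>k. \<phi> (k / N) * real (N choose k)"]
    obtain D where D: "trig_poly m D P" unfolding P_def by blast
    have iP: "integrable (torus m) P" by (rule trig_poly_integrable[OF D])
    have iPs: "integrable (torus m) (\<lambda>\<theta>. P (\<lambda>i. \<theta> i + c i))"
    proof -
      from D obtain B where B: "comb m UNIV (box m (- D) D) B (\<lambda>\<theta>. complex_of_real (P \<theta>))"
        by (auto simp: trig_poly_def)
      have "box m (- D) D \<subseteq> {y. \<forall>i\<ge>m. y i = 0}" by (auto simp: box_def)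
      from comb_shift_integral[OF B this, of c] have "integrable (torus m) (\<lambda>\<theta>. complex_of_real (P (\<lambda>i. \<theta> i + c i)))" by simp
      then show ?thesis by (auto dest: integrable_Re)
    qed
    have i\<phi>: "integrable (torus m) (\<lambda>\<theta>. \<phi> (sq \<theta>))" by (rule integrable_continuous_sq[OF cont])
    have bnd: "\<bar>(\<integral>\<theta>. F \<theta> \<partial>torus m) - (\<integral>\<theta>. G \<theta> \<partial>torus m)\<bar> \<le> e / 2"
      if "integrable (torus m) F" "integrable (torus m) G" "\<And>\<theta>. \<bar>F \<theta> - G \<theta>\<bar> \<le> e / 2" for F G :: "(nat \<Rightarrow> real) \<Rightarrow> real"
    proof -
      have "\<bar>(\<integral>\<theta>. F \<theta> \<partial>torus m) - (\<integral>\<theta>. G \<theta> \<partial>torus m)\<bar> = \<bar>\<integral>\<theta>. F \<theta> - G \<theta> \<partial>torus m\<bar>" using that by simp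
      also have "\<dots> \<le> (\<integral>\<theta>. \<bar>F \<theta> - G \<theta>\<bar> \<partial>torus m)" by (rule integral_abs_bound)
      also have "\<dots> \<le> (\<integral>\<theta>. e / 2 \<partial>torus m)" using that by (intro integral_mono) auto
      also have "\<dots> = e / 2" using one by simp
      finally show ?thesis .
    qed
    show ?thesis
      using bnd[OF int iPs PB] bnd[OF i\<phi> iP PB] trig_poly_shift[OF D, of c] by linarith
  qed
  then show ?thesis using field_le_epsilon[of "\<bar>(\<integral>\<theta>. \<phi> (sq (\<lambda>i. \<theta> i + c i)) \<partial>torus m) - (\<integral>\<theta>. \<phi> (sq \<theta>) \<partial>torus m)\<bar>" 0]
    by fastforce
qed

text \<open>The three columns from \<open>indep3\<close> are pairwise different, so two equal
  columns \<open>i\<close>, \<open>j\<close> cannot both be among them. This leaves two further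
  indices \<open>k\<close>, \<open>l\<close>, and \<open>indep4\<close> with
  \<open>\<alpha> = 1\<close>, \<open>\<beta> = 0\<close> is violated.\<close>

lemma a_distinct:
  assumes "i \<noteq> j" shows "\<exists>r<m. a i r \<noteq> a j r"
proof (rule ccontr)
  assume "\<not> ?thesis"
  then have eq: "a i r = a j r" if "r < m" for r using that by blast
  from indep3 obtain x y z where xyz: "\<And>\<alpha> \<beta>. (\<alpha>, \<beta>) \<noteq> (0, 0) \<Longrightarrow>
        \<exists>r<m. \<alpha> * (a x r - a z r) + \<beta> * (a y r - a z r) \<noteq> 0" by blast
  have ne: "\<exists>r<m. a x r \<noteq> a z r" "\<exists>r<m. a y r \<noteq> a z r" "\<exists>r<m. a x r \<noteq> a y r"
    using xyz[of 1 0] xyz[of 0 1] xyz[of 1 "-1"] by auto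
  then have d: "x \<noteq> z" "y \<noteq> z" "x \<noteq> y" by auto
  have nsub: "\<not> ({i, j} \<subseteq> {x, y, z})"
  proof
    assume "{i, j} \<subseteq> {x, y, z}"
    then have "i = x \<or> i = y \<or> i = z" "j = x \<or> j = y \<or> j = z" by auto
    with assms eq ne show False by (elim disjE) force+
  qed
  then have "\<exists>k l. distinct [i, j, k, l]"
  proof -
    consider "i \<notin> {x, y, z}" | "j \<notin> {x, y, z}" using nsub by blast
    then show ?thesis
    proof cases
      case 1
      then consider "j \<noteq> x \<and> j \<noteq> y" | "j = x" | "j = y" by blast
      then show ?thesis
      proof cases
        case 1
        then show ?thesis using \<open>i \<notin> _\<close> d assms by (intro exI[of _ x] exI[of _ y]) auto
      next
        case 2
        then show ?thesis using \<open>i \<notin> _\<close> d assms by (intro exI[of _ y] exI[of _ z]) auto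
      next
        case 3
        then show ?thesis using \<open>i \<notin> _\<close> d assms by (intro exI[of _ x] exI[of _ z]) auto
      qed
    next
      case 2
      then consider "i \<noteq> x \<and> i \<noteq> y" | "i = x" | "i = y" by blast
      then show ?thesis
      proof cases
        case 1
        then show ?thesis using \<open>j \<notin> _\<close> d assms by (intro exI[of _ x] exI[of _ y]) auto
      next
        case 2
        then show ?thesis using \<open>j \<notin> _\<close> d assms by (intro exI[of _ y] exI[of _ z]) auto
      next
        case 3
        then show ?thesis using \<open>j \<notin> _\<close> d assms by (intro exI[of _ x] exI[of _ z]) auto
      qed
    qed
  qed
  then obtain k l where "distinct [i, j, k, l]" by blast
  from indep4[OF this, of 1 0] eq show False by auto
qed

lemma card_index: "CARD('j) \<ge> 3"
proof -
  from indep3 obtain x y z where xyz: "\<And>\<alpha> \<beta>. (\<alpha>, \<beta>) \<noteq> (0, 0) \<Longrightarrow>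
        \<exists>r<m. \<alpha> * (a x r - a z r) + \<beta> * (a y r - a z r) \<noteq> 0" by blast
  have "x \<noteq> z" "y \<noteq> z" "x \<noteq> y"
    using xyz[of 1 0] xyz[of 0 1] xyz[of 1 "-1"] by auto
  then have "card {x, y, z} = 3" by simp
  moreover have "card {x, y, z} \<le> CARD('j)" by (rule card_mono) auto
  ultimately show ?thesis by simp
qed

definition nn :: nat where "nn = CARD('j) - 1"

lemma nn_ge_2: "nn \<ge> 2" and card_nn: "CARD('j) = Suc nn"
  using card_index by (simp_all add: nn_def)

text \<open>
  Every exponent below \<open>1 / n\<close> makes the integral of \<open>sq\<^bsup>-\<gamma>\<^esup>\<close> converge; this one leads to the error term of the theorem.
\<close>

definition \<gamma> :: real where "\<gamma> = 3 / (8 * real nn)"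

lemma \<gamma>_bounds: "0 < \<gamma>" "\<gamma> \<le> 1"
  using nn_ge_2 by (simp_all add: \<gamma>_def divide_le_eq)

lemma csum_line:
  "csum (\<lambda>i. \<theta> i + x * of_int (v i)) = (\<Sum>j\<in>UNIV. echar m (a j) \<theta> * cis (2 * pi * of_int (ipr m v (a j)) * x))"
proof -
  have "echar m (a j) (\<lambda>i. x * of_int (v i)) = cis (2 * pi * of_int (ipr m v (a j)) * x)" for j
    by (simp add: echar_def ipr_def sum_distrib_left sum_distrib_right mult_ac)
  then show ?thesis by (simp add: csum_def echar_shift)
qed

text \<open>Along a suitable integral direction the exponents become pairwise different frequencies.
  The base point \<open>\<theta>\<close> only enters through unimodular weights, in which the
  one-dimensional sublevel estimate is uniform.\<close>

lemma line_integral_bound: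
  "\<exists>v K. K \<ge> 0 \<and> (\<forall>\<theta> q. q > 0 \<longrightarrow>
     (\<integral>\<^sup>+x. ennreal ((4 * sq (\<lambda>i. \<theta> i + x * of_int (v i)) + q) powr (- \<gamma>)) * indicator {0..1} x \<partial>lborel) \<le> ennreal K)"
proof -
  define V where "V = (\<lambda>(i, j) r. a i r - a j r) ` {(i, j). i \<noteq> j}"
  have "\<exists>w. \<forall>v\<in>V. ipr m w v \<noteq> 0"
    by (rule ex_functional_nonzero) (use a_distinct in \<open>auto simp: V_def\<close>)
  then obtain v where v: "\<And>i j. i \<noteq> j \<Longrightarrow> ipr m v (\<lambda>r. a i r - a j r) \<noteq> 0" by (force simp: V_def)
  define b where "b j = ipr m v (a j)" for j
  have inj: "inj b"
    unfolding inj_def b_def using v by (metis eq_iff_diff_eq_0 ipr_diff)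
  have n1: "nn \<ge> 1" using nn_ge_2 by simp
  from exponential_sum_sublevel[OF inj card_nn n1] obtain C N where C: "C \<ge> 0"
    and cov: "\<And>w \<delta>. (\<And>j. cmod (w j) = 1) \<Longrightarrow> \<delta> > 0 \<Longrightarrow>
       covered N (C * \<delta> powr (1 / real nn)) {x \<in> {0..1}. cmod (\<Sum>j\<in>UNIV. w j * cis (2 * pi * of_int (b j) * x)) < \<delta>}"
    by blast
  define C' where "C' = C * n1 powr (1 / real nn)"
  have C': "C' \<ge> 0" using C by (simp add: C'_def)
  \<comment> \<open>\<open>sq\<close> is quadratic in the modulus, so the modulus carries the
    exponent \<open>2 * \<gamma> = 3 / (4 n)\<close>, which has to stay below the exponent
    \<open>1 / n\<close> of the sublevel estimate.\<close>
  have \<gamma>2: "0 < 2 * \<gamma>" "2 * \<gamma> < 1 / real nn" using nn_ge_2 by (simp_all add: \<gamma>_def field_simps)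
  from dyadic_nn_integral_bound[OF n1 \<gamma>2 C', of N] obtain K where K: "K \<ge> 0"
    "\<And>f \<phi> M. f \<in> borel_measurable borel \<Longrightarrow> (\<And>x. 0 \<le> f x \<and> f x \<le> 1) \<Longrightarrow>
     (\<And>\<delta>. \<delta> > 0 \<Longrightarrow> covered N (C' * \<delta> powr (1 / real nn)) {x \<in> {0..1}. f x < \<delta>}) \<Longrightarrow>
     (\<And>x. \<phi> x \<le> M) \<Longrightarrow> (\<And>x. f x > 0 \<Longrightarrow> \<phi> x \<le> f x powr (- (2 * \<gamma>))) \<Longrightarrow>
     (\<integral>\<^sup>+x. ennreal (\<phi> x) * indicator {0..1} x \<partial>lborel) \<le> ennreal K" by blast
  have "(\<integral>\<^sup>+x. ennreal ((4 * sq (\<lambda>i. \<theta> i + x * of_int (v i)) + q) powr (- \<gamma>)) * indicator {0..1} x \<partial>lborel) \<le> ennreal K"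
    if q: "q > 0" for \<theta> q
  proof (rule K(2))
    let ?f = "\<lambda>x. cmod (csum (\<lambda>i. \<theta> i + x * of_int (v i))) / n1"
    have n10: "n1 > 0" using n1_ge1 by simp
    show "?f \<in> borel_measurable borel"
      unfolding csum_line using n10
      by (intro borel_measurable_continuous_onI) (auto intro!: continuous_intros)
    show "0 \<le> ?f x \<and> ?f x \<le> 1" for x using norm_csum n10 by simp
    show "covered N (C' * \<delta> powr (1 / real nn)) {x \<in> {0..1}. ?f x < \<delta>}" if \<delta>: "\<delta> > 0" for \<delta>
    proof -
      have "covered N (C * (n1 * \<delta>) powr (1 / real nn))
        {x \<in> {0..1}. cmod (\<Sum>j\<in>UNIV. echar m (a j) \<theta> * cis (2 * pi * of_int (b j) * x)) < n1 * \<delta>}"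
        by (rule cov) (use \<delta> n10 in auto)
      moreover have "C * (n1 * \<delta>) powr (1 / real nn) = C' * \<delta> powr (1 / real nn)"
        using \<delta> n10 by (simp add: C'_def powr_mult)
      moreover have "{x \<in> {0..1}. cmod (\<Sum>j\<in>UNIV. echar m (a j) \<theta> * cis (2 * pi * of_int (b j) * x)) < n1 * \<delta>}
         = {x \<in> {0..1}. ?f x < \<delta>}"
        using n10 by (simp add: csum_line b_def divide_less_eq mult.commute)
      ultimately show ?thesis by simp
    qed
    show "(4 * sq (\<lambda>i. \<theta> i + x * of_int (v i)) + q) powr (- \<gamma>) \<le> q powr (- \<gamma>)" for x
      by (rule powr_mono2') (use q sq_bounds \<gamma>_bounds in auto)
    show "(4 * sq (\<lambda>i. \<theta> i + x * of_int (v i)) + q) powr (- \<gamma>) \<le> ?f x powr (- (2 * \<gamma>))" if f: "?f x > 0" for x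
    proof -
      have "(4 * sq (\<lambda>i. \<theta> i + x * of_int (v i)) + q) powr (- \<gamma>) \<le> ((?f x)\<^sup>2) powr (- \<gamma>)"
        by (rule powr_mono2') (use q f \<gamma>_bounds in \<open>auto simp: sq_eq\<close>)
      also have "((?f x)\<^sup>2) powr (- \<gamma>) = (?f x powr 2) powr (- \<gamma>)" using f by simp
      also have "\<dots> = ?f x powr (- (2 * \<gamma>))" by (simp only: powr_powr) simp
      finally show ?thesis .
    qed
  qed
  then show ?thesis using K(1) by blast
qed

lemma continuous_powr_sq: "q > 0 \<Longrightarrow> continuous_on {0..1} (\<lambda>s. (4 * s + q) powr (- \<gamma>))"
  by (auto intro!: continuous_intros)

text \<open>All translates of the integrand along the chosen direction have the same integral.
  Averaging over the translates and exchanging the integrals reduces the bound to the uniform one on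
  lines.\<close>

lemma torus_integral_bound:
  "\<exists>K\<ge>0. \<forall>q>0. (\<integral>\<theta>. (4 * sq \<theta> + q) powr (- \<gamma>) \<partial>torus m) \<le> K"
proof -
  interpret finite_measure "torus m" by (rule finite_measure_torus)
  interpret pair_sigma_finite lborel "torus m" by standard
  from line_integral_bound obtain v K where K: "K \<ge> 0" and line: "\<And>\<theta> q. q > 0 \<Longrightarrow>
     (\<integral>\<^sup>+x. ennreal ((4 * sq (\<lambda>i. \<theta> i + x * of_int (v i)) + q) powr (- \<gamma>)) * indicator {0..1} x \<partial>lborel) \<le> ennreal K"
    by blast
  have "(\<integral>\<theta>. (4 * sq \<theta> + q) powr (- \<gamma>) \<partial>torus m) \<le> K" if q: "q > 0" for q
  proof -
    define \<phi> where "\<phi> s = (4 * s + q) powr (- \<gamma>)" for s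
    have cont: "continuous_on {0..1} \<phi>" unfolding \<phi>_def[abs_def] by (rule continuous_powr_sq[OF q])
    have cism [measurable]: "(\<lambda>x::real. cis (c * x)) \<in> borel_measurable borel" for c
      by (intro borel_measurable_continuous_onI continuous_intros)
    define S where "S x \<theta> = sq (\<lambda>i. \<theta> i + x * of_int (v i))" for x \<theta>
    have S_eq: "S x \<theta> = (cmod (\<Sum>j\<in>UNIV. echar m (a j) \<theta> * cis (2 * pi * of_int (ipr m v (a j)) * x)))\<^sup>2 / n1\<^sup>2" for x \<theta>
      by (simp add: S_def sq_def csum_line)
    have Sb: "0 \<le> S x \<theta>" "S x \<theta> \<le> 1" for x \<theta> by (simp_all add: S_def sq_bounds)
    have meas2: "(\<lambda>(x, \<theta>). ennreal (\<phi> (S x \<theta>)) * indicator {0..1} x) \<in> borel_measurable (lborel \<Otimes>\<^sub>M torus m)"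
      unfolding S_eq \<phi>_def by measurable
    have int: "integrable (torus m) (\<lambda>\<theta>. \<phi> (S x \<theta>))" for x
    proof (rule integrable_const_bound[of _ "q powr (- \<gamma>)"])
      have "\<phi> (S x \<theta>) \<le> q powr (- \<gamma>)" for \<theta>
        unfolding \<phi>_def by (rule powr_mono2') (use q Sb[of x \<theta>] \<gamma>_bounds in auto)
      then show "AE \<theta> in torus m. norm (\<phi> (S x \<theta>)) \<le> q powr (- \<gamma>)" by (simp add: \<phi>_def)
      show "(\<lambda>\<theta>. \<phi> (S x \<theta>)) \<in> borel_measurable (torus m)"
        unfolding S_eq \<phi>_def by measurable
    qed
    have eq: "(\<integral>\<^sup>+\<theta>. ennreal (\<phi> (S x \<theta>)) \<partial>torus m) = ennreal (\<integral>\<theta>. \<phi> (sq \<theta>) \<partial>torus m)" for x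
    proof -
      have "(\<integral>\<^sup>+\<theta>. ennreal (\<phi> (S x \<theta>)) \<partial>torus m) = ennreal (\<integral>\<theta>. \<phi> (S x \<theta>) \<partial>torus m)"
        by (rule nn_integral_eq_integral[OF int]) (simp add: \<phi>_def)
      also have "(\<integral>\<theta>. \<phi> (S x \<theta>) \<partial>torus m) = (\<integral>\<theta>. \<phi> (sq \<theta>) \<partial>torus m)"
        unfolding S_def by (rule continuous_sq_shift[OF cont int[unfolded S_def]])
      finally show ?thesis .
    qed
    have "ennreal (\<integral>\<theta>. \<phi> (sq \<theta>) \<partial>torus m) = (\<integral>\<^sup>+x. ennreal (\<integral>\<theta>. \<phi> (sq \<theta>) \<partial>torus m) * indicator {0..1} x \<partial>(lborel :: real measure))"
      by (subst nn_integral_cmult_indicator) auto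
    also have "\<dots> = (\<integral>\<^sup>+x. (\<integral>\<^sup>+\<theta>. ennreal (\<phi> (S x \<theta>)) * indicator {0..1} x \<partial>torus m) \<partial>lborel)"
    proof (rule nn_integral_cong)
      fix x :: real
      have "(\<integral>\<^sup>+\<theta>. ennreal (\<phi> (S x \<theta>)) * indicator {0..1} x \<partial>torus m) = (\<integral>\<^sup>+\<theta>. ennreal (\<phi> (S x \<theta>)) \<partial>torus m) * indicator {0..1} x"
        by (rule nn_integral_multc) (use int in auto)
      then show "ennreal (\<integral>\<theta>. \<phi> (sq \<theta>) \<partial>torus m) * indicator {0..1} x = (\<integral>\<^sup>+\<theta>. ennreal (\<phi> (S x \<theta>)) * indicator {0..1} x \<partial>torus m)"
        by (simp add: eq)
    qed
    also have "\<dots> = (\<integral>\<^sup>+\<theta>. (\<integral>\<^sup>+x. ennreal (\<phi> (S x \<theta>)) * indicator {0..1} x \<partial>lborel) \<partial>torus m)"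
      by (rule Fubini'[symmetric]) (rule meas2)
    also have "\<dots> \<le> (\<integral>\<^sup>+\<theta>. ennreal K \<partial>torus m)"
      unfolding \<phi>_def S_def by (intro nn_integral_mono line q)
    also have "\<dots> = ennreal K" by (simp add: emeasure_torus)
    finally show ?thesis using K by (simp add: \<phi>_def)
  qed
  then show ?thesis using K by blast
qed

definition logint :: "real \<Rightarrow> real" where
  "logint q = (\<integral>\<theta>. ln (4 * sq \<theta> + q) \<partial>torus m)"

lemma integrable_log_sq: "q > 0 \<Longrightarrow> integrable (torus m) (\<lambda>\<theta>. ln (4 * sq \<theta> + q))"
  by (rule integrable_continuous_sq[of "\<lambda>s. ln (4 * s + q)"]) (auto intro!: continuous_intros simp: add_nonneg_eq_0_iff)

text \<open>Everything follows from the bound on the integral of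
  \<open>(4 * sq \<theta> + q) powr (- \<gamma>)\<close>, which is uniform in \<open>q\<close>. A
  number in \<open>[0, 1]\<close> is at most its power \<open>\<gamma>\<close>, which treats the
  Poisson term; \<open>ln (1 + y) \<le> y powr \<gamma> / \<gamma>\<close> treats differences of
  smoothed logarithms, uniformly as the smaller parameter tends to 0.\<close>

lemma log_integral_approximation:
  "\<exists>K\<ge>0. (AE \<theta> in torus m. sq \<theta> \<noteq> 0) \<and> integrable (torus m) (\<lambda>\<theta>. ln (4 * sq \<theta>)) \<and>
     (\<forall>q>0. \<bar>logint q - (\<integral>\<theta>. ln (4 * sq \<theta>) \<partial>torus m)\<bar> \<le> K * q powr \<gamma> \<and>
        (\<integral>\<theta>. q / (q + 4 * sq \<theta>) \<partial>torus m) \<le> K * q powr \<gamma>)"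
proof -
  interpret finite_measure "torus m" by (rule finite_measure_torus)
  from torus_integral_bound obtain K0 where K0: "K0 \<ge> 0"
    "\<And>q. q > 0 \<Longrightarrow> (\<integral>\<theta>. (4 * sq \<theta> + q) powr (- \<gamma>) \<partial>torus m) \<le> K0" by blast
  define K where "K = K0 / \<gamma>"
  have KK: "K \<ge> 0" "K0 \<le> K" using K0(1) \<gamma>_bounds by (simp_all add: K_def le_divide_eq mult_left_le)
  have ip: "integrable (torus m) (\<lambda>\<theta>. (4 * sq \<theta> + q) powr (- \<gamma>))" if "q > 0" for q
    by (rule integrable_continuous_sq[OF continuous_powr_sq[OF that]])
  have pois: "(\<integral>\<theta>. q / (q + 4 * sq \<theta>) \<partial>torus m) \<le> K * q powr \<gamma>" if q: "q > 0" for q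
  proof -
    have i1: "integrable (torus m) (\<lambda>\<theta>. q / (q + 4 * sq \<theta>))"
      by (rule integrable_continuous_sq[of "\<lambda>s. q / (q + 4 * s)"]) (use q in \<open>auto intro!: continuous_intros simp: add_nonneg_eq_0_iff\<close>)
    have "(\<integral>\<theta>. q / (q + 4 * sq \<theta>) \<partial>torus m) \<le> (\<integral>\<theta>. q powr \<gamma> * (4 * sq \<theta> + q) powr (- \<gamma>) \<partial>torus m)"
    proof (rule integral_mono[OF i1])
      show "integrable (torus m) (\<lambda>\<theta>. q powr \<gamma> * (4 * sq \<theta> + q) powr (- \<gamma>))" using ip[OF q] by simp
      fix \<theta>
      have s: "4 * sq \<theta> + q > 0" using q sq_bounds[of \<theta>] by simp
      have le1: "q / (q + 4 * sq \<theta>) \<le> 1" "0 < q / (q + 4 * sq \<theta>)" using q sq_bounds[of \<theta>] by (simp_all add: add_pos_nonneg)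
      have "q / (q + 4 * sq \<theta>) = (q / (q + 4 * sq \<theta>)) powr 1"
        using le1(2) by (intro powr_one[symmetric]) linarith
      also have "\<dots> \<le> (q / (q + 4 * sq \<theta>)) powr \<gamma>" using le1 \<gamma>_bounds by (intro powr_mono') auto
      also have "\<dots> = q powr \<gamma> * (4 * sq \<theta> + q) powr (- \<gamma>)"
        using q s by (simp add: powr_divide powr_minus_divide add.commute)
      finally show "q / (q + 4 * sq \<theta>) \<le> q powr \<gamma> * (4 * sq \<theta> + q) powr (- \<gamma>)" .
    qed
    also have "\<dots> = q powr \<gamma> * (\<integral>\<theta>. (4 * sq \<theta> + q) powr (- \<gamma>) \<partial>torus m)" by simp
    also have "\<dots> \<le> q powr \<gamma> * K" using K0(2)[OF q] KK by (intro mult_left_mono) auto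
    finally show ?thesis by (simp add: mult.commute)
  qed
  have ld: "0 \<le> logint q - logint q' \<and> logint q - logint q' \<le> K * q powr \<gamma>" if q: "0 < q'" "q' \<le> q" for q q'
  proof -
    have i: "integrable (torus m) (\<lambda>\<theta>. ln (4 * sq \<theta> + q))" "integrable (torus m) (\<lambda>\<theta>. ln (4 * sq \<theta> + q'))"
      using integrable_log_sq q by auto
    have e: "logint q - logint q' = (\<integral>\<theta>. ln (4 * sq \<theta> + q) - ln (4 * sq \<theta> + q') \<partial>torus m)"
      using i by (simp add: logint_def)
    have s: "4 * sq \<theta> + q' > 0" "4 * sq \<theta> + q > 0" for \<theta> using q sq_bounds[of \<theta>] by simp_all
    have nonneg: "0 \<le> logint q - logint q'" unfolding e
    proof (rule integral_nonneg_AE, rule AE_I2)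
      fix \<theta>
      have "ln (4 * sq \<theta> + q') \<le> ln (4 * sq \<theta> + q)" using s[of \<theta>] q by (subst ln_le_cancel_iff) auto
      then show "0 \<le> ln (4 * sq \<theta> + q) - ln (4 * sq \<theta> + q')" by simp
    qed
    have "logint q - logint q' \<le> (\<integral>\<theta>. (q powr \<gamma> / \<gamma>) * (4 * sq \<theta> + q') powr (- \<gamma>) \<partial>torus m)"
      unfolding e
    proof (rule integral_mono)
      show "integrable (torus m) (\<lambda>\<theta>. ln (4 * sq \<theta> + q) - ln (4 * sq \<theta> + q'))" using i by simp
      show "integrable (torus m) (\<lambda>\<theta>. (q powr \<gamma> / \<gamma>) * (4 * sq \<theta> + q') powr (- \<gamma>))" using ip[of q'] q by simp
      fix \<theta>
      have "ln (4 * sq \<theta> + q) - ln (4 * sq \<theta> + q') = ln ((4 * sq \<theta> + q) / (4 * sq \<theta> + q'))"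
        using s[of \<theta>] by (simp add: ln_div)
      also have "\<dots> \<le> ln (1 + q / (4 * sq \<theta> + q'))"
      proof (rule ln_mono)
        have "1 + q / (4 * sq \<theta> + q') = (4 * sq \<theta> + q' + q) / (4 * sq \<theta> + q')"
          using s(1)[of \<theta>] by (simp add: add_divide_distrib)
        also have "\<dots> \<ge> (4 * sq \<theta> + q) / (4 * sq \<theta> + q')"
          using s(1)[of \<theta>] q by (intro divide_right_mono) auto
        finally show "(4 * sq \<theta> + q) / (4 * sq \<theta> + q') \<le> 1 + q / (4 * sq \<theta> + q')" .
        show "0 < (4 * sq \<theta> + q) / (4 * sq \<theta> + q')" using s[of \<theta>] by simp
      qed
      also have "\<dots> \<le> (q / (4 * sq \<theta> + q')) powr \<gamma> / \<gamma>"
        by (rule ln_one_plus_le_powr) (use s[of \<theta>] q \<gamma>_bounds in auto)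
      also have "\<dots> = (q powr \<gamma> / \<gamma>) * (4 * sq \<theta> + q') powr (- \<gamma>)"
        using q s[of \<theta>] by (simp add: powr_divide powr_minus_divide)
      finally show "ln (4 * sq \<theta> + q) - ln (4 * sq \<theta> + q') \<le> (q powr \<gamma> / \<gamma>) * (4 * sq \<theta> + q') powr (- \<gamma>)" .
    qed
    also have "\<dots> = (q powr \<gamma> / \<gamma>) * (\<integral>\<theta>. (4 * sq \<theta> + q') powr (- \<gamma>) \<partial>torus m)" by simp
    also have "\<dots> \<le> (q powr \<gamma> / \<gamma>) * K0" using K0(2)[of q'] q \<gamma>_bounds by (intro mult_left_mono) auto
    also have "\<dots> = K * q powr \<gamma>" by (simp add: K_def)
    finally show ?thesis using nonneg by blast
  qed
  have AE0: "AE \<theta> in torus m. sq \<theta> \<noteq> 0"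
  proof -
    define Z where "Z = {\<theta> \<in> space (torus m). sq \<theta> = 0}"
    have Z: "Z \<in> sets (torus m)" unfolding Z_def by measurable
    have b: "measure (torus m) Z \<le> K0 * q powr \<gamma>" if q: "q > 0" for q
    proof -
      \<comment> \<open>On \<open>Z\<close> the integrand of the uniform bound equals
        \<open>q powr (- \<gamma>)\<close>. This gives \<open>Z\<close> measure at most
        \<open>K0 * q powr \<gamma>\<close> for every \<open>q > 0\<close>.\<close>
      have "q powr (- \<gamma>) * measure (torus m) Z = (\<integral>\<theta>. q powr (- \<gamma>) * indicator Z \<theta> \<partial>torus m)"
        using Z by simp
      also have "\<dots> \<le> (\<integral>\<theta>. (4 * sq \<theta> + q) powr (- \<gamma>) \<partial>torus m)"
      proof (rule integral_mono[OF _ ip[OF q]])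
        show "integrable (torus m) (\<lambda>\<theta>. q powr (- \<gamma>) * indicator Z \<theta>)"
          using Z by (intro integrable_mult_right integrable_real_indicator) (auto simp: less_top[symmetric])
        show "q powr (- \<gamma>) * indicator Z \<theta> \<le> (4 * sq \<theta> + q) powr (- \<gamma>)" for \<theta>
          by (cases "\<theta> \<in> Z") (simp_all add: Z_def)
      qed
      also have "\<dots> \<le> K0" by (rule K0(2)[OF q])
      finally show ?thesis using q by (simp add: powr_minus field_simps)
    qed
    have ev: "\<forall>\<^sub>F x::real in at_right 0. 0 \<le> x"
      unfolding eventually_at_right_field by (rule exI[of _ 1]) auto
    have "((\<lambda>q. K0 * q powr \<gamma>) \<longlongrightarrow> K0 * 0) (at_right 0)"
      using \<gamma>_bounds by (intro tendsto_mult tendsto_const tendsto_zero_powrI[where b = \<gamma>])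
        (auto intro!: tendsto_ident_at ev)
    then have "((\<lambda>q. K0 * q powr \<gamma>) \<longlongrightarrow> 0) (at_right 0)" by simp
    moreover have "\<forall>\<^sub>F q in at_right 0. measure (torus m) Z \<le> K0 * q powr \<gamma>"
      unfolding eventually_at_right_field by (rule exI[of _ 1]) (use b in auto)
    ultimately have "measure (torus m) Z \<le> 0" by (rule tendsto_lowerbound) simp
    then have "emeasure (torus m) Z = 0" by (simp add: emeasure_eq_measure measure_le_0_iff)
    then show ?thesis using Z by (intro AE_I[of _ _ Z]) (auto simp: Z_def)
  qed
  have main: "integrable (torus m) (\<lambda>\<theta>. ln (4 * sq \<theta>)) \<and> \<bar>logint q - (\<integral>\<theta>. ln (4 * sq \<theta>) \<partial>torus m)\<bar> \<le> K * q powr \<gamma>"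
    if q: "q > 0" for q
  proof -
    \<comment> \<open>As \<open>qs\<close> decreases to 0 the differences \<open>g i\<close>
      increase, with integrals bounded by \<open>ld\<close>. Their limit is \<open>u\<close> almost
      everywhere; on the null set the convention \<open>ln 0 = 0\<close> breaks the
      convergence.\<close>
    define qs where "qs i = q / real (Suc i)" for i
    have qs: "0 < qs i" "qs i \<le> q" for i using q by (simp_all add: qs_def divide_le_eq mult_le_cancel_left1)
    have qsm: "qs j \<le> qs i" if "i \<le> j" for i j using q that by (simp add: qs_def divide_left_mono)
    define g where "g i \<theta> = ln (4 * sq \<theta> + q) - ln (4 * sq \<theta> + qs i)" for i \<theta>
    define u where "u \<theta> = ln (4 * sq \<theta> + q) - ln (4 * sq \<theta>)" for \<theta>
    have gi: "integrable (torus m) (g i)" for i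
      unfolding g_def using integrable_log_sq[OF q] integrable_log_sq[OF qs(1)] by simp
    have gint: "(\<integral>\<theta>. g i \<theta> \<partial>torus m) = logint q - logint (qs i)" for i
      unfolding g_def logint_def using integrable_log_sq[OF q] integrable_log_sq[OF qs(1)] by simp
    have gmono: "mono (\<lambda>i. g i \<theta>)" for \<theta>
    proof (rule monoI)
      fix i j :: nat assume "i \<le> j"
      then have "ln (4 * sq \<theta> + qs j) \<le> ln (4 * sq \<theta> + qs i)"
        using qs[of j] qs[of i] qsm sq_bounds[of \<theta>] by (subst ln_le_cancel_iff) (auto intro: add_nonneg_pos)
      then show "g i \<theta> \<le> g j \<theta>" by (simp add: g_def)
    qed
    have lim0: "qs \<longlonglongrightarrow> 0"
      unfolding qs_def[abs_def] using LIMSEQ_Suc[OF lim_const_over_n[of q]] by simp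
    have glim: "AE \<theta> in torus m. (\<lambda>i. g i \<theta>) \<longlonglongrightarrow> u \<theta>"
      using AE0
    proof eventually_elim
      case (elim \<theta>)
      have "(\<lambda>i. 4 * sq \<theta> + qs i) \<longlonglongrightarrow> 4 * sq \<theta> + 0" by (intro tendsto_intros lim0)
      then show ?case unfolding g_def u_def using elim by (auto intro!: tendsto_intros)
    qed
    have inc: "incseq (\<lambda>i. \<integral>\<theta>. g i \<theta> \<partial>torus m)"
      unfolding incseq_def by (intro allI impI integral_mono gi) (use gmono in \<open>auto simp: mono_def\<close>)
    have bd: "(\<integral>\<theta>. g i \<theta> \<partial>torus m) \<le> K * q powr \<gamma>" for i
      unfolding gint using ld[OF qs, of i] by simp
    obtain L where L: "(\<lambda>i. \<integral>\<theta>. g i \<theta> \<partial>torus m) \<longlonglongrightarrow> L" "\<And>i. (\<integral>\<theta>. g i \<theta> \<partial>torus m) \<le> L"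
      using incseq_convergent[OF inc] bd by blast
    have um: "u \<in> borel_measurable (torus m)" unfolding u_def[abs_def] by measurable
    have I: "integrable (torus m) u" "integral\<^sup>L (torus m) u = L"
      using integrable_monotone_convergence[OF gi _ glim L(1) um] integral_monotone_convergence[OF gi _ glim L(1) um] gmono by auto
    have "L \<le> K * q powr \<gamma>" by (rule LIMSEQ_le_const2[OF L(1)]) (use bd in auto)
    moreover have "0 \<le> L"
    proof -
      have "0 \<le> (\<integral>\<theta>. g 0 \<theta> \<partial>torus m)" unfolding gint using ld[OF qs, of 0] by simp
      with L(2)[of 0] show ?thesis by simp
    qed
    moreover have "integrable (torus m) (\<lambda>\<theta>. ln (4 * sq \<theta> + q) - u \<theta>)" using integrable_log_sq[OF q] I by simp
    then have i4: "integrable (torus m) (\<lambda>\<theta>. ln (4 * sq \<theta>))" by (simp add: u_def)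
    moreover have "L = logint q - (\<integral>\<theta>. ln (4 * sq \<theta>) \<partial>torus m)"
      unfolding I(2)[symmetric] u_def logint_def using integrable_log_sq[OF q] i4 by simp
    ultimately show ?thesis by simp
  qed
  show ?thesis
    using KK(1) AE0 main pois main[of 1] by (intro exI[of _ K]) auto
qed

end

section \<open>Averages over an orbit of \<open>p\<close>-torsion points\<close>

text \<open>With \<open>u\<close> the coordinates of \<open>a\<close> in the basis, these are the
  multiples of the torsion point \<open>u / p\<close>. They are not reduced modulo 1, because
  characters with integer exponents are periodic.\<close>

definition orb :: "nat \<Rightarrow> (nat \<Rightarrow> int) \<Rightarrow> nat \<Rightarrow> nat \<Rightarrow> real" where
  "orb p u t = (\<lambda>i. real t * of_int (u i) / real p)"

text \<open>The bridge to arithmetic: at orbit points a Laurent polynomial in several variables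
  becomes a polynomial in a \<open>p\<close>-th root of unity, with exponents reduced to
  residues.\<close>

lemma echar_orb:
  assumes "p > 0"
  shows "echar m x (orb p u t) = (cis (2 * pi / real p) ^ t) ^ nat (ipr m x u mod int p)"
proof -
  define e where "e = nat (ipr m x u mod int p)"
  define l where "l = ipr m x u div int p"
  have "ipr m x u mod int p \<ge> 0" using assms by simp
  then have ip: "ipr m x u = int e + int p * l" by (simp add: e_def l_def)
  have "echar m x (orb p u t) = cis (2 * pi * (real t * of_int (ipr m x u) / real p))"
    by (simp add: echar_def orb_def ipr_def sum_distrib_left sum_divide_distrib mult_ac)
  also have "real t * of_int (ipr m x u) / real p = real t * real e / real p + of_int (int t * l)"
    using assms by (simp add: ip field_simps)
  also have "cis (2 * pi * (real t * real e / real p + of_int (int t * l)))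
     = cis (2 * pi * (real t * real e / real p)) * cis (2 * pi * of_int (int t * l))"
    by (simp only: distrib_left cis_mult)
  also have "cis (2 * pi * of_int (int t * l)) = 1" by (rule cis_multiple_2pi[OF Ints_of_int])
  also have "cis (2 * pi * (real t * real e / real p)) = (cis (2 * pi / real p) ^ t) ^ e"
    by (simp add: Complex.DeMoivre mult_ac)
  finally show ?thesis by (simp add: e_def)
qed

context character_sum
begin

lemma csum_orb_0: "csum (orb p u 0) = of_nat CARD('j)"
  by (simp add: csum_def orb_def echar_def)

lemma orbit_mean_approx:
  assumes p: "p > 0" and T: "trig_poly m D T" and F: "integrable (torus m) F"
    and FT: "\<And>\<theta>. \<bar>F \<theta> - T \<theta>\<bar> \<le> e"
    and no: "\<And>y. \<exists>i<m. y i \<noteq> 0 \<Longrightarrow> (\<And>i. i < m \<Longrightarrow> \<bar>y i\<bar> \<le> D) \<Longrightarrow> \<not> int p dvd ipr m y u"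
  shows "\<bar>(\<Sum>t<p. F (orb p u t)) - real p * (\<integral>\<theta>. F \<theta> \<partial>torus m)\<bar> \<le> 2 * real p * e"
proof -
  interpret finite_measure "torus m" by (rule finite_measure_torus)
  have one: "measure (torus m) (space (torus m)) = 1" by (simp add: measure_def emeasure_torus)
  have iT: "integrable (torus m) T" by (rule trig_poly_integrable[OF T])
  have eq: "(\<Sum>t<p. T (orb p u t)) = real p * (\<integral>\<theta>. T \<theta> \<partial>torus m)"
    unfolding orb_def by (rule trig_poly_orbit_mean[OF T p]) (use no in \<open>auto simp: box_def abs_le_iff minus_le_iff\<close>)
  have "\<bar>(\<Sum>t<p. F (orb p u t)) - (\<Sum>t<p. T (orb p u t))\<bar> \<le> (\<Sum>t<p. \<bar>F (orb p u t) - T (orb p u t)\<bar>)"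
    by (simp add: sum_subtractf[symmetric] sum_abs)
  also have "\<dots> \<le> (\<Sum>t<p. e)" by (intro sum_mono FT)
  finally have 1: "\<bar>(\<Sum>t<p. F (orb p u t)) - (\<Sum>t<p. T (orb p u t))\<bar> \<le> real p * e" by simp
  have "\<bar>(\<integral>\<theta>. F \<theta> \<partial>torus m) - (\<integral>\<theta>. T \<theta> \<partial>torus m)\<bar> = \<bar>\<integral>\<theta>. F \<theta> - T \<theta> \<partial>torus m\<bar>" using F iT by simp
  also have "\<dots> \<le> (\<integral>\<theta>. \<bar>F \<theta> - T \<theta>\<bar> \<partial>torus m)" by (rule integral_abs_bound)
  also have "\<dots> \<le> (\<integral>\<theta>. e \<partial>torus m)" using F iT FT by (intro integral_mono) auto
  also have "\<dots> = e" using one by simp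
  finally have "real p * \<bar>(\<integral>\<theta>. F \<theta> \<partial>torus m) - (\<integral>\<theta>. T \<theta> \<partial>torus m)\<bar> \<le> real p * e" by (intro mult_left_mono) auto
  then have 2: "\<bar>real p * (\<integral>\<theta>. F \<theta> \<partial>torus m) - real p * (\<integral>\<theta>. T \<theta> \<partial>torus m)\<bar> \<le> real p * e"
    by (simp add: right_diff_distrib[symmetric] abs_mult)
  from 1 2 show ?thesis unfolding eq by linarith
qed

lemma trig_poly_cheb:
  "trig_poly m (int K * (2 * amax)) (\<lambda>\<theta>. \<Sum>n<K. c n * cos (real n * arccos (1 - 2 * sq \<theta>)))"
proof (rule trig_poly_sum)
  fix n assume n: "n \<in> {..<K}"
  have y: "trig_poly m (2 * amax) (\<lambda>\<theta>. 1 - 2 * sq \<theta>)"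
    using trig_poly_add[OF trig_poly_const[of "2 * amax" m 1] trig_poly_scale[OF trig_poly_sq, of "-2"]] amax1 by simp
  have b: "\<bar>1 - 2 * sq \<theta>\<bar> \<le> 1" for \<theta> using sq_bounds[of \<theta>] by linarith
  have "trig_poly m (int n * (2 * amax)) (\<lambda>\<theta>. cos (real n * arccos (1 - 2 * sq \<theta>)))"
    by (rule trig_poly_cos_arccos[OF y _ b]) (use amax1 in simp)
  then have "trig_poly m (int K * (2 * amax)) (\<lambda>\<theta>. cos (real n * arccos (1 - 2 * sq \<theta>)))"
    by (rule trig_poly_mono) (use n amax1 in \<open>auto intro!: mult_right_mono\<close>)
  then show "trig_poly m (int K * (2 * amax)) (\<lambda>\<theta>. c n * cos (real n * arccos (1 - 2 * sq \<theta>)))"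
    by (rule trig_poly_scale)
qed (use amax1 in auto)

text \<open>For \<open>r = 1 - \<delta>\<close> and \<open>y = 1 - 2 * sq \<theta>\<close>, the
  expression \<open>1 - 2 r y + r^2\<close> equals \<open>r * (4 * sq \<theta> + q)\<close>
  precisely for this \<open>q\<close>. Both functions then have Chebyshev expansions with ratio
  \<open>r\<close>, whose first \<open>K\<close> terms average exactly over the orbit.\<close>

lemma orbit_mean_log_poisson:
  assumes p: "p > 0" and \<delta>: "0 < \<delta>" "\<delta> < 1"
    and no: "\<And>y. \<exists>i<m. y i \<noteq> 0 \<Longrightarrow> (\<And>i. i < m \<Longrightarrow> \<bar>y i\<bar> \<le> int K * (2 * amax)) \<Longrightarrow> \<not> int p dvd ipr m y u"
  defines "q \<equiv> \<delta>\<^sup>2 / (1 - \<delta>)"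
  shows "\<bar>(\<Sum>t<p. ln (4 * sq (orb p u t) + q)) - real p * logint q\<bar> \<le> 4 * real p * ((1 - \<delta>) ^ K / \<delta>)"
    and "\<bar>(\<Sum>t<p. q / (q + 4 * sq (orb p u t))) - real p * (\<integral>\<theta>. q / (q + 4 * sq \<theta>) \<partial>torus m)\<bar> \<le> 4 * real p * ((1 - \<delta>) ^ K / \<delta>)"
proof -
  interpret finite_measure "torus m" by (rule finite_measure_torus)
  have one: "measure (torus m) (space (torus m)) = 1" by (simp add: measure_def emeasure_torus)
  define r where "r = 1 - \<delta>"
  have r: "0 < r" "r < 1" using \<delta> by (simp_all add: r_def)
  have q: "q > 0" using \<delta> by (simp add: q_def)
  have b: "\<bar>1 - 2 * sq \<theta>\<bar> \<le> 1" for \<theta> using sq_bounds[of \<theta>] by linarith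
  have den: "1 - 2 * r * (1 - 2 * sq \<theta>) + r\<^sup>2 = r * (4 * sq \<theta> + q)" for \<theta>
  proof -
    have "r * q = \<delta>\<^sup>2" using \<delta> by (simp add: q_def r_def)
    moreover have "1 - 2 * r * (1 - 2 * sq \<theta>) + r\<^sup>2 = r * (4 * sq \<theta>) + (1 - r)\<^sup>2"
      by (simp add: power2_eq_square algebra_simps)
    ultimately show ?thesis by (simp add: r_def distrib_left)
  qed
  have pos: "4 * sq \<theta> + q > 0" for \<theta> using q sq_bounds[of \<theta>] by simp
  let ?T1 = "\<lambda>\<theta>. (\<Sum>n<K. - 2 * r ^ n / real n * cos (real n * arccos (1 - 2 * sq \<theta>)))"
  let ?F1 = "\<lambda>\<theta>. ln r + ln (4 * sq \<theta> + q)"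
  have "\<bar>(\<Sum>t<p. ?F1 (orb p u t)) - real p * (\<integral>\<theta>. ?F1 \<theta> \<partial>torus m)\<bar> \<le> 2 * real p * (2 * r ^ K / (1 - r))"
  proof (rule orbit_mean_approx[OF p trig_poly_cheb])
    show "integrable (torus m) ?F1" using integrable_log_sq[OF q] by simp
    show "\<bar>?F1 \<theta> - ?T1 \<theta>\<bar> \<le> 2 * r ^ K / (1 - r)" for \<theta>
      using log_chebyshev_expansion[OF r b, of \<theta> K] pos[of \<theta>] r unfolding den by (simp add: ln_mult)
  qed (rule no)
  moreover have "(\<integral>\<theta>. ?F1 \<theta> \<partial>torus m) = ln r + logint q"
    using integrable_log_sq[OF q] one by (simp add: logint_def)
  ultimately show "\<bar>(\<Sum>t<p. ln (4 * sq (orb p u t) + q)) - real p * logint q\<bar> \<le> 4 * real p * ((1 - \<delta>) ^ K / \<delta>)"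
    by (simp add: sum.distrib algebra_simps r_def)
  let ?T2 = "\<lambda>\<theta>. 2 * (\<Sum>n<K. r ^ n * cos (real n * arccos (1 - 2 * sq \<theta>))) + (- 1)"
  let ?F2 = "\<lambda>\<theta>. (1 - r\<^sup>2) / (r * (4 * sq \<theta> + q))"
  \<comment> \<open>\<open>c\<close> turns the Poisson kernel, which is normalised by
    \<open>1 - r^2\<close>, into \<open>q / (q + 4 * sq \<theta>)\<close>.\<close>
  define c where "c = \<delta> / (2 - \<delta>)"
  have c: "0 \<le> c" "c \<le> 1" using \<delta> by (simp_all add: c_def)
  have F2: "c * ?F2 \<theta> = q / (q + 4 * sq \<theta>)" for \<theta>
  proof -
    have "1 - r\<^sup>2 = \<delta> * (2 - \<delta>)" by (simp add: r_def power2_eq_square algebra_simps)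
    then have "c * (1 - r\<^sup>2) = r * q" using \<delta> by (simp add: c_def q_def r_def power2_eq_square)
    then show ?thesis using r pos[of \<theta>] by (simp add: add.commute)
  qed
  have i2: "integrable (torus m) ?F2"
    by (rule integrable_continuous_sq[of "\<lambda>s. (1 - r\<^sup>2) / (r * (4 * s + q))"])
       (use q r in \<open>auto intro!: continuous_intros simp: add_nonneg_eq_0_iff\<close>)
  have t2: "trig_poly m (int K * (2 * amax)) ?T2"
    by (intro trig_poly_add trig_poly_scale trig_poly_cheb trig_poly_const) (use amax1 in auto)
  have m2: "\<bar>(\<Sum>t<p. ?F2 (orb p u t)) - real p * (\<integral>\<theta>. ?F2 \<theta> \<partial>torus m)\<bar> \<le> 2 * real p * (2 * r ^ K / (1 - r))"
  proof (rule orbit_mean_approx[OF p t2 i2])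
    show "\<bar>?F2 \<theta> - ?T2 \<theta>\<bar> \<le> 2 * r ^ K / (1 - r)" for \<theta>
      using poisson_chebyshev_expansion[OF r b, of \<theta> K] unfolding den by simp
  qed (rule no)
  have "\<bar>(\<Sum>t<p. q / (q + 4 * sq (orb p u t))) - real p * (\<integral>\<theta>. q / (q + 4 * sq \<theta>) \<partial>torus m)\<bar>
     = c * \<bar>(\<Sum>t<p. ?F2 (orb p u t)) - real p * (\<integral>\<theta>. ?F2 \<theta> \<partial>torus m)\<bar>"
  proof -
    have "(\<Sum>t<p. q / (q + 4 * sq (orb p u t))) - real p * (\<integral>\<theta>. q / (q + 4 * sq \<theta>) \<partial>torus m)
      = c * ((\<Sum>t<p. ?F2 (orb p u t)) - real p * (\<integral>\<theta>. ?F2 \<theta> \<partial>torus m))"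
      unfolding F2[symmetric] right_diff_distrib sum_distrib_left integral_mult_right_zero by simp
    then show ?thesis using c by (simp add: abs_mult)
  qed
  also have "\<dots> \<le> 1 * (2 * real p * (2 * r ^ K / (1 - r)))" by (rule mult_mono[OF c(2) m2]) auto
  finally show "\<bar>(\<Sum>t<p. q / (q + 4 * sq (orb p u t))) - real p * (\<integral>\<theta>. q / (q + 4 * sq \<theta>) \<partial>torus m)\<bar> \<le> 4 * real p * ((1 - \<delta>) ^ K / \<delta>)"
    by (simp add: r_def)
qed

text \<open>
  Where \<open>P\<close> is small, so is the auxiliary polynomial \<open>R\<close>, of the order of \<open>|P|\<^sup>k\<close>; since the norm of
  its value is at least \<open>1\<close>, the values of \<open>P\<close> cannot be too small too often.
\<close>

lemma defect_bound:
  "\<exists>c\<ge>0. \<exists>k0. \<forall>k\<ge>k0. \<forall>p u. prime p \<longrightarrow>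
     (\<forall>y. (\<exists>i<m. y i \<noteq> 0) \<longrightarrow> (\<forall>i<m. \<bar>y i\<bar> \<le> int (2 * k\<^sup>2)) \<longrightarrow> \<not> int p dvd ipr m y u) \<longrightarrow>
     (\<forall>t\<in>{1..<p}. csum (orb p u t) \<noteq> 0) \<and>
     (\<forall>q. 0 < q \<longrightarrow> q \<le> 4 / 5 \<longrightarrow>
        (\<Sum>t\<in>{1..<p}. ln (4 * sq (orb p u t) + q) - ln (4 * sq (orb p u t)))
          \<le> c * real k * (\<Sum>t\<in>{1..<p}. q / (q + 4 * sq (orb p u t))) + c * ((1 + ln (real k)) / real k) * real (p - 1))"
proof -
  from auxiliary_polynomial obtain C :: real and H :: int and k0 where C: "C \<ge> 1" and
    aux: "\<And>k. k \<ge> k0 \<Longrightarrow> \<exists>h::(nat \<Rightarrow> int) \<Rightarrow> int.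
     (\<exists>x\<in>box m 0 (int (k\<^sup>2)). h x \<noteq> 0) \<and> (\<forall>x\<in>box m 0 (int (k\<^sup>2)). \<bar>h x\<bar> \<le> H) \<and>
     (\<forall>\<theta>. cmod (\<Sum>x\<in>box m 0 (int (k\<^sup>2)). of_int (h x) * echar m x \<theta>) \<le> C ^ k\<^sup>2 * cmod (csum \<theta>) ^ k)"
    by blast
  define H' where "H' = max 1 (real_of_int H)"
  define c1 where "c1 = 10 * (ln n1 + ln C) + 2"
  define c2 where "c2 = 2 * ln H' + 4 * real m"
  have n10: "n1 > 0" "ln n1 \<ge> 0" using n1_ge1 by auto
  have lnC: "ln C \<ge> 0" using C by simp
  have c1: "c1 \<ge> 2" using n10 lnC by (simp add: c1_def)
  have c2: "c2 \<ge> 0" by (simp add: c2_def H'_def)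
  define c where "c = c1 + c2"
  have main: "(\<forall>t\<in>{1..<p}. csum (orb p u t) \<noteq> 0) \<and>
     (\<forall>q. 0 < q \<longrightarrow> q \<le> 4 / 5 \<longrightarrow>
        (\<Sum>t\<in>{1..<p}. ln (4 * sq (orb p u t) + q) - ln (4 * sq (orb p u t)))
          \<le> c * real k * (\<Sum>t\<in>{1..<p}. q / (q + 4 * sq (orb p u t))) + c * ((1 + ln (real k)) / real k) * real (p - 1))"
    if k: "k \<ge> k0 + 1" and p: "prime p"
      and no: "\<And>y. \<exists>i<m. y i \<noteq> 0 \<Longrightarrow> (\<And>i. i < m \<Longrightarrow> \<bar>y i\<bar> \<le> int (2 * k\<^sup>2)) \<Longrightarrow> \<not> int p dvd ipr m y u" for k p u
  proof -
    have k1: "k \<ge> 1" and kk0: "k \<ge> k0" using k by simp_all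
    have p0: "p > 0" "p > 1" using p prime_gt_0_nat prime_gt_1_nat by auto
    let ?X = "box m 0 (int (k\<^sup>2))" and ?X2 = "box m 0 (int (2 * k\<^sup>2))"
    from aux[OF kk0] obtain h :: "(nat \<Rightarrow> int) \<Rightarrow> int" where
      h: "\<exists>x\<in>?X. h x \<noteq> 0" "\<And>x. x \<in> ?X \<Longrightarrow> \<bar>h x\<bar> \<le> H"
         "\<And>\<theta>. cmod (\<Sum>x\<in>?X. of_int (h x) * echar m x \<theta>) \<le> C ^ k\<^sup>2 * cmod (csum \<theta>) ^ k" by blast
    define e where "e x = nat (ipr m x u mod int p)" for x
    \<comment> \<open>Injectivity on the box of twice the side shows that there are more residues
      than exponents in the small box. The exponents of \<open>R\<close> therefore miss a residue,
      as \<open>sparse_root_of_unity_sum\<close> demands.\<close>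
    have inj2: "inj_on e ?X2"
    proof (rule inj_onI, rule ccontr)
      fix x y assume xy: "x \<in> ?X2" "y \<in> ?X2" "e x = e y" "x \<noteq> y"
      have "ipr m x u mod int p = ipr m y u mod int p"
        using xy(3) p0 by (simp add: e_def nat_eq_iff)
      then have "int p dvd ipr m x u - ipr m y u" by (rule mod_eq_dvd_iff[THEN iffD1])
      then have "int p dvd ipr m (\<lambda>i. x i - y i) u"
        by (simp add: ipr_def left_diff_distrib sum_subtractf)
      moreover have "\<exists>i<m. x i - y i \<noteq> 0"
      proof (rule ccontr)
        assume "\<not> ?thesis"
        then have "x i = y i" for i using xy(1,2) by (cases "i < m") (auto simp: box_def)
        with xy(4) show False by auto
      qed
      moreover have "\<bar>x i - y i\<bar> \<le> int (2 * k\<^sup>2)" if "i < m" for i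
      proof -
        have "0 \<le> x i" "x i \<le> int (2 * k\<^sup>2)" "0 \<le> y i" "y i \<le> int (2 * k\<^sup>2)"
          using xy(1,2) that by (auto simp: box_def)
        then show ?thesis by linarith
      qed
      ultimately show False using no[of "\<lambda>i. x i - y i"] by blast
    qed
    have sub: "?X \<subseteq> ?X2" by (auto simp: box_def)
    have fX: "finite ?X" "finite ?X2" by (rule finite_card_box)+
    have inj: "inj_on e ?X" using inj_on_subset[OF inj2 sub] .
    have el: "e x < p" for x using p0 by (simp add: e_def nat_less_iff)
    have cX: "card ?X = (k\<^sup>2 + 1) ^ m" "card ?X2 = (2 * k\<^sup>2 + 1) ^ m"
    proof -
      have cb: "card (box m 0 (int N)) = (N + 1) ^ m" for N
        by (simp add: finite_card_box nat_add_distrib)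
      show "card ?X = (k\<^sup>2 + 1) ^ m" "card ?X2 = (2 * k\<^sup>2 + 1) ^ m" by (rule cb)+
    qed
    have "card ?X < card ?X2" unfolding cX using k1 m_ge_2 by (intro power_strict_mono) auto
    also have "\<dots> = card (e ` ?X2)" using card_image[OF inj2] by simp
    also have "\<dots> \<le> card {..<p}" by (rule card_mono) (use el in auto)
    finally have "card (e ` ?X) < card {..<p}" using card_image[OF inj] by simp
    then have sub': "e ` ?X \<subset> {..<p}" using el by (metis image_subsetI lessThan_iff psubsetI order_less_irrefl)
    define R where "R t = (\<Sum>x\<in>?X. of_int (h x) * (cis (2 * pi / real p) ^ t) ^ e x)" for t
    have R: "R t = (\<Sum>x\<in>?X. of_int (h x) * echar m x (orb p u t))" for t
      by (simp only: R_def echar_orb[OF p0(1)] e_def)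
    have Rnz: "\<And>t. t \<in> {1..<p} \<Longrightarrow> R t \<noteq> 0" and Rprod: "(\<Prod>t\<in>{1..<p}. cmod (R t)) \<ge> 1"
      using sparse_root_of_unity_sum[OF p fX(1) inj sub' h(1)] unfolding R_def by blast+
    have RC: "cmod (R t) \<le> C ^ k\<^sup>2 * cmod (csum (orb p u t)) ^ k" for t
      unfolding R by (rule h(3))
    define B where "B = H' * real ((k\<^sup>2 + 1) ^ m)"
    have B1: "B \<ge> 1"
    proof -
      have "1 * 1 \<le> H' * real ((k\<^sup>2 + 1) ^ m)"
        by (rule mult_mono) (auto simp: H'_def intro!: one_le_power)
      then show ?thesis by (simp add: B_def)
    qed
    have RB: "cmod (R t) \<le> B" for t
    proof -
      have "cmod (R t) \<le> (\<Sum>x\<in>?X. H')" unfolding R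
      proof (rule order_trans[OF norm_sum], rule sum_mono)
        fix x assume "x \<in> ?X"
        from h(2)[OF this] have "\<bar>real_of_int (h x)\<bar> \<le> real_of_int H" by linarith
        then show "cmod (of_int (h x) * echar m x (orb p u t)) \<le> H'"
          by (simp add: norm_mult H'_def)
      qed
      also have "\<dots> = B" unfolding sum_constant cX B_def by simp
      finally show ?thesis .
    qed
    have cnz: "csum (orb p u t) \<noteq> 0" if "t \<in> {1..<p}" for t
      using RC[of t] Rnz[OF that] k1 by (auto simp: power_0_left)
    have lnR0: "(\<Sum>t\<in>{1..<p}. ln (cmod (R t))) \<ge> 0"
    proof -
      have "(\<Sum>t\<in>{1..<p}. ln (cmod (R t))) = ln (\<Prod>t\<in>{1..<p}. cmod (R t))"
        by (rule ln_prod[symmetric]) (use Rnz in auto)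
      then show ?thesis using Rprod by simp
    qed
    have lnB: "2 * ln B \<le> c2 * (1 + ln (real k))"
    proof -
      have "(1::real)\<^sup>2 \<le> (real k)\<^sup>2" using k1 by (intro power_mono) auto
      then have "real (k\<^sup>2 + 1) \<le> (2 * real k)\<^sup>2" by (simp add: power_mult_distrib)
      then have "ln (real (k\<^sup>2 + 1)) \<le> ln ((2 * real k)\<^sup>2)" using k1 by (intro ln_mono) auto
      also have "\<dots> = 2 * ln (2 * real k)" using k1 by (subst ln_realpow) auto
      also have "\<dots> = 2 * (ln 2 + ln (real k))" using k1 by (subst ln_mult) auto
      also have "\<dots> \<le> 2 * (1 + ln (real k))" using ln_2_less_1 by simp
      finally have l: "ln (real (k\<^sup>2 + 1)) \<le> 2 * (1 + ln (real k))" .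
      have "ln B = ln H' + real m * ln (real (k\<^sup>2 + 1))"
      proof -
        have kp: "real (k\<^sup>2 + 1) > 0" by (simp only: of_nat_0_less_iff)
        have "H' > 0" by (simp add: H'_def)
        then have "ln B = ln H' + ln (real (k\<^sup>2 + 1) ^ m)"
          unfolding B_def of_nat_power by (rule ln_mult_pos[OF _ zero_less_power[OF kp]])
        then show ?thesis by (simp only: ln_realpow)
      qed
      also have "\<dots> \<le> ln H' * (1 + ln (real k)) + real m * (2 * (1 + ln (real k)))"
      proof (rule add_mono)
        have "0 \<le> ln H' * ln (real k)" using k1 by (simp add: H'_def)
        then show "ln H' \<le> ln H' * (1 + ln (real k))" by (simp add: distrib_left)
        show "real m * ln (real (k\<^sup>2 + 1)) \<le> real m * (2 * (1 + ln (real k)))" by (rule mult_left_mono[OF l]) simp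
      qed
      finally show ?thesis by (simp add: c2_def algebra_simps)
    qed
    have each: "ln (4 * sq (orb p u t) + q) - ln (4 * sq (orb p u t))
        \<le> c1 * real k * (q / (q + 4 * sq (orb p u t))) + 2 / real k * (ln B - ln (cmod (R t)))"
      if t: "t \<in> {1..<p}" and q: "0 < q" "q \<le> 4 / 5" for t q
    proof -
      define s where "s = sq (orb p u t)"
      have s0: "s > 0" using cnz[OF t] sq_bounds(1)[of "orb p u t"] csum_eq_0_iff[of "orb p u t"] by (simp add: s_def)
      have Rp: "cmod (R t) > 0" using Rnz[OF t] by simp
      \<comment> \<open>This term is non-negative and may be added at every point, good or bad. Only
        its sum over the full orbit can profit from the norm being at least 1.\<close>
      have rest: "0 \<le> 2 / real k * (ln B - ln (cmod (R t)))"
      proof (rule mult_nonneg_nonneg)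
        have "ln (cmod (R t)) \<le> ln B" using RB[of t] Rp B1 by (subst ln_le_cancel_iff) auto
        then show "0 \<le> ln B - ln (cmod (R t))" by simp
      qed simp
      have \<psi>0: "q / (q + 4 * s) > 0" using q s0 by simp
      have c1k: "2 \<le> c1 * real k"
      proof -
        have "2 * 1 \<le> c1 * real k" using c1 k1 by (intro mult_mono) auto
        then show ?thesis by simp
      qed
      have d: "ln (4 * s + q) - ln (4 * s) = ln (1 + q / (4 * s))"
      proof -
        have "ln (4 * s + q) - ln (4 * s) = ln ((4 * s + q) / (4 * s))" using s0 q by (subst ln_div) auto
        also have "(4 * s + q) / (4 * s) = 1 + q / (4 * s)" using s0 by (simp add: add_divide_distrib)
        finally show ?thesis .
      qed
      \<comment> \<open>For \<open>q \<le> s\<close> smoothing changes the logarithm by at most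
        twice the Poisson term. For \<open>s < q\<close> the Poisson term is at least
        \<open>1 / 5\<close>, so a loss of order \<open>k\<close> from the inequality for
        \<open>R\<close> can be charged to it.\<close>
      show ?thesis
      proof (cases "q \<le> s")
        case True
        have "ln (1 + q / (4 * s)) \<le> q / (4 * s)" using s0 q by (intro ln_add_one_self_le_self) auto
        also have "\<dots> \<le> 2 * (q / (q + 4 * s))" using True s0 q by (simp add: field_simps)
        also have "\<dots> \<le> c1 * real k * (q / (q + 4 * s))" using c1k \<psi>0 by (intro mult_right_mono) auto
        finally show ?thesis using rest d unfolding s_def[symmetric] by linarith
      next
        case False
        have \<psi>1: "1 \<le> 5 * (q / (q + 4 * s))" using False s0 q by (simp add: field_simps)
        have P0: "cmod (csum (orb p u t)) > 0" using cnz[OF t] by simp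
        have "1 + q / (4 * s) \<le> 1 / s"
        proof -
          \<comment> \<open>Here \<open>4 * s + q < 5 * q\<close>, which is where the limit
            \<open>4 / 5\<close> for \<open>q\<close> comes from.\<close>
          have "4 * s + q \<le> 4" using False q by linarith
          then have "(4 * s + q) / (4 * s) \<le> 4 / (4 * s)" using s0 by (intro divide_right_mono) auto
          then show ?thesis using s0 by (simp add: add_divide_distrib)
        qed
        moreover have "0 < 1 + q / (4 * s)" using s0 q by (intro add_pos_pos) auto
        ultimately have "ln (1 + q / (4 * s)) \<le> ln (1 / s)" by (intro ln_mono) auto
        also have "ln (1 / s) = 2 * ln n1 - 2 * ln (cmod (csum (orb p u t)))"
          using s0 P0 n10 unfolding s_def sq_def by (simp add: ln_div ln_realpow)
        also have "\<dots> \<le> 2 * ln n1 + 2 / real k * (real k * real k * ln C - ln (cmod (R t)))"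
        proof -
          have "ln (cmod (R t)) \<le> ln (C ^ k\<^sup>2 * cmod (csum (orb p u t)) ^ k)"
            by (rule ln_mono[OF RC Rp])
          also have "\<dots> = real (k\<^sup>2) * ln C + real k * ln (cmod (csum (orb p u t)))"
            using C P0 by (simp add: ln_mult ln_realpow del: of_nat_power)
          finally have "- real k * ln (cmod (csum (orb p u t))) \<le> real k * real k * ln C - ln (cmod (R t))"
            by (simp add: power2_eq_square)
          then have "2 / real k * (- real k * ln (cmod (csum (orb p u t)))) \<le> 2 / real k * (real k * real k * ln C - ln (cmod (R t)))"
            by (rule mult_left_mono) simp
          then show ?thesis using k1 by simp
        qed
        also have "\<dots> = (2 * ln n1 + 2 * real k * ln C) - 2 / real k * ln (cmod (R t))"
          using k1 by (simp add: right_diff_distrib)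
        also have "\<dots> \<le> c1 * real k * (q / (q + 4 * s)) + 2 / real k * (ln B - ln (cmod (R t)))"
        proof -
          have "2 * ln n1 + 2 * real k * ln C \<le> 2 * real k * ln n1 + 2 * real k * ln C"
            using k1 n10 by (simp add: mult_le_cancel_right1)
          also have "\<dots> = (2 * (ln n1 + ln C) * real k) * 1" by (simp add: algebra_simps)
          also have "\<dots> \<le> (2 * (ln n1 + ln C) * real k) * (5 * (q / (q + 4 * s)))"
            using n10 lnC by (intro mult_left_mono[OF \<psi>1]) auto
          also have "\<dots> = (10 * (ln n1 + ln C)) * real k * (q / (q + 4 * s))" by simp
          also have "\<dots> \<le> c1 * real k * (q / (q + 4 * s))"
            using \<psi>0 by (intro mult_right_mono) (auto simp: c1_def)
          finally have 1: "2 * ln n1 + 2 * real k * ln C \<le> c1 * real k * (q / (q + 4 * s))" .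
          have "0 \<le> 2 / real k * ln B" using B1 by simp
          with 1 show ?thesis by (simp only: right_diff_distrib)
        qed
        finally show ?thesis unfolding d[unfolded s_def] s_def .
      qed
    qed
    have "(\<Sum>t\<in>{1..<p}. ln (4 * sq (orb p u t) + q) - ln (4 * sq (orb p u t)))
          \<le> c * real k * (\<Sum>t\<in>{1..<p}. q / (q + 4 * sq (orb p u t))) + c * ((1 + ln (real k)) / real k) * real (p - 1)"
      if q: "0 < q" "q \<le> 4 / 5" for q
    proof -
      let ?\<psi> = "\<lambda>t. q / (q + 4 * sq (orb p u t))"
      have \<psi>0: "(\<Sum>t\<in>{1..<p}. ?\<psi> t) \<ge> 0"
        using q sq_bounds by (intro sum_nonneg divide_nonneg_nonneg add_nonneg_nonneg) auto
      have "(\<Sum>t\<in>{1..<p}. ln (4 * sq (orb p u t) + q) - ln (4 * sq (orb p u t)))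
        \<le> (\<Sum>t\<in>{1..<p}. c1 * real k * ?\<psi> t + 2 / real k * (ln B - ln (cmod (R t))))"
        by (intro sum_mono each q)
      also have "\<dots> = c1 * real k * (\<Sum>t\<in>{1..<p}. ?\<psi> t) + 2 / real k * (real (p - 1) * ln B - (\<Sum>t\<in>{1..<p}. ln (cmod (R t))))"
        by (simp only: sum.distrib sum_distrib_left[symmetric] sum_subtractf sum_constant card_atLeastLessThan)
      also have "\<dots> \<le> c1 * real k * (\<Sum>t\<in>{1..<p}. ?\<psi> t) + 2 / real k * (real (p - 1) * ln B)"
        using lnR0 by (intro add_left_mono mult_left_mono) auto
      also have "2 / real k * (real (p - 1) * ln B) = (2 * ln B) / real k * real (p - 1)" by simp
      also have "\<dots> \<le> (c2 * (1 + ln (real k))) / real k * real (p - 1)"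
        by (intro mult_right_mono divide_right_mono lnB) auto
      also have "\<dots> = c2 * ((1 + ln (real k)) / real k * real (p - 1))" by simp
      also have "c1 * real k * (\<Sum>t\<in>{1..<p}. ?\<psi> t) + c2 * ((1 + ln (real k)) / real k * real (p - 1))
        \<le> c * real k * (\<Sum>t\<in>{1..<p}. ?\<psi> t) + c * ((1 + ln (real k)) / real k * real (p - 1))"
        using \<psi>0 c1 c2 k1 by (intro add_mono mult_right_mono mult_nonneg_nonneg divide_nonneg_nonneg) (auto simp: c_def)
      finally show ?thesis by (simp only: mult.assoc)
    qed
    with cnz show ?thesis by blast
  qed
  have "c \<ge> 0" using c1 c2 by (simp add: c_def)
  show ?thesis
  proof (rule exI[of _ c], rule conjI[OF \<open>c \<ge> 0\<close>], rule exI[of _ "k0 + 1"], intro allI impI)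
    fix k p u
    assume k: "k0 + 1 \<le> k" and p: "prime p"
      and no: "\<forall>y. (\<exists>i<m. y i \<noteq> 0) \<longrightarrow> (\<forall>i<m. \<bar>y i\<bar> \<le> int (2 * k\<^sup>2)) \<longrightarrow> \<not> int p dvd ipr m y u"
    show "(\<forall>t\<in>{1..<p}. csum (orb p u t) \<noteq> 0) \<and>
     (\<forall>q. 0 < q \<longrightarrow> q \<le> 4 / 5 \<longrightarrow>
        (\<Sum>t\<in>{1..<p}. ln (4 * sq (orb p u t) + q) - ln (4 * sq (orb p u t)))
          \<le> c * real k * (\<Sum>t\<in>{1..<p}. q / (q + 4 * sq (orb p u t))) + c * ((1 + ln (real k)) / real k) * real (p - 1))"
      by (rule main[OF k p]) (use no in simp)
  qed
qed

end

text \<open>It will be used for \<open>y\<close> of order \<open>\<rho>^(1/4)\<close>; the power 8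
  then yields a decay of order \<open>\<rho>^(-2)\<close>.\<close>

lemma exp_minus_le_power8:
  fixes y :: real assumes "y > 0" shows "exp (- y) \<le> (8 / y) ^ 8"
proof -
  have "(y / 8) ^ 8 \<le> (1 + y / real 8) ^ 8" using assms by (intro power_mono) auto
  also have "\<dots> \<le> exp y" by (rule exp_ge_one_plus_x_over_n_power_n) (use assms in auto)
  finally have "1 / exp y \<le> 1 / (y / 8) ^ 8" using assms by (intro divide_left_mono) auto
  then show ?thesis by (simp add: exp_minus inverse_eq_divide power_divide)
qed

section \<open>Choice of the parameters\<close>

context character_sum
begin

lemma log_csum_integral:
  assumes AE: "AE \<theta> in torus m. sq \<theta> \<noteq> 0" and int: "integrable (torus m) (\<lambda>\<theta>. ln (4 * sq \<theta>))"
  shows "(\<integral>\<theta>. ln (4 * sq \<theta>) \<partial>torus m) = ln 4 - 2 * ln n1 + 2 * (\<integral>\<theta>. ln (cmod (csum \<theta>)) \<partial>torus m)"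
proof -
  interpret finite_measure "torus m" by (rule finite_measure_torus)
  have one: "measure (torus m) (space (torus m)) = 1" by (simp add: measure_def emeasure_torus)
  define b where "b = ln 4 - 2 * ln n1"
  have "(\<integral>\<theta>. ln (cmod (csum \<theta>)) \<partial>torus m) = (\<integral>\<theta>. (ln (4 * sq \<theta>) - b) / 2 \<partial>torus m)"
  proof (rule integral_cong_AE)
    show "AE \<theta> in torus m. ln (cmod (csum \<theta>)) = (ln (4 * sq \<theta>) - b) / 2"
      using AE
    proof eventually_elim
      case (elim \<theta>)
      then have "cmod (csum \<theta>) > 0" using csum_eq_0_iff[of \<theta>] by simp
      then show ?case using n1_ge1 by (simp add: sq_def b_def ln_mult ln_div ln_realpow)
    qed
  qed measurable
  also have "\<dots> = ((\<integral>\<theta>. ln (4 * sq \<theta>) \<partial>torus m) - b) / 2"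
    using int one by simp
  finally show ?thesis by (simp add: b_def)
qed

text \<open>Three errors are balanced: truncation of the Chebyshev expansions,
  \<open>k * q powr \<gamma>\<close> from the defect, and \<open>ln k / k\<close> from the size of
  \<open>R\<close>. With \<open>k\<close> about \<open>X = \<rho>^\<kappa>\<close> the last two are
  of order \<open>1 / X\<close> and \<open>ln X / X\<close>. The target is
  \<open>E = X^(-8/9)\<close>, and this margin absorbs the logarithm.\<close>

theorem orbit_log_mean:
  "\<exists>C R0. \<forall>p u \<rho>. prime p \<longrightarrow> \<rho> \<ge> R0 \<longrightarrow>
     (\<forall>y. (\<exists>i<m. y i \<noteq> 0) \<longrightarrow> (\<forall>i<m. \<bar>real_of_int (y i)\<bar> < \<rho>) \<longrightarrow> \<not> int p dvd ipr m y u) \<longrightarrow>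
     (\<forall>t\<in>{1..<p}. csum (orb p u t) \<noteq> 0) \<and>
     \<bar>1 / (real p - 1) * (\<Sum>t\<in>{1..<p}. ln (cmod (csum (orb p u t)))) - (\<integral>\<theta>. ln (cmod (csum \<theta>)) \<partial>torus m)\<bar>
       \<le> C * \<rho> powr (- (1 / (4 * real nn)))"
proof -
  interpret finite_measure "torus m" by (rule finite_measure_torus)
  have one: "measure (torus m) (space (torus m)) = 1" by (simp add: measure_def emeasure_torus)
  from defect_bound obtain c :: real and k0 where c: "c \<ge> 0" and defect:
    "\<forall>k\<ge>k0. \<forall>p u. prime p \<longrightarrow>
     (\<forall>y. (\<exists>i<m. y i \<noteq> 0) \<longrightarrow> (\<forall>i<m. \<bar>y i\<bar> \<le> int (2 * k\<^sup>2)) \<longrightarrow> \<not> int p dvd ipr m y u) \<longrightarrow>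
     (\<forall>t\<in>{1..<p}. csum (orb p u t) \<noteq> 0) \<and>
     (\<forall>q. 0 < q \<longrightarrow> q \<le> 4 / 5 \<longrightarrow>
        (\<Sum>t\<in>{1..<p}. ln (4 * sq (orb p u t) + q) - ln (4 * sq (orb p u t)))
          \<le> c * real k * (\<Sum>t\<in>{1..<p}. q / (q + 4 * sq (orb p u t))) + c * ((1 + ln (real k)) / real k) * real (p - 1))"
    by (elim exE conjE) (rule that)
  from log_integral_approximation obtain K where K: "K \<ge> 0" and AE: "AE \<theta> in torus m. sq \<theta> \<noteq> 0"
    and iln: "integrable (torus m) (\<lambda>\<theta>. ln (4 * sq \<theta>))"
    and K1: "\<And>q. q > 0 \<Longrightarrow> \<bar>logint q - (\<integral>\<theta>. ln (4 * sq \<theta>) \<partial>torus m)\<bar> \<le> K * q powr \<gamma>"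
    and K2: "\<And>q. q > 0 \<Longrightarrow> (\<integral>\<theta>. q / (q + 4 * sq \<theta>) \<partial>torus m) \<le> K * q powr \<gamma>"
    by blast
  define n where "n = real nn"
  have n: "n \<ge> 2" using nn_ge_2 by (simp add: n_def)
  \<comment> \<open>The solution of \<open>3/2 * \<gamma> = 2 * \<kappa>\<close>: it makes
    \<open>q powr \<gamma>\<close> of order \<open>1 / X^2\<close> and
    \<open>k * q powr \<gamma>\<close> of order \<open>1 / X\<close>. It is also \<open>9/8\<close>
    times the exponent \<open>1 / (4 n)\<close> of the target.\<close>
  define \<kappa> where "\<kappa> = 9 / (32 * n)"
  have \<kappa>: "0 < \<kappa>" "\<kappa> \<le> 9 / 64" using n by (simp_all add: \<kappa>_def field_simps)
  define A where "A = real_of_int amax"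
  have A: "A \<ge> 1" using amax1 by (simp add: A_def)
  define cT where "cT = (64 * A) ^ 8"
  have cT: "cT \<ge> 0" using A by (simp add: cT_def)
  \<comment> \<open>The entry 65 makes the square root of \<open>\<rho>\<close> exceed 8,
    \<open>8 * A\<close> keeps half of \<open>\<rho> / (4 * A)\<close> after rounding down to
    \<open>M\<close>, and the last entry forces \<open>k \<ge> k0\<close>.\<close>
  define R0 where "R0 = max (max 65 (8 * A)) (real k0 powr (1 / \<kappa>))"
  define C where "C = 8 * cT + 22 + 2 * K + c * (8 * K + 16 * cT + 11)"
  have main: "(\<forall>t\<in>{1..<p}. csum (orb p u t) \<noteq> 0) \<and>
     \<bar>1 / (real p - 1) * (\<Sum>t\<in>{1..<p}. ln (cmod (csum (orb p u t)))) - (\<integral>\<theta>. ln (cmod (csum \<theta>)) \<partial>torus m)\<bar>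
       \<le> C * \<rho> powr (- (1 / (4 * real nn)))"
    if p: "prime p" and \<rho>R: "\<rho> \<ge> R0"
      and no: "\<And>y. \<exists>i<m. y i \<noteq> 0 \<Longrightarrow> (\<And>i. i < m \<Longrightarrow> \<bar>real_of_int (y i)\<bar> < \<rho>) \<Longrightarrow> \<not> int p dvd ipr m y u" for p u \<rho>
  proof -
    have \<rho>: "\<rho> \<ge> 65" "\<rho> \<ge> 8 * A" "\<rho> \<ge> real k0 powr (1 / \<kappa>)" using \<rho>R by (simp_all add: R0_def)
    have \<rho>0: "\<rho> > 0" "\<rho> \<ge> 1" using \<rho> by simp_all
    have p1: "p > 1" using p by (rule prime_gt_1_nat)
    have p\<rho>: "real p \<ge> \<rho>"
    proof (rule ccontr)
      assume lt: "\<not> ?thesis"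
      \<comment> \<open>A multiple of \<open>p\<close> in a single coordinate is annihilated modulo
        \<open>p\<close> whatever \<open>u\<close> is, so it cannot be smaller than
        \<open>\<rho>\<close>.\<close>
      define y where "y i = (if i = 0 then int p else 0)" for i :: nat
      have "\<not> int p dvd ipr m y u"
        by (rule no) (use lt m_ge_2 p1 \<rho>0 in \<open>auto simp: y_def intro!: exI[of _ 0]\<close>)
      moreover have "int p dvd ipr m y u"
        unfolding ipr_def by (rule dvd_sum) (simp add: y_def)
      ultimately show False by blast
    qed
    define P1 where "P1 = real p - 1"
    have P1: "P1 > 0" "real p \<le> 2 * P1" "real (p - 1) = P1" using p\<rho> \<rho>(1) p1 by (simp_all add: P1_def of_nat_diff)
    define X where "X = \<rho> powr \<kappa>"
    have X1: "X \<ge> 1" unfolding X_def using \<rho>0 \<kappa> by (intro ge_one_powr_ge_zero) auto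
    define E where "E = \<rho> powr (- (1 / (4 * n)))"
    have E0: "E > 0" using \<rho>0 by (simp add: E_def)
    have EX: "E = X powr (- (8 / 9))" using n by (simp add: E_def X_def powr_powr \<kappa>_def)
    have XE: "1 / X \<le> E"
    proof -
      have "X powr (- 1) \<le> X powr (- (8 / 9))" using X1 by (intro powr_mono) auto
      then show ?thesis using X1 by (simp add: EX powr_minus_divide)
    qed
    have X2: "1 / X\<^sup>2 \<le> 1 / X" using X1 by (simp add: power2_eq_square field_simps)
    have X2\<rho>: "\<rho> powr (- 2 * \<kappa>) = 1 / X\<^sup>2"
    proof -
      have "X\<^sup>2 = \<rho> powr (2 * \<kappa>)" unfolding X_def power2_eq_square by (simp add: powr_add[symmetric])
      then show ?thesis by (simp add: powr_minus_divide)
    qed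
    define w where "w = sqrt \<rho>"
    have w: "w > 0" "w * w = \<rho>" "w = \<rho> powr (1 / 2)" using \<rho>0 by (simp_all add: w_def powr_half_sqrt)
    have w8: "w > 8"
    proof -
      have "sqrt 64 < sqrt \<rho>" using \<rho>(1) by (intro real_sqrt_less_mono) auto
      then show ?thesis by (simp add: w_def)
    qed
    have Xw: "X\<^sup>2 \<le> w"
    proof -
      have "X\<^sup>2 = \<rho> powr (2 * \<kappa>)" unfolding X_def power2_eq_square by (simp add: powr_add[symmetric])
      also have "\<dots> \<le> \<rho> powr (1 / 2)" using \<kappa> \<rho>0 by (intro powr_mono) auto
      finally show ?thesis by (simp add: w)
    qed
    have Xw': "X \<le> w"
    proof -
      have "X * 1 \<le> X * X" using X1 by (intro mult_left_mono) auto
      with Xw show ?thesis by (simp add: power2_eq_square)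
    qed
    have wE: "1 / w \<le> E"
    proof -
      have "1 / w \<le> 1 / X" using Xw' X1 by (intro divide_left_mono) auto
      with XE show ?thesis by linarith
    qed
    \<comment> \<open>The truncation order \<open>M\<close> is proportional to
      \<open>\<rho>\<close>, so \<open>(1 - \<delta>)^M\<close> is exponentially small in
      \<open>\<rho>^(1/4)\<close>, while \<open>q\<close> is of order
      \<open>\<rho>^(-3/2)\<close>.\<close>
    define \<delta> where "\<delta> = \<rho> powr (- (3 / 4))"
    have \<delta>: "0 < \<delta>" "\<delta> \<le> 1 / 8"
    proof -
      show "0 < \<delta>" using \<rho>0 by (simp add: \<delta>_def)
      have "(8::real) \<le> w" using w8 by simp
      also have "w = \<rho> powr (1 / 2)" by (rule w(3))
      also have "\<dots> \<le> \<rho> powr (3 / 4)" using \<rho>0 by (intro powr_mono) auto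
      finally have "1 / \<rho> powr (3 / 4) \<le> 1 / 8" by (intro divide_left_mono) auto
      then show "\<delta> \<le> 1 / 8" by (simp add: \<delta>_def powr_minus_divide)
    qed
    define q where "q = \<delta>\<^sup>2 / (1 - \<delta>)"
    have q: "0 < q" "\<delta>\<^sup>2 \<le> q" "q \<le> 2 * \<delta>\<^sup>2"
    proof -
      show "0 < q" using \<delta> by (simp add: q_def)
      have "\<delta>\<^sup>2 * (1 - \<delta>) \<le> \<delta>\<^sup>2 * 1" using \<delta> by (intro mult_left_mono) auto
      then show "\<delta>\<^sup>2 \<le> q" using \<delta> by (simp add: q_def le_divide_eq)
      have "\<delta>\<^sup>2 * 1 \<le> \<delta>\<^sup>2 * (2 * (1 - \<delta>))" using \<delta> by (intro mult_left_mono) auto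
      then show "q \<le> 2 * \<delta>\<^sup>2" using \<delta> by (simp add: q_def divide_le_eq mult_ac)
    qed
    have \<delta>sq: "\<delta>\<^sup>2 \<le> 1 / 64" using \<delta> power_mono[of \<delta> "1/8" 2] by (simp add: power_divide)
    have q1: "q \<le> 4 / 5" "q \<le> 1" using q(3) \<delta>sq by linarith+
    have q\<gamma>: "q powr \<gamma> \<le> 2 / X\<^sup>2"
    proof -
      have "q powr \<gamma> \<le> (2 * \<delta>\<^sup>2) powr \<gamma>" using q \<gamma>_bounds by (intro powr_mono2) auto
      also have "\<dots> = 2 powr \<gamma> * (\<delta>\<^sup>2) powr \<gamma>" by (simp add: powr_mult)
      also have "(\<delta>\<^sup>2) powr \<gamma> = \<rho> powr (- 2 * \<kappa>)"
      proof -
        have "\<delta>\<^sup>2 = \<rho> powr (- (3 / 2))" unfolding \<delta>_def power2_eq_square by (simp add: powr_add[symmetric])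
        then have "(\<delta>\<^sup>2) powr \<gamma> = \<rho> powr (- (3 / 2) * \<gamma>)" by (simp add: powr_powr)
        also have "- (3 / 2) * \<gamma> = - 2 * \<kappa>" using n by (simp add: \<gamma>_def \<kappa>_def n_def[symmetric] field_simps)
        finally show ?thesis .
      qed
      also have "2 powr \<gamma> * \<rho> powr (- 2 * \<kappa>) \<le> 2 * \<rho> powr (- 2 * \<kappa>)"
      proof (rule mult_right_mono)
        have "2 powr \<gamma> \<le> 2 powr (1::real)" using \<gamma>_bounds by (intro powr_mono) auto
        then show "2 powr \<gamma> \<le> (2::real)" by simp
      qed simp
      finally have "q powr \<gamma> \<le> 2 * \<rho> powr (- 2 * \<kappa>)" .
      then show ?thesis unfolding X2\<rho> by simp
    qed
    define k where "k = nat \<lceil>X\<rceil>"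
    have k: "X \<le> real k" "real k \<le> 2 * X" "k \<ge> 1"
      using X1 by (simp_all add: k_def) linarith+
    have kk0: "k \<ge> k0"
    proof (cases "k0 = 0")
      case False
      have "real k0 = (real k0 powr (1 / \<kappa>)) powr \<kappa>" using False \<kappa> by (simp add: powr_powr)
      also have "\<dots> \<le> X" unfolding X_def using \<rho>(3) \<kappa> by (intro powr_mono2) auto
      also have "\<dots> \<le> real k" by (rule k)
      finally show ?thesis by simp
    qed simp
    have ksq: "real (2 * k\<^sup>2) < \<rho>"
    proof -
      have "(real k)\<^sup>2 \<le> (2 * X)\<^sup>2" using k by (intro power_mono) auto
      then have "real (2 * k\<^sup>2) \<le> 8 * X\<^sup>2" by (simp add: power_mult_distrib)
      also have "\<dots> \<le> 8 * w" using Xw by simp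
      also have "\<dots> < w * w" using w8 by simp
      finally show ?thesis unfolding w(2) .
    qed
    have kln: "(1 + ln (real k)) / real k \<le> 11 * E"
    proof -
      have "ln (real k) \<le> ln (2 * X)" using k X1 by (intro ln_mono) auto
      also have "\<dots> = ln 2 + ln X" using X1 by (simp add: ln_mult)
      also have "\<dots> \<le> 1 + 9 * X powr (1 / 9)"
      proof -
        have "ln X = 9 * ln (X powr (1 / 9))" using X1 by (simp add: ln_powr)
        also have "ln (X powr (1 / 9)) \<le> X powr (1 / 9) - 1" using X1 by (intro ln_le_minus_one) auto
        finally have "ln X \<le> 9 * X powr (1 / 9)" by simp
        then show ?thesis using ln_2_less_1 by linarith
      qed
      finally have "1 + ln (real k) \<le> 2 * 1 + 9 * X powr (1 / 9)" by simp
      also have "\<dots> \<le> 11 * X powr (1 / 9)"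
      proof -
        have "1 \<le> X powr (1 / 9)" using X1 by (intro ge_one_powr_ge_zero) auto
        then show ?thesis by linarith
      qed
      finally have "(1 + ln (real k)) / real k \<le> 11 * X powr (1 / 9) / real k"
        using k by (intro divide_right_mono) auto
      also have "\<dots> \<le> 11 * X powr (1 / 9) / X" using k X1 by (intro divide_left_mono) auto
      also have "\<dots> = 11 * E"
      proof -
        have "X powr (1 / 9 - 1) = X powr (1 / 9) / X" using X1 by (subst powr_diff) simp
        moreover have "(1 / 9 - 1 :: real) = - (8 / 9)" by simp
        ultimately show ?thesis by (simp only: EX times_divide_eq_right)
      qed
      finally show ?thesis .
    qed
    \<comment> \<open>The truncated expansions have degree at most \<open>M * (2 * amax)\<close>,
      hence at most \<open>\<rho> / 2\<close>, and none of their non-trivial exponents is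
      annihilated modulo \<open>p\<close>.\<close>
    define M where "M = nat \<lfloor>\<rho> / (4 * A)\<rfloor>"
    have M: "real M \<le> \<rho> / (4 * A)" "real M \<ge> \<rho> / (8 * A)"
    proof -
      have "\<rho> / (4 * A) \<ge> 0" using \<rho>0 A by simp
      then show "real M \<le> \<rho> / (4 * A)" by (simp add: M_def)
      have "real M \<ge> \<rho> / (4 * A) - 1" unfolding M_def by linarith
      moreover have "\<rho> / (8 * A) \<ge> 1" using \<rho>(2) A by simp
      moreover have "\<rho> / (4 * A) = \<rho> / (8 * A) + \<rho> / (8 * A)" by simp
      ultimately show "real M \<ge> \<rho> / (8 * A)" by linarith
    qed
    define T where "T = (1 - \<delta>) ^ M / \<delta>"
    have TX: "T \<le> cT / X\<^sup>2" "T \<ge> 0"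
    proof -
      show "T \<ge> 0" using \<delta> by (simp add: T_def)
      define y where "y = \<rho> powr (1 / 4) / (8 * A)"
      have y0: "y > 0" using \<rho>0 A by (simp add: y_def)
      have "(1 - \<delta>) ^ M \<le> exp (- \<delta>) ^ M"
        using \<delta> exp_ge_add_one_self[of "- \<delta>"] by (intro power_mono) auto
      also have "\<dots> = exp (- (\<delta> * real M))" by (simp add: exp_of_nat_mult[symmetric] mult.commute)
      also have "\<dots> \<le> exp (- y)"
      proof -
        have "y = \<delta> * (\<rho> / (8 * A))"
        proof -
          have "\<delta> * \<rho> = \<rho> powr (- (3 / 4)) * \<rho> powr 1" using \<rho>0 by (simp add: \<delta>_def)
          also have "\<dots> = \<rho> powr (1 / 4)" by (simp only: powr_add[symmetric]) simp
          finally show ?thesis by (simp add: y_def)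
        qed
        also have "\<dots> \<le> \<delta> * real M" using M \<delta> by (intro mult_left_mono) auto
        finally show ?thesis by simp
      qed
      also have "\<dots> \<le> (8 / y) ^ 8" by (rule exp_minus_le_power8[OF y0])
      also have "\<dots> = cT / \<rho> powr 2"
      proof -
        have "(\<rho> powr (1 / 4)) ^ 8 = (\<rho> powr (1 / 4)) powr real 8" using \<rho>0 by (subst powr_realpow) auto
        also have "\<dots> = \<rho> powr 2" by (simp only: powr_powr) simp
        finally have "(\<rho> powr (1 / 4)) ^ 8 = \<rho> powr 2" .
        moreover have "8 / y = 64 * A / \<rho> powr (1 / 4)" using A \<rho>0 by (simp add: y_def)
        ultimately show ?thesis by (simp add: cT_def power_divide)
      qed
      finally have "T \<le> (cT / \<rho> powr 2) / \<delta>" unfolding T_def using \<delta> by (intro divide_right_mono) auto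
      also have "\<dots> = cT * \<rho> powr (- (5 / 4))"
      proof -
        have "\<rho> powr 2 * \<delta> = \<rho> powr (5 / 4)" unfolding \<delta>_def by (simp only: powr_add[symmetric]) simp
        then show ?thesis by (simp add: powr_minus_divide)
      qed
      also have "\<dots> \<le> cT * \<rho> powr (- 2 * \<kappa>)" using \<kappa> \<rho>0 cT by (intro mult_left_mono powr_mono) auto
      finally have "T \<le> cT * \<rho> powr (- 2 * \<kappa>)" .
      then show "T \<le> cT / X\<^sup>2" unfolding X2\<rho> by simp
    qed
    have no1: "\<not> int p dvd ipr m y u" if "\<exists>i<m. y i \<noteq> 0" "\<forall>i<m. \<bar>y i\<bar> \<le> int (2 * k\<^sup>2)" for y
    proof (rule no[OF that(1)])
      fix i assume "i < m"
      then have "\<bar>y i\<bar> \<le> int (2 * k\<^sup>2)" using that by blast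
      then have "\<bar>real_of_int (y i)\<bar> \<le> real (2 * k\<^sup>2)" by linarith
      with ksq show "\<bar>real_of_int (y i)\<bar> < \<rho>" by linarith
    qed
    have no2: "\<not> int p dvd ipr m y u" if "\<exists>i<m. y i \<noteq> 0" "\<And>i. i < m \<Longrightarrow> \<bar>y i\<bar> \<le> int M * (2 * amax)" for y
    proof (rule no[OF that(1)])
      fix i assume "i < m"
      then have "real_of_int \<bar>y i\<bar> \<le> real_of_int (int M * (2 * amax))" using that(2) by (simp only: of_int_le_iff)
      also have "\<dots> = real M * (2 * A)" by (simp add: A_def)
      also have "\<dots> \<le> \<rho> / (4 * A) * (2 * A)" using M A by (intro mult_right_mono) auto
      also have "\<dots> = \<rho> / 2" using A by simp
      also have "\<dots> < \<rho>" using \<rho>0 by simp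
      finally show "\<bar>real_of_int (y i)\<bar> < \<rho>" by simp
    qed
    have nz: "\<forall>t\<in>{1..<p}. csum (orb p u t) \<noteq> 0" and
      D: "(\<Sum>t\<in>{1..<p}. ln (4 * sq (orb p u t) + q) - ln (4 * sq (orb p u t)))
          \<le> c * real k * (\<Sum>t\<in>{1..<p}. q / (q + 4 * sq (orb p u t))) + c * ((1 + ln (real k)) / real k) * real (p - 1)"
    proof -
      have no1': "\<forall>y. (\<exists>i<m. y i \<noteq> 0) \<longrightarrow> (\<forall>i<m. \<bar>y i\<bar> \<le> int (2 * k\<^sup>2)) \<longrightarrow> \<not> int p dvd ipr m y u"
        using no1 by blast
      note d = mp[OF mp[OF spec[OF spec[OF mp[OF spec[OF defect, of k] kk0], of p], of u] p] no1']
      show "\<forall>t\<in>{1..<p}. csum (orb p u t) \<noteq> 0" by (rule conjunct1[OF d])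
      show "(\<Sum>t\<in>{1..<p}. ln (4 * sq (orb p u t) + q) - ln (4 * sq (orb p u t)))
          \<le> c * real k * (\<Sum>t\<in>{1..<p}. q / (q + 4 * sq (orb p u t))) + c * ((1 + ln (real k)) / real k) * real (p - 1)"
        by (rule mp[OF mp[OF spec[OF conjunct2[OF d], of q] q(1)] q1(1)])
    qed
    define L where "L = (\<integral>\<theta>. ln (4 * sq \<theta>) \<partial>torus m)"
    define SX where "SX = (\<Sum>t\<in>{1..<p}. ln (4 * sq (orb p u t) + q))"
    define SZ where "SZ = (\<Sum>t\<in>{1..<p}. ln (4 * sq (orb p u t)))"
    define SP where "SP = (\<Sum>t\<in>{1..<p}. q / (q + 4 * sq (orb p u t)))"
    \<comment> \<open>Averaging takes place over the whole group of \<open>p\<close> points, whereas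
      the product over the conjugates omits the origin, where \<open>sq\<close> is 1.\<close>
    have set: "{..<p} = insert 0 {1..<p}" using p1 by auto
    have sq0: "sq (orb p u 0) = 1" by (simp add: sq_def csum_orb_0 n1_def)
    have p0: "p > 0" and \<delta>1: "\<delta> < 1" using p1 \<delta> by simp_all
    have sum0: "(\<Sum>t<p. f t) = f 0 + (\<Sum>t\<in>{1..<p}. f t)" for f :: "nat \<Rightarrow> real"
      unfolding set by (subst sum.insert) auto
    have olp: "\<bar>(\<Sum>t<p. ln (4 * sq (orb p u t) + q)) - real p * logint q\<bar> \<le> 4 * real p * T"
      "\<bar>(\<Sum>t<p. q / (q + 4 * sq (orb p u t))) - real p * (\<integral>\<theta>. q / (q + 4 * sq \<theta>) \<partial>torus m)\<bar> \<le> 4 * real p * T"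
      unfolding q_def T_def by (rule orbit_mean_log_poisson[OF p0 \<delta>(1) \<delta>1], rule no2, assumption, blast)+
    have om1: "\<bar>SX + ln (4 + q) - real p * logint q\<bar> \<le> 4 * real p * T"
      using olp(1)
      unfolding sum0 sq0 SX_def by (simp add: add.commute)
    have om2: "SP \<le> real p * (K * q powr \<gamma>) + 4 * real p * T"
    proof -
      have "\<bar>SP + q / (q + 4) - real p * (\<integral>\<theta>. q / (q + 4 * sq \<theta>) \<partial>torus m)\<bar> \<le> 4 * real p * T"
        using olp(2)
        unfolding sum0 sq0 SP_def by (simp add: add.commute)
      moreover have "q / (q + 4) \<ge> 0" using q by simp
      moreover have "real p * (\<integral>\<theta>. q / (q + 4 * sq \<theta>) \<partial>torus m) \<le> real p * (K * q powr \<gamma>)"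
        by (rule mult_left_mono[OF K2[OF q(1)]]) simp
      ultimately show ?thesis by linarith
    qed
    have SP0: "SP \<ge> 0" unfolding SP_def using q sq_bounds by (intro sum_nonneg divide_nonneg_nonneg add_nonneg_nonneg) auto
    have lnq: "\<bar>ln q\<bar> \<le> 3 * w"
    proof -
      have "ln q \<le> 0" using q q1 by simp
      moreover have "ln (\<delta>\<^sup>2) \<le> ln q" using q \<delta> by (intro ln_mono) auto
      moreover have "ln (\<delta>\<^sup>2) = - (3 / 2) * ln \<rho>" using \<rho>0 by (simp add: \<delta>_def ln_realpow ln_powr)
      moreover have "ln \<rho> \<le> 2 * w"
      proof -
        have "ln \<rho> = ln w + ln w" using ln_mult_pos[OF w(1) w(1)] unfolding w(2) .
        moreover have "ln w \<le> w - 1" using w by (intro ln_le_minus_one) auto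
        ultimately show ?thesis by linarith
      qed
      ultimately show ?thesis by linarith
    qed
    have ln5: "\<bar>ln (4 * s + q)\<bar> \<le> 4 + 3 * w" if s: "0 \<le> s" "s \<le> 1" for s
    proof -
      have "ln (4 * s + q) \<le> 4 * s + q - 1" using q s by (intro ln_le_minus_one) auto
      moreover have "ln q \<le> ln (4 * s + q)" using q s by (intro ln_mono) auto
      ultimately show ?thesis using lnq s q1 w by linarith
    qed
    have \<Lambda>: "\<bar>logint q\<bar> \<le> 4 + 3 * w"
    proof -
      have "\<bar>logint q\<bar> \<le> (\<integral>\<theta>. \<bar>ln (4 * sq \<theta> + q)\<bar> \<partial>torus m)" unfolding logint_def by (rule integral_abs_bound)
      also have "\<dots> \<le> (\<integral>\<theta>. 4 + 3 * w \<partial>torus m)"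
        using integrable_log_sq[OF q(1)] ln5 sq_bounds by (intro integral_mono) auto
      also have "\<dots> = 4 + 3 * w" using one by simp
      finally show ?thesis .
    qed
    \<comment> \<open>Omitting \<open>t = 0\<close> and dividing by \<open>p - 1\<close> instead of
      \<open>p\<close> costs \<open>O(w / p)\<close>, with \<open>w\<close>, the square root of
      \<open>\<rho>\<close>, as a crude bound for the logarithms. By \<open>p \<ge> \<rho>\<close>
      this is \<open>O(1 / w)\<close>, which is \<open>O(E)\<close>.\<close>
    have avgX: "\<bar>SX / P1 - logint q\<bar> \<le> 8 * T + 22 * E"
    proof -
      have "SX / P1 - logint q = ((SX + ln (4 + q) - real p * logint q) + (logint q - ln (4 + q))) / P1"
        using P1 by (simp add: field_simps P1_def)
      also have "\<bar>\<dots>\<bar> = \<bar>(SX + ln (4 + q) - real p * logint q) + (logint q - ln (4 + q))\<bar> / P1"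
        using P1 by simp
      also have "\<dots> \<le> (4 * real p * T + (8 + 6 * w)) / P1"
        using P1 om1 \<Lambda> ln5[of 1] by (intro divide_right_mono) auto
      also have "\<dots> \<le> (4 * (2 * P1) * T + (8 + 6 * w)) / P1"
        using P1 TX by (intro divide_right_mono add_right_mono mult_right_mono mult_left_mono) auto
      also have "\<dots> = 8 * T + (8 + 6 * w) / P1" using P1 by (simp add: add_divide_distrib)
      also have "(8 + 6 * w) / P1 \<le> 22 * E"
      proof -
        have "(8 + 6 * w) / P1 \<le> (7 * w) / P1" using w8 P1 by (intro divide_right_mono) auto
        also have "\<dots> \<le> (7 * w) / (\<rho> / 2)" using P1 p\<rho> w \<rho>0 by (intro divide_left_mono) auto
        also have "\<dots> = 14 * (1 / w)" using w(1) by (simp add: w(2)[symmetric])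
        also have "\<dots> \<le> 14 * E" using wE by simp
        also have "\<dots> \<le> 22 * E" using E0 by simp
        finally show ?thesis .
      qed
      finally show ?thesis by simp
    qed
    have TE: "T \<le> cT * E" "real k * T \<le> 2 * cT * E"
    proof -
      have "cT / X\<^sup>2 \<le> cT * E"
        using mult_left_mono[OF order_trans[OF X2 XE] cT] by simp
      then show "T \<le> cT * E" using TX by linarith
      have "real k * T \<le> (2 * X) * (cT / X\<^sup>2)" using k TX X1 cT by (intro mult_mono) auto
      also have "\<dots> = 2 * cT * (1 / X)" using X1 by (simp add: power2_eq_square)
      also have "\<dots> \<le> 2 * cT * E" using XE cT by (intro mult_left_mono) auto
      finally show "real k * T \<le> 2 * cT * E" .
    qed
    have qE: "q powr \<gamma> \<le> 2 * E" "real k * q powr \<gamma> \<le> 4 * E"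
    proof -
      show "q powr \<gamma> \<le> 2 * E" using q\<gamma> X2 XE by simp
      have "real k * q powr \<gamma> \<le> (2 * X) * (2 / X\<^sup>2)" using k q\<gamma> X1 by (intro mult_mono) auto
      also have "\<dots> = 4 * (1 / X)" using X1 by (simp add: power2_eq_square)
      also have "\<dots> \<le> 4 * E" using XE by simp
      finally show "real k * q powr \<gamma> \<le> 4 * E" .
    qed
    have SD: "SX - SZ \<le> c * real k * SP + c * ((1 + ln (real k)) / real k) * P1"
      using D unfolding SX_def SZ_def SP_def P1(3) by (simp add: sum_subtractf)
    have SD0: "0 \<le> SX - SZ"
    proof -
      have "SZ \<le> SX" unfolding SX_def SZ_def
      proof (rule sum_mono)
        fix t assume "t \<in> {1..<p}"
        then have "sq (orb p u t) \<noteq> 0" using nz csum_eq_0_iff by blast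
        then have "sq (orb p u t) > 0" using sq_bounds(1)[of "orb p u t"] by simp
        then show "ln (4 * sq (orb p u t)) \<le> ln (4 * sq (orb p u t) + q)" using q by (intro ln_mono) auto
      qed
      then show ?thesis by simp
    qed
    have avgD: "(SX - SZ) / P1 \<le> c * (8 * K + 16 * cT + 11) * E"
    proof -
      have "(SX - SZ) / P1 \<le> (c * real k * SP + c * ((1 + ln (real k)) / real k) * P1) / P1"
        using SD P1 by (intro divide_right_mono) auto
      also have "\<dots> = c * (real k * (SP / P1) + (1 + ln (real k)) / real k)" using P1 by (simp add: field_simps)
      also have "\<dots> \<le> c * ((8 * K * E + 16 * cT * E) + 11 * E)"
      proof (intro mult_left_mono add_mono kln c)
        have "SP \<le> real p * (K * q powr \<gamma> + 4 * T)" using om2 by (simp add: algebra_simps)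
        also have "\<dots> \<le> (2 * P1) * (K * q powr \<gamma> + 4 * T)"
          using P1 K TX by (intro mult_right_mono) auto
        finally have "SP / P1 \<le> 2 * (K * q powr \<gamma> + 4 * T)" using P1 by (simp add: divide_le_eq mult_ac)
        then have "real k * (SP / P1) \<le> real k * (2 * (K * q powr \<gamma> + 4 * T))" by (rule mult_left_mono) simp
        also have "\<dots> = 2 * K * (real k * q powr \<gamma>) + 8 * (real k * T)" by (simp add: algebra_simps)
        also have "\<dots> \<le> 2 * K * (4 * E) + 8 * (2 * cT * E)"
          using qE TE K by (intro add_mono mult_left_mono) auto
        finally show "real k * (SP / P1) \<le> 8 * K * E + 16 * cT * E" by simp
      qed
      finally show ?thesis by (simp add: algebra_simps)
    qed
    have "\<bar>SZ / P1 - L\<bar> \<le> C * E"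
    proof -
      have 1: "\<bar>logint q - L\<bar> \<le> 2 * K * E"
      proof -
        have "\<bar>logint q - L\<bar> \<le> K * q powr \<gamma>" unfolding L_def by (rule K1[OF q(1)])
        also have "\<dots> \<le> K * (2 * E)" by (rule mult_left_mono[OF qE(1) K])
        finally show ?thesis by simp
      qed
      have 2: "0 \<le> (SX - SZ) / P1" using SD0 P1 by simp
      have 3: "SZ / P1 = SX / P1 - (SX - SZ) / P1" by (simp add: diff_divide_distrib)
      have "\<bar>SZ / P1 - L\<bar> \<le> (8 * T + 22 * E) + 2 * K * E + c * (8 * K + 16 * cT + 11) * E"
        using avgX 1 2 3 avgD by linarith
      also have "\<dots> \<le> (8 * (cT * E) + 22 * E) + 2 * K * E + c * (8 * K + 16 * cT + 11) * E"
        using TE(1) by simp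
      also have "\<dots> = C * E" by (simp add: C_def algebra_simps)
      finally show ?thesis .
    qed
    moreover have "SZ / P1 - L = 2 * (1 / (real p - 1) * (\<Sum>t\<in>{1..<p}. ln (cmod (csum (orb p u t)))) - (\<integral>\<theta>. ln (cmod (csum \<theta>)) \<partial>torus m))"
    proof -
      have "SZ = (\<Sum>t\<in>{1..<p}. (ln 4 - 2 * ln n1) + 2 * ln (cmod (csum (orb p u t))))"
        unfolding SZ_def
      proof (rule sum.cong[OF refl])
        fix t assume "t \<in> {1..<p}"
        then have "cmod (csum (orb p u t)) > 0" using nz by simp
        then show "ln (4 * sq (orb p u t)) = (ln 4 - 2 * ln n1) + 2 * ln (cmod (csum (orb p u t)))"
          using n1_ge1 by (simp add: sq_def ln_mult ln_div ln_realpow)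
      qed
      also have "\<dots> = P1 * (ln 4 - 2 * ln n1) + 2 * (\<Sum>t\<in>{1..<p}. ln (cmod (csum (orb p u t))))"
        unfolding sum.distrib sum_distrib_left[symmetric] sum_constant card_atLeastLessThan P1(3) ..
      finally show ?thesis
        unfolding L_def log_csum_integral[OF AE iln] P1_def[symmetric] using P1(1) by (simp add: field_simps)
    qed
    moreover have "E = \<rho> powr (- (1 / (4 * real nn)))" by (simp add: E_def n_def)
    ultimately show ?thesis using nz by simp
  qed
  show ?thesis
  proof (rule exI[of _ C], rule exI[of _ R0], intro allI impI)
    fix p u \<rho>
    assume p: "prime p" and \<rho>: "R0 \<le> \<rho>"
      and no: "\<forall>y. (\<exists>i<m. y i \<noteq> 0) \<longrightarrow> (\<forall>i<m. \<bar>real_of_int (y i)\<bar> < \<rho>) \<longrightarrow> \<not> int p dvd ipr m y u"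
    show "(\<forall>t\<in>{1..<p}. csum (orb p u t) \<noteq> 0) \<and>
     \<bar>1 / (real p - 1) * (\<Sum>t\<in>{1..<p}. ln (cmod (csum (orb p u t)))) - (\<integral>\<theta>. ln (cmod (csum \<theta>)) \<partial>torus m)\<bar>
       \<le> C * \<rho> powr (- (1 / (4 * real nn)))"
      by (rule main[OF p \<rho>]) (use no in simp)
  qed
qed

end

section \<open>Subgroups of \<open>\<int>\<^sup>n\<close>\<close>

lemma scalar_product_add [simp]: "scalar_product (v + w) u = scalar_product v u + scalar_product w u"
  and scalar_product_diff [simp]: "scalar_product (v - w) u = scalar_product v u - scalar_product w u"
  and scalar_product_scale [simp]: "scalar_product (c *s v) u = c * scalar_product v u"
  and scalar_product_zero [simp]: "scalar_product 0 u = 0"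
  for u v w :: "int ^ 'n"
  by (simp_all add: scalar_product_def algebra_simps sum.distrib sum_subtractf sum_distrib_left)

lemma scalar_product_diff_right [simp]: "scalar_product u (v - w) = scalar_product u v - scalar_product u w"
  and scalar_product_scale_right [simp]: "scalar_product u (c *s v) = c * scalar_product u v"
  and scalar_product_zero_right [simp]: "scalar_product u 0 = 0"
  for u v w :: "int ^ 'n"
  by (simp_all add: scalar_product_def algebra_simps sum_subtractf sum_distrib_left)

lemma scalar_product_commute: "scalar_product v w = scalar_product w v" for v w :: "int ^ 'n"
  by (simp add: scalar_product_def mult.commute)

lemma scalar_product_sum: "scalar_product (\<Sum>i\<in>I. f i) u = (\<Sum>i\<in>I. scalar_product (f i) u)" for u :: "int ^ 'n"
  by (induction I rule: infinite_finite_induct) simp_all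

lemma scalar_product_self: "scalar_product v v = 0 \<longleftrightarrow> v = 0" for v :: "int ^ 'n"
  by (auto simp: scalar_product_def vec_eq_iff sum_nonneg_eq_0_iff)

lemma span_perp:
  fixes v w :: "int ^ 'n"
  assumes "v \<in> int_vec.span B" "\<And>b. b \<in> B \<Longrightarrow> scalar_product b w = 0"
  shows "scalar_product v w = 0"
  using assms(1)
proof (induction rule: int_vec.span_induct)
  show "int_vec.subspace {v. scalar_product v w = 0}"
    by (rule int_vec.subspaceI) auto
qed (use assms(2) in auto)

text \<open>Orthogonalisation with denominators cleared. First \<open>b\<close> and \<open>w\<close>
  are made orthogonal to \<open>B\<close>; then the component of \<open>w'\<close> along
  \<open>b'\<close> is removed by cross-multiplication. If \<open>b' = 0\<close>, then
  \<open>b\<close> depends on \<open>B\<close> and nothing remains to be removed.\<close>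

lemma integer_gram_schmidt:
  fixes w :: "int ^ 'n"
  assumes "finite B"
  shows "\<exists>c v. c \<noteq> 0 \<and> v \<in> int_vec.span B \<and> (\<forall>b\<in>B. scalar_product b (c *s w - v) = 0)"
  using assms
proof (induction B arbitrary: w)
  case empty
  then show ?case by (intro exI[of _ 1] exI[of _ 0]) simp
next
  case (insert b B)
  obtain c1 v1 where 1: "c1 \<noteq> 0" "v1 \<in> int_vec.span B" "\<And>x. x \<in> B \<Longrightarrow> scalar_product x (c1 *s b - v1) = 0"
    using insert.IH by blast
  obtain c2 v2 where 2: "c2 \<noteq> 0" "v2 \<in> int_vec.span B" "\<And>x. x \<in> B \<Longrightarrow> scalar_product x (c2 *s w - v2) = 0"
    using insert.IH by blast
  define b' w' where "b' = c1 *s b - v1" and "w' = c2 *s w - v2"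
  have v1w': "scalar_product v1 w' = 0" unfolding w'_def by (rule span_perp[OF 1(2) 2(3)])
  have v1b': "scalar_product v1 b' = 0" unfolding b'_def by (rule span_perp[OF 1(2) 1(3)])
  have cb: "c1 * scalar_product b x = scalar_product b' x + scalar_product v1 x" for x by (simp add: b'_def)
  have sub: "int_vec.span B \<subseteq> int_vec.span (insert b B)" by (rule int_vec.span_mono) auto
  show ?case
  proof (cases "b' = 0")
    case True
    then have "scalar_product b w' = 0" using cb[of w'] v1w' 1(1) by simp
    then show ?thesis using 2 sub by (intro exI[of _ c2] exI[of _ v2]) (auto simp: w'_def)
  next
    case False
    define N where "N = scalar_product b' b'"
    have N: "N \<noteq> 0" using False by (simp add: N_def scalar_product_self)
    define z where "z = scalar_product b' w'"
    define v where "v = N *s v2 + z *s (c1 *s b - v1)"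
    have "v \<in> int_vec.span (insert b B)"
      unfolding v_def
      by (intro int_vec.span_add int_vec.span_scale int_vec.span_diff subsetD[OF sub 2(2)] subsetD[OF sub 1(2)] int_vec.span_base) auto
    moreover have eq: "(N * c2) *s w - v = N *s w' - z *s b'"
      by (simp add: v_def w'_def b'_def vec_eq_iff algebra_simps)
    moreover have "scalar_product x (N *s w' - z *s b') = 0" if "x \<in> insert b B" for x
    proof (cases "x = b")
      case True
      have "c1 * scalar_product b (N *s w' - z *s b') = scalar_product b' (N *s w' - z *s b') + scalar_product v1 (N *s w' - z *s b')"
        by (rule cb)
      also have "\<dots> = N * z - z * N + 0"
        using v1w' v1b' by (simp add: N_def z_def)
      finally show ?thesis using 1(1) True by simp
    next
      case False
      then have "x \<in> B" using that by simp
      then have "scalar_product x b' = 0" "scalar_product x w' = 0"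
        using 1(3)[of x] 2(3)[of x] unfolding b'_def w'_def by blast+
      then show ?thesis by simp
    qed
    ultimately show ?thesis using N 2(1) by (intro exI[of _ "N * c2"] exI[of _ v]) auto
  qed
qed

text \<open>Induction on the set of coordinates that may be non-zero. A vector
  \<open>\<omega>0\<close> whose \<open>s\<close>-th coordinate is the least positive value that
  occurs splits off by division with remainder, and the elements with \<open>s\<close>-th coordinate
  0 form a smaller case.\<close>

lemma subgroup_has_basis:
  fixes \<Omega> :: "(int ^ 'n) set"
  assumes "finite S" "int_vec.subspace \<Omega>" "\<And>\<omega> i. \<omega> \<in> \<Omega> \<Longrightarrow> i \<notin> S \<Longrightarrow> \<omega> $ i = 0"
  shows "\<exists>B. finite B \<and> int_vec.independent B \<and> int_vec.span B = \<Omega>"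
  using assms
proof (induction S arbitrary: \<Omega>)
  case empty
  have "\<Omega> = {0}" using empty int_vec.subspace_0[of \<Omega>] by (auto simp: vec_eq_iff)
  then show ?case by (intro exI[of _ "{}"]) (simp add: int_vec.independent_empty)
next
  case (insert s S)
  show ?case
  proof (cases "\<forall>\<omega>\<in>\<Omega>. \<omega> $ s = 0")
    case True
    then show ?thesis using insert.IH[OF insert.prems(1)] insert.prems(2) by (metis insertE)
  next
    case False
    then obtain \<omega>1 where \<omega>1: "\<omega>1 \<in> \<Omega>" "\<omega>1 $ s \<noteq> 0" by blast
    define Q where "Q k \<longleftrightarrow> k > 0 \<and> (\<exists>\<omega>\<in>\<Omega>. \<omega> $ s = int k)" for k :: nat
    have "Q (nat \<bar>\<omega>1 $ s\<bar>)"
    proof (cases "\<omega>1 $ s > 0")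
      case True
      then show ?thesis using \<omega>1 by (auto simp: Q_def)
    next
      case False
      then show ?thesis using \<omega>1 int_vec.subspace_neg[OF insert.prems(1) \<omega>1(1)]
        by (auto simp: Q_def intro!: bexI[of _ "- \<omega>1"])
    qed
    define d where "d = (LEAST k. Q k)"
    have Qd: "Q d" unfolding d_def by (rule LeastI) fact
    have dmin: "\<not> Q k" if "k < d" for k using that not_less_Least unfolding d_def by blast
    obtain \<omega>0 where \<omega>0: "\<omega>0 \<in> \<Omega>" "\<omega>0 $ s = int d" and d0: "d > 0" using Qd by (auto simp: Q_def)
    define \<Omega>' where "\<Omega>' = {\<omega>\<in>\<Omega>. \<omega> $ s = 0}"
    have sub': "int_vec.subspace \<Omega>'"
      using insert.prems(1) by (auto simp: \<Omega>'_def int_vec.subspace_def)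
    have "\<omega> $ i = 0" if "\<omega> \<in> \<Omega>'" "i \<notin> S" for \<omega> i
      using that insert.prems(2)[of \<omega> i] by (cases "i = s") (auto simp: \<Omega>'_def)
    from insert.IH[OF sub' this] obtain B where B: "finite B" "int_vec.independent B" "int_vec.span B = \<Omega>'" by blast
    have Bs: "b $ s = 0" if "b \<in> B" for b
      using int_vec.span_base[OF that] B(3) by (auto simp: \<Omega>'_def)
    have \<omega>0B: "\<omega>0 \<notin> B" using Bs \<omega>0(2) d0 by auto
    have "int_vec.independent (insert \<omega>0 B)"
    proof
      assume "int_vec.dependent (insert \<omega>0 B)"
      then obtain u v where u: "v \<in> insert \<omega>0 B" "u v \<noteq> 0" "(\<Sum>x\<in>insert \<omega>0 B. u x *s x) = 0"
        using B(1) by (auto simp: int_vec.dependent_finite)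
      have s0: "u \<omega>0 *s \<omega>0 + (\<Sum>x\<in>B. u x *s x) = 0" using u(3) B(1) \<omega>0B by simp
      have "(u \<omega>0 *s \<omega>0 + (\<Sum>x\<in>B. u x *s x)) $ s = u \<omega>0 * int d"
        using Bs by (simp add: \<omega>0(2))
      then have u0: "u \<omega>0 = 0" using s0 d0 by simp
      then have "(\<Sum>x\<in>B. u x *s x) = 0" "v \<in> B" using s0 u(1,2) by auto
      then show False using B(1,2) u(2) int_vec.dependent_finite[OF B(1)] by blast
    qed
    moreover have "int_vec.span (insert \<omega>0 B) = \<Omega>"
    proof
      have "B \<subseteq> \<Omega>" using int_vec.span_superset[of B] B(3) by (auto simp: \<Omega>'_def)
      then show "int_vec.span (insert \<omega>0 B) \<subseteq> \<Omega>"
        using \<omega>0 insert.prems(1) by (intro int_vec.span_minimal) auto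
      show "\<Omega> \<subseteq> int_vec.span (insert \<omega>0 B)"
      proof
        fix \<omega> assume \<omega>: "\<omega> \<in> \<Omega>"
        define k where "k = \<omega> $ s div int d"
        define \<omega>' where "\<omega>' = \<omega> - k *s \<omega>0"
        have in\<Omega>: "\<omega>' \<in> \<Omega>" unfolding \<omega>'_def
          using \<omega> \<omega>0 insert.prems(1) by (intro int_vec.subspace_diff int_vec.subspace_scale)
        have "\<omega>' $ s = \<omega> $ s mod int d"
          by (simp add: \<omega>'_def k_def \<omega>0(2) minus_div_mult_eq_mod)
        moreover have "\<omega> $ s mod int d \<ge> 0" "\<omega> $ s mod int d < int d" using d0 by simp_all
        ultimately have "\<omega>' $ s = int (nat (\<omega> $ s mod int d))" "nat (\<omega> $ s mod int d) < d" by simp_all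
        define k' where "k' = nat (\<omega> $ s mod int d)"
        have k': "\<omega>' $ s = int k'" "k' < d" using \<open>\<omega>' $ s = int (nat (\<omega> $ s mod int d))\<close> \<open>nat (\<omega> $ s mod int d) < d\<close> by (simp_all only: k'_def)
        have "\<not> k' > 0" using dmin[OF k'(2)] bexI[of "\<lambda>\<omega>. \<omega> $ s = int k'", OF k'(1) in\<Omega>] unfolding Q_def by simp
        then have "\<omega>' $ s = 0" using k'(1) by simp
        then have "\<omega>' \<in> int_vec.span (insert \<omega>0 B)"
          using in\<Omega> B(3) int_vec.span_mono[of B "insert \<omega>0 B"] by (auto simp: \<Omega>'_def)
        moreover have "\<omega> = \<omega>' + k *s \<omega>0" by (simp add: \<omega>'_def)
        ultimately show "\<omega> \<in> int_vec.span (insert \<omega>0 B)"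
          by (metis int_vec.span_add int_vec.span_base int_vec.span_scale insertI1)
      qed
    qed
    ultimately show ?thesis using B(1) by (intro exI[of _ "insert \<omega>0 B"]) auto
  qed
qed

section \<open>The rank through rational vector spaces\<close>

definition to_rat :: "int ^ 'n \<Rightarrow> rat ^ 'n" where
  "to_rat v = (\<chi> i. of_int (v $ i))"

lemma to_rat_sum: "to_rat (\<Sum>v\<in>I. u v *s f v) = (\<Sum>v\<in>I. of_int (u v) *s to_rat (f v))"
  by (simp add: to_rat_def vec_eq_iff)

lemma inj_to_rat: "inj to_rat"
  by (auto simp: inj_def to_rat_def vec_eq_iff)

lemma common_denominator:
  assumes "finite C"
  shows "\<exists>D::int. D \<noteq> 0 \<and> (\<forall>v\<in>C. \<exists>n::int. of_int D * q v = (of_int n :: rat))"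
  using assms
proof (induction C)
  case (insert v C)
  then obtain D :: int where D: "D \<noteq> 0" "\<And>v. v \<in> C \<Longrightarrow> \<exists>n::int. of_int D * q v = of_int n" by auto
  obtain a b where ab: "quotient_of (q v) = (a, b)" by (cases "quotient_of (q v)")
  have b: "b > 0" "q v = of_int a / of_int b" using quotient_of_denom_pos[OF ab] quotient_of_div[OF ab] by auto
  have "\<exists>n::int. of_int (D * b) * q x = of_int n" if "x \<in> insert v C" for x
  proof (cases "x = v")
    case True
    have "of_int (D * b) * q v = of_int (D * a)" using b by simp
    then show ?thesis using True by blast
  next
    case False
    then obtain n :: int where "of_int D * q x = of_int n" using D(2)[of x] \<open>x \<in> insert v C\<close> by auto
    then have "of_int (D * b) * q x = of_int (n * b)" by (simp add: mult_ac)
    then show ?thesis by blast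
  qed
  then show ?case using D(1) b(1) by (intro exI[of _ "D * b"]) auto
qed (auto intro: exI[of _ 1])

lemma independent_to_rat:
  assumes "finite C" "int_vec.independent C"
  shows "vec.independent (to_rat ` C)"
proof
  assume "vec.dependent (to_rat ` C)"
  then obtain q where q: "\<exists>v\<in>to_rat ` C. q v \<noteq> 0" "(\<Sum>v\<in>to_rat ` C. q v *s v) = 0"
    using assms(1) by (auto simp: vec.dependent_finite)
  have inj: "inj_on to_rat C" using inj_to_rat by (rule inj_on_subset) simp
  have s: "(\<Sum>v\<in>C. q (to_rat v) *s to_rat v) = 0" using q(2) by (simp add: sum.reindex[OF inj])
  obtain D :: int where D: "D \<noteq> 0" "\<And>v. v \<in> C \<Longrightarrow> \<exists>n::int. of_int D * q (to_rat v) = of_int n"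
    using common_denominator[OF assms(1), of "\<lambda>v. q (to_rat v)"] by blast
  then obtain n :: "int ^ 'a \<Rightarrow> int" where n: "\<And>v. v \<in> C \<Longrightarrow> of_int D * q (to_rat v) = of_int (n v)" by metis
  have "to_rat (\<Sum>v\<in>C. n v *s v) = (\<Sum>v\<in>C. of_int (n v) *s to_rat v)" by (rule to_rat_sum)
  also have "\<dots> = (\<Sum>v\<in>C. (of_int D * q (to_rat v)) *s to_rat v)" by (intro sum.cong) (simp_all add: n)
  also have "\<dots> = of_int D *s (\<Sum>v\<in>C. q (to_rat v) *s to_rat v)"
    by (simp add: vec.scale_sum_right)
  also have "\<dots> = 0" by (simp add: s)
  also have "0 = to_rat 0" by (simp add: to_rat_def vec_eq_iff)
  finally have z: "(\<Sum>v\<in>C. n v *s v) = 0" by (rule injD[OF inj_to_rat])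
  obtain v where v: "v \<in> C" "q (to_rat v) \<noteq> 0" using q(1) by auto
  then have "of_int (n v) \<noteq> (0::rat)" using n[OF v(1)] D(1) by (metis mult_eq_0_iff of_int_eq_0_iff)
  then have "n v \<noteq> 0" by simp
  then show False using z v(1) assms by (auto simp: int_vec.dependent_finite)
qed

text \<open>Independence and membership in the span both survive the passage to rational vectors,
  where the dimension bound for vector spaces is at hand.\<close>

lemma independent_card_le:
  fixes B C :: "(int ^ 'n) set"
  assumes "finite B" "finite C" "int_vec.independent C" "C \<subseteq> int_vec.span B"
  shows "card C \<le> card B"
proof -
  have inj: "inj_on to_rat X" for X :: "(int ^ 'n) set" using inj_to_rat by (rule inj_on_subset) simp
  have "to_rat ` C \<subseteq> vec.span (to_rat ` B)"
  proof
    fix x assume "x \<in> to_rat ` C"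
    then obtain v where v: "x = to_rat v" "v \<in> int_vec.span B" using assms(4) by auto
    then obtain u where "v = (\<Sum>b\<in>B. u b *s b)" using int_vec.span_finite[OF assms(1)] by auto
    then have "x = (\<Sum>b\<in>B. of_int (u b) *s to_rat b)" using v(1) by (simp add: to_rat_sum)
    then show "x \<in> vec.span (to_rat ` B)"
      by (simp only:) (intro vec.span_sum vec.span_scale vec.span_base imageI)
  qed
  then have "card (to_rat ` C) \<le> card (to_rat ` B)"
    using vec.independent_span_bound[OF _ independent_to_rat[OF assms(2,3)]] assms(1) by blast
  then show ?thesis by (simp add: card_image[OF inj])
qed

text \<open>The maximum in \<open>subgroup_rank\<close> is over a finite set and attained by any
  basis. It follows that the choice operator in \<open>lattice_mahler\<close> selects a genuine
  basis.\<close>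

lemma subgroup_rank_basis:
  fixes \<Omega> :: "(int ^ 'n) set"
  assumes "int_vec.subspace \<Omega>"
  shows "\<exists>A. rows_form_basis (subgroup_rank \<Omega>) A \<Omega>"
proof -
  obtain B where B: "finite B" "int_vec.independent B" "int_vec.span B = \<Omega>"
    using subgroup_has_basis[of UNIV \<Omega>] assms by auto
  have "subgroup_rank \<Omega> = card B"
    unfolding subgroup_rank_def
  proof (rule Max_eqI)
    let ?S = "{card C |C. C \<subseteq> \<Omega> \<and> finite C \<and> int_vec.independent C}"
    have le: "x \<le> card B" if "x \<in> ?S" for x
      using that independent_card_le[OF B(1)] B(3) by auto
    then show "finite ?S" by (meson finite_nat_set_iff_bounded_le)
    show "x \<le> card B" if "x \<in> ?S" for x by (rule le[OF that])
    show "card B \<in> ?S" using B int_vec.span_superset[of B] by blast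
  qed
  moreover obtain f where "bij_betw f {0..<card B} B" using ex_bij_betw_nat_finite[OF B(1)] by blast
  then have "rows_form_basis (card B) f \<Omega>"
    using B by (auto simp: rows_form_basis_def bij_betw_def lessThan_atLeast0)
  ultimately show ?thesis by auto
qed

lemma basis_coefficients_zero:
  assumes A: "rows_form_basis m A \<Omega>" and z: "(\<Sum>i<m. c i *s A i) = 0" and i: "i < m"
  shows "c i = 0"
proof -
  have inj: "inj_on A {..<m}" and ind: "int_vec.independent (A ` {..<m})" using A by (auto simp: rows_form_basis_def)
  define u where "u v = c (the_inv_into {..<m} A v)" for v
  have u: "u (A i) = c i" if "i < m" for i using the_inv_into_f_f[OF inj] that by (simp add: u_def)
  have "(\<Sum>v\<in>A ` {..<m}. u v *s v) = (\<Sum>i<m. c i *s A i)"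
    by (simp add: sum.reindex[OF inj] u)
  then have "(\<Sum>v\<in>A ` {..<m}. u v *s v) = 0" using z by simp
  then have "\<not> (\<exists>v\<in>A ` {..<m}. u v \<noteq> 0)" using ind by (auto simp: int_vec.dependent_finite)
  then show ?thesis using i u by auto
qed

lemma basis_span:
  assumes A: "rows_form_basis m A \<Omega>" and "a \<in> \<Omega>"
  shows "\<exists>u. a = (\<Sum>i<m. u i *s A i)"
proof -
  have inj: "inj_on A {..<m}" and span: "int_vec.span (A ` {..<m}) = \<Omega>" using A by (auto simp: rows_form_basis_def)
  have "a \<in> range (\<lambda>u. \<Sum>v\<in>A ` {..<m}. u v *s v)" using assms(2) span int_vec.span_finite[of "A ` {..<m}"] by simp
  then obtain u where "a = (\<Sum>v\<in>A ` {..<m}. u v *s v)" by auto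
  then have "a = (\<Sum>i<m. u (A i) *s A i)" by (simp add: sum.reindex[OF inj])
  then show ?thesis by (rule exI[of _ "\<lambda>i. u (A i)"])
qed

text \<open>A dual basis inside the subgroup, up to a common factor \<open>D\<close>. Each row is
  orthogonalised against the others, and multiplication by the remaining diagonal pairings makes all
  of these equal. It serves to turn coefficient vectors \<open>y\<close> into elements of the
  subgroup.\<close>

lemma dual_vectors:
  assumes A: "rows_form_basis m A \<Omega>"
  shows "\<exists>d D. D \<noteq> 0 \<and> (\<forall>i<m. d i \<in> \<Omega> \<and> (\<forall>j<m. scalar_product (d i) (A j) = (if i = j then D else 0)))"
proof -
  have inj: "inj_on A {..<m}" and span: "int_vec.span (A ` {..<m}) = \<Omega>" using A by (auto simp: rows_form_basis_def)
  have ex: "\<exists>e. e \<in> \<Omega> \<and> (\<forall>j<m. j \<noteq> i \<longrightarrow> scalar_product e (A j) = 0) \<and> scalar_product e (A i) \<noteq> 0" if i: "i < m" for i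
  proof -
    let ?B = "A ` ({..<m} - {i})"
    obtain c v where c: "c \<noteq> 0" and v: "v \<in> int_vec.span ?B" and perp: "\<And>b. b \<in> ?B \<Longrightarrow> scalar_product b (c *s A i - v) = 0"
      using integer_gram_schmidt[of ?B "A i"] by blast
    define e where "e = c *s A i - v"
    have sub: "int_vec.span ?B \<subseteq> \<Omega>" using int_vec.span_mono[of ?B "A ` {..<m}"] span by auto
    have "A i \<in> \<Omega>" using int_vec.span_base[of "A i" "A ` {..<m}"] span i by auto
    then have e\<Omega>: "e \<in> \<Omega>"
      unfolding e_def using sub v span int_vec.subspace_span[of "A ` {..<m}"]
      by (intro int_vec.subspace_diff int_vec.subspace_scale) auto
    have z: "scalar_product e (A j) = 0" if "j < m" "j \<noteq> i" for j
      using perp[of "A j"] that by (simp add: e_def[symmetric] scalar_product_commute)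
    have "e \<noteq> 0"
    proof
      assume e0: "e = 0"
      obtain u where u: "v = (\<Sum>b\<in>?B. u b *s b)" using v int_vec.span_finite[of ?B] by auto
      have inj': "inj_on A ({..<m} - {i})" using inj by (rule inj_on_subset) auto
      define c' where "c' j = (if j = i then c else - u (A j))" for j
      have "(\<Sum>j<m. c' j *s A j) = c' i *s A i + (\<Sum>j\<in>{..<m} - {i}. c' j *s A j)"
        using i by (intro sum.remove) auto
      also have "(\<Sum>j\<in>{..<m} - {i}. c' j *s A j) = - v"
        unfolding u by (simp add: sum.reindex[OF inj'] c'_def sum_negf[symmetric])
      also have "c' i *s A i + - v = e" by (simp add: c'_def e_def)
      finally have "c' i = 0" using basis_coefficients_zero[OF A _ i] e0 by simp
      with c show False by (simp add: c'_def)
    qed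
    \<comment> \<open>\<open>e\<close> is orthogonal to \<open>v\<close>, so its pairing with
      \<open>c *s A i = e + v\<close> is its own square length, which is not 0.\<close>
    have "scalar_product v e = 0" using perp unfolding e_def by (intro span_perp[OF v])
    then have "c * scalar_product e (A i) = scalar_product e e"
    proof -
      have "scalar_product e e = scalar_product e (c *s A i - v)" by (simp only: e_def)
      also have "\<dots> = c * scalar_product e (A i) - scalar_product v e" by (simp add: scalar_product_commute[of v])
      finally show ?thesis using \<open>scalar_product v e = 0\<close> by simp
    qed
    moreover have "scalar_product e e \<noteq> 0" using \<open>e \<noteq> 0\<close> by (simp add: scalar_product_self)
    ultimately have "scalar_product e (A i) \<noteq> 0" by auto
    with e\<Omega> z show ?thesis by blast
  qed
  then obtain e where e: "\<And>i. i < m \<Longrightarrow> e i \<in> \<Omega>" "\<And>i j. i < m \<Longrightarrow> j < m \<Longrightarrow> j \<noteq> i \<Longrightarrow> scalar_product (e i) (A j) = 0"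
    "\<And>i. i < m \<Longrightarrow> scalar_product (e i) (A i) \<noteq> 0" by metis
  define p where "p i = scalar_product (e i) (A i)" for i
  define D where "D = (\<Prod>i<m. p i)"
  define d where "d i = (\<Prod>j\<in>{..<m} - {i}. p j) *s e i" for i
  have "D \<noteq> 0" using e(3) by (simp add: D_def p_def)
  moreover have "d i \<in> \<Omega>" if "i < m" for i
    unfolding d_def using e(1)[OF that] span int_vec.subspace_span[of "A ` {..<m}"] by (auto intro: int_vec.subspace_scale)
  moreover have "scalar_product (d i) (A j) = (if i = j then D else 0)" if "i < m" "j < m" for i j
  proof (cases "i = j")
    case True
    have "D = p i * (\<Prod>j\<in>{..<m} - {i}. p j)" unfolding D_def using that by (intro prod.remove) auto
    then show ?thesis using True by (simp add: d_def p_def mult.commute)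
  next
    case False
    then show ?thesis using e(2)[of i j] that by (simp add: d_def)
  qed
  ultimately show ?thesis by blast
qed

section \<open>The Mahler measure of the lattice polynomial\<close>

lemma laurent_eval_superset:
  assumes "finite S" "Poly_Mapping.keys P \<subseteq> S"
  shows "laurent_eval P z = (\<Sum>e\<in>S. Poly_Mapping.lookup P e * (\<Prod>i\<in>Poly_Mapping.keys e. z i powi Poly_Mapping.lookup e i))"
  unfolding laurent_eval_def
  by (rule sum.mono_neutral_left[OF assms]) (auto simp: in_keys_iff)

lemma laurent_eval_add: "laurent_eval (P + Q) z = laurent_eval P z + laurent_eval Q z"
proof -
  let ?S = "Poly_Mapping.keys P \<union> Poly_Mapping.keys Q"
  have "laurent_eval R z = (\<Sum>e\<in>?S. Poly_Mapping.lookup R e * (\<Prod>i\<in>Poly_Mapping.keys e. z i powi Poly_Mapping.lookup e i))"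
    if "Poly_Mapping.keys R \<subseteq> ?S" for R
    by (rule laurent_eval_superset[OF _ that]) simp
  from this[of P] this[of Q] this[of "P + Q"] show ?thesis
    using keys_add[of P Q] by (simp add: lookup_add distrib_right sum.distrib)
qed

lemma laurent_eval_0: "laurent_eval 0 z = 0"
  by (simp add: laurent_eval_def)

lemma laurent_eval_sum: "laurent_eval (\<Sum>j\<in>J. P j) z = (\<Sum>j\<in>J. laurent_eval (P j) z)"
  by (induction J rule: infinite_finite_induct) (simp_all add: laurent_eval_0 laurent_eval_add)

lemma laurent_eval_single:
  "laurent_eval (Poly_Mapping.single e 1) z = (\<Prod>i\<in>Poly_Mapping.keys e. z i powi Poly_Mapping.lookup e i)"
  by (simp add: laurent_eval_def)

definition lcol :: "nat \<Rightarrow> (nat \<Rightarrow> int ^ 'n) \<Rightarrow> 'n option \<Rightarrow> nat \<Rightarrow> int" where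
  "lcol m A o' i = (if i < m then case o' of None \<Rightarrow> 0 | Some j \<Rightarrow> A i $ j else 0)"

lemma laurent_eval_lattice_poly:
  "laurent_eval (lattice_poly m A) (\<lambda>i. exp (2 * of_real pi * \<i> * of_real (x i))) = (\<Sum>o'\<in>UNIV. echar m (lcol m A o') x)"
proof -
  let ?z = "\<lambda>i. exp (2 * of_real pi * \<i> * of_real (x i))"
  have z: "?z i = cis (2 * pi * x i)" for i by (simp add: cis_conv_exp mult_ac)
  have mon: "laurent_eval (Poly_Mapping.single (\<Sum>i<m. Poly_Mapping.single i (A i $ j)) 1) ?z = echar m (lcol m A (Some j)) x" for j
  proof -
    let ?e = "\<Sum>i<m. Poly_Mapping.single i (A i $ j)"
    have l: "Poly_Mapping.lookup ?e i = (if i < m then A i $ j else 0)" for i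
    proof -
      have "Poly_Mapping.lookup ?e i = (\<Sum>k<m. if k = i then A k $ j else 0)"
        by (simp add: lookup_sum lookup_single when_def)
      then show ?thesis by simp
    qed
    have k: "Poly_Mapping.keys ?e \<subseteq> {..<m}" by (auto simp: in_keys_iff l split: if_splits)
    have "laurent_eval (Poly_Mapping.single ?e 1) ?z = (\<Prod>i\<in>Poly_Mapping.keys ?e. ?z i powi Poly_Mapping.lookup ?e i)"
      by (rule laurent_eval_single)
    also have "\<dots> = (\<Prod>i<m. ?z i powi Poly_Mapping.lookup ?e i)"
      by (rule prod.mono_neutral_left[OF _ k]) (auto simp: in_keys_iff)
    also have "\<dots> = (\<Prod>i<m. cis (2 * pi * (of_int (A i $ j) * x i)))"
      by (rule prod.cong[OF refl]) (simp only: l z cis_power_int, simp add: mult_ac)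
    also have "\<dots> = cis (\<Sum>i<m. 2 * pi * (of_int (A i $ j) * x i))"
      by (induction m) (simp_all add: cis_mult)
    also have "\<dots> = echar m (lcol m A (Some j)) x"
      by (simp add: echar_def lcol_def sum_distrib_left)
    finally show ?thesis .
  qed
  have one: "laurent_eval 1 ?z = echar m (lcol m A None) x"
  proof -
    have "laurent_eval (Poly_Mapping.single 0 1) ?z = 1" unfolding laurent_eval_single by simp
    then show ?thesis by (simp add: echar_def lcol_def)
  qed
  show ?thesis
    unfolding lattice_poly_def laurent_eval_add laurent_eval_sum mon one
    by (simp add: UNIV_option_conv sum.reindex)
qed

text \<open>Pairing \<open>std_vec\<close> with row \<open>r\<close> reads off entry
  \<open>r\<close> of a column. A combination that vanishes in every row would be orthogonal to the
  span of the rows, which is the whole subgroup.\<close>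

lemma character_sum_lcol:
  fixes \<Omega> :: "(int ^ 'n) set"
  assumes A: "rows_form_basis m A \<Omega>" and m: "m \<ge> 2"
    and cond: "\<And>(\<alpha>::int) (\<beta>::int) (i::'n option) j k l.
           (\<alpha>, \<beta>) \<noteq> (0, 0) \<Longrightarrow> distinct [i, j, k, l] \<Longrightarrow>
           \<not> \<Omega> \<subseteq> orth (range (\<lambda>c. c *s (\<alpha> *s (std_vec i - std_vec j) + \<beta> *s (std_vec k - std_vec l))))"
  shows "character_sum m (lcol m A)"
proof
  show "lcol m A j i = 0" if "i \<ge> m" for j i using that by (simp add: lcol_def)
next
  fix i j k l :: "'n option" and \<alpha> \<beta> :: int
  assume d: "distinct [i, j, k, l]" and ab: "(\<alpha>, \<beta>) \<noteq> (0, 0)"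
  define v where "v = \<alpha> *s (std_vec i - std_vec j) + \<beta> *s (std_vec k - std_vec l)"
  obtain \<omega> c where \<omega>: "\<omega> \<in> \<Omega>" "scalar_product \<omega> (c *s v) \<noteq> 0"
    using cond[OF ab d] unfolding v_def[symmetric] orth_def by blast
  then have nz: "scalar_product v \<omega> \<noteq> 0" by (auto simp: scalar_product_commute[of v])
  obtain u where u: "\<omega> = (\<Sum>i<m. u i *s A i)" using basis_span[OF A \<omega>(1)] by blast
  have "scalar_product \<omega> v = (\<Sum>i<m. u i * scalar_product (A i) v)" unfolding u by (simp add: scalar_product_sum)
  then have "(\<Sum>i<m. u i * scalar_product (A i) v) \<noteq> 0" using nz by (simp add: scalar_product_commute[of v])
  then obtain r where r: "r < m" "scalar_product (A r) v \<noteq> 0"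
    by (metis (no_types, lifting) lessThan_iff mult_zero_right sum.neutral)
  have sv: "scalar_product (std_vec o') (A r) = lcol m A o' r" for o'
    using r(1) by (cases o') (simp_all add: lcol_def scalar_product_def axis_def if_distrib if_distribR cong: if_cong)
  have "scalar_product v (A r) = \<alpha> * (lcol m A i r - lcol m A j r) + \<beta> * (lcol m A k r - lcol m A l r)"
    by (simp add: v_def sv right_diff_distrib)
  then show "\<exists>r<m. \<alpha> * (lcol m A i r - lcol m A j r) + \<beta> * (lcol m A k r - lcol m A l r) \<noteq> 0"
    using r by (auto simp: scalar_product_commute[of v])
next
  have m01: "0 < m" "1 < m" using m by simp_all
  \<comment> \<open>Two independent rows have a non-zero minor. Its two columns together with the
    zero column are the three exponents required by \<open>indep3\<close>.\<close>
  have "\<exists>i j. A 0 $ i * A 1 $ j \<noteq> A 0 $ j * A 1 $ i"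
  proof (rule ccontr)
    assume "\<not> ?thesis"
    then have eq: "A 0 $ i * A 1 $ j = A 0 $ j * A 1 $ i" for i j by blast
    have A0: "\<exists>i. A 0 $ i \<noteq> 0"
    proof (rule ccontr)
      assume "\<not> ?thesis"
      then have "A 0 = 0" by (simp add: vec_eq_iff)
      then have "(\<Sum>i<m. (if i = 0 then 1 else 0) *s A i) = 0"
        by (intro sum.neutral) auto
      from basis_coefficients_zero[OF A this m01(1)] show False by simp
    qed
    then obtain i where i: "A 0 $ i \<noteq> 0" by blast
    define c where "c k = (if k = 0 then - (A 1 $ i) else if k = 1 then A 0 $ i else 0)" for k :: nat
    have "(\<Sum>k<m. c k *s A k) = (\<Sum>k\<in>{0, 1}. c k *s A k)"
      by (rule sum.mono_neutral_right) (use m01 in \<open>auto simp: c_def\<close>)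
    also have "\<dots> = 0" using eq by (simp add: c_def vec_eq_iff mult.commute)
    finally have "c 1 = 0" using basis_coefficients_zero[OF A _ m01(2)] by blast
    with i show False by (simp add: c_def)
  qed
  then obtain i j where ij: "A 0 $ i * A 1 $ j \<noteq> A 0 $ j * A 1 $ i" by blast
  have "\<exists>r<m. \<alpha> * (lcol m A (Some i) r - lcol m A None r) + \<beta> * (lcol m A (Some j) r - lcol m A None r) \<noteq> 0"
    if ab: "(\<alpha>, \<beta>) \<noteq> (0, 0)" for \<alpha> \<beta>
  proof (rule ccontr)
    assume "\<not> ?thesis"
    then have e: "\<alpha> * A 0 $ i + \<beta> * A 0 $ j = 0" "\<alpha> * A 1 $ i + \<beta> * A 1 $ j = 0"
      using m01 by (auto simp: lcol_def)
    have "\<alpha> * (A 0 $ i * A 1 $ j - A 0 $ j * A 1 $ i) = (\<alpha> * A 0 $ i + \<beta> * A 0 $ j) * A 1 $ j - (\<alpha> * A 1 $ i + \<beta> * A 1 $ j) * A 0 $ j"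
      by (simp add: algebra_simps)
    then have "\<alpha> = 0" using e ij by simp
    have "\<beta> * (A 0 $ i * A 1 $ j - A 0 $ j * A 1 $ i) = (\<alpha> * A 1 $ i + \<beta> * A 1 $ j) * A 0 $ i - (\<alpha> * A 0 $ i + \<beta> * A 0 $ j) * A 1 $ i"
      by (simp add: algebra_simps)
    then have "\<beta> = 0" using e ij by simp
    with \<open>\<alpha> = 0\<close> ab show False by simp
  qed
  then show "\<exists>i j k. \<forall>\<alpha> \<beta>. (\<alpha>, \<beta>) \<noteq> (0, 0) \<longrightarrow>
        (\<exists>r<m. \<alpha> * (lcol m A i r - lcol m A k r) + \<beta> * (lcol m A j r - lcol m A k r) \<noteq> 0)" by blast
qed

lemma sup_norm_le:
  fixes v :: "int ^ 'n"
  assumes "\<And>i. \<bar>real_of_int (v $ i)\<bar> \<le> b" shows "sup_norm v \<le> b"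
  unfolding sup_norm_def infnorm_cart by (rule cSup_least) (use assms in auto)

lemma Delta_eq:
  fixes A :: "nat \<Rightarrow> int ^ 'n"
  assumes "p > 0" and a: "a = (\<Sum>i<m. u i *s A i)"
  shows "Delta p a = (\<Prod>t\<in>{1..<p}. cmod (\<Sum>o'\<in>UNIV. echar m (lcol m A o') (orb p u t)))"
proof -
  have "exp (2 * of_real pi * \<i> / of_nat p) = cis (2 * pi / real p)" by (simp add: cis_conv_exp mult_ac)
  then have z: "exp (2 * of_real pi * \<i> / of_nat p) powi k = cis (2 * pi * of_int k / real p)" for k
    by (simp add: cis_power_int mult_ac)
  have e: "echar m (lcol m A (Some j)) (orb p u t) = cis (2 * pi * of_int (int t * a $ j) / real p)" for j t
    by (simp add: echar_def orb_def lcol_def a sum_distrib_left sum_divide_distrib mult_ac)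
  have n: "echar m (lcol m A None) \<theta> = 1" for \<theta> by (simp add: echar_def lcol_def)
  show ?thesis
    unfolding Delta_def Let_def z UNIV_option_conv
    by (simp add: sum.reindex n e)
qed

theorem theorem8p2:
  fixes \<Omega> :: "(int ^ 'n) set"
  assumes "CARD('n) \<ge> 2"
    and "int_vec.subspace \<Omega>"
    and "subgroup_rank \<Omega> \<ge> 2"
    and "\<And>(\<alpha>::int) (\<beta>::int) (i::'n option) j k l.
           (\<alpha>, \<beta>) \<noteq> (0, 0) \<Longrightarrow> distinct [i, j, k, l] \<Longrightarrow>
           \<not> \<Omega> \<subseteq> orth (range (\<lambda>c. c *s (\<alpha> *s (std_vec i - std_vec j) + \<beta> *s (std_vec k - std_vec l))))"
  shows "\<exists>R::real. \<forall>\<epsilon>::real. \<epsilon> > 0 \<longrightarrow>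
           (\<exists>C::real. \<forall>a\<in>\<Omega>. \<forall>p::nat. prime p \<and> rho p a \<Omega> \<ge> R \<longrightarrow>
              Delta p a \<noteq> 0 \<and>
              \<bar>1 / (real p - 1) * ln (Delta p a) - lattice_mahler \<Omega>\<bar>
                \<le> C * rho p a \<Omega> powr (- (1 / (4 * real CARD('n))) + \<epsilon>))"
proof -
  define m where "m = subgroup_rank \<Omega>"
  define A where "A = (SOME A. rows_form_basis m A \<Omega>)"
  have A: "rows_form_basis m A \<Omega>"
    unfolding A_def m_def by (rule someI_ex[OF subgroup_rank_basis[OF assms(2)]])
  have m2: "m \<ge> 2" using assms(3) by (simp add: m_def)
  interpret cs: character_sum m "lcol m A"
    by (rule character_sum_lcol[OF A m2 assms(4)])
  have mahler: "lattice_mahler \<Omega> = (\<integral>\<theta>. ln (cmod (cs.csum \<theta>)) \<partial>torus m)"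
    unfolding lattice_mahler_def Let_def m_def[symmetric] A_def[symmetric] mahler_measure_def
      laurent_eval_lattice_poly integral_torus cs.csum_def ..
  have nn: "real cs.nn = real CARD('n)" by (simp add: cs.nn_def card_UNIV_option)
  obtain C R0 where main: "\<And>p u \<rho>. prime p \<Longrightarrow> \<rho> \<ge> R0 \<Longrightarrow>
     (\<forall>y. (\<exists>i<m. y i \<noteq> 0) \<longrightarrow> (\<forall>i<m. \<bar>real_of_int (y i)\<bar> < \<rho>) \<longrightarrow> \<not> int p dvd ipr m y u) \<Longrightarrow>
     (\<forall>t\<in>{1..<p}. cs.csum (orb p u t) \<noteq> 0) \<and>
     \<bar>1 / (real p - 1) * (\<Sum>t\<in>{1..<p}. ln (cmod (cs.csum (orb p u t)))) - lattice_mahler \<Omega>\<bar>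
       \<le> C * \<rho> powr (- (1 / (4 * real CARD('n))))"
    using cs.orbit_log_mean unfolding mahler[symmetric] nn by blast
  obtain d :: "nat \<Rightarrow> int ^ 'n" and D where D: "D \<noteq> 0" and d: "\<And>i. i < m \<Longrightarrow> d i \<in> \<Omega>"
    "\<And>i j. i < m \<Longrightarrow> j < m \<Longrightarrow> scalar_product (d i) (A j) = (if i = j then D else 0)"
    using dual_vectors[OF A] by blast
  \<comment> \<open>\<open>K - 1\<close> bounds the growth of the norm from \<open>y\<close> to the
    corresponding element of the subgroup; the extra 1 makes the final comparison with the infimum
    strict.\<close>
  define K where "K = 1 + (\<Sum>i<m. \<Sum>l\<in>UNIV. \<bar>real_of_int (d i $ l)\<bar>)"
  have K: "K \<ge> 1" by (simp add: K_def sum_nonneg)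
  \<comment> \<open>The factor \<open>K\<close> carries the threshold \<open>R0\<close> over to
    \<open>rho / K\<close>; the value 1 ensures that adding \<open>\<epsilon>\<close> to the
    exponent can only enlarge the bound.\<close>
  define R where "R = max 1 (K * max R0 1)"
  define C' where "C' = \<bar>C\<bar> * K powr (1 / (4 * real CARD('n)))"
  have bound: "Delta p a \<noteq> 0 \<and> \<bar>1 / (real p - 1) * ln (Delta p a) - lattice_mahler \<Omega>\<bar>
                \<le> C' * rho p a \<Omega> powr (- (1 / (4 * real CARD('n))))"
    if a: "a \<in> \<Omega>" and p: "prime p" and R: "rho p a \<Omega> \<ge> R" for a p
  proof -
    have p0: "p > 0" using p by (rule prime_gt_0_nat)
    obtain u where u: "a = (\<Sum>i<m. u i *s A i)" using basis_span[OF A a] by blast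
    define \<rho> where "\<rho> = rho p a \<Omega> / K"
    have "K * max R0 1 \<le> rho p a \<Omega>" using R by (simp add: R_def)
    then have \<rho>: "\<rho> \<ge> max R0 1" using K by (simp add: \<rho>_def le_divide_eq mult.commute)
    have no: "\<not> int p dvd ipr m y u" if y: "\<exists>i<m. y i \<noteq> 0" "\<And>i. i < m \<Longrightarrow> \<bar>real_of_int (y i)\<bar> < \<rho>" for y
    proof
      assume dvd: "int p dvd ipr m y u"
      \<comment> \<open>A small \<open>y\<close> annihilating \<open>u\<close> modulo
        \<open>p\<close> would give an element of the subgroup whose pairing with \<open>a\<close>
        is \<open>D\<close> times \<open>ipr m y u\<close>, and whose norm lies below the infimum
        defining \<open>rho\<close>.\<close>
      define \<omega> where "\<omega> = (\<Sum>i<m. y i *s d i)"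
      have sA: "scalar_product \<omega> (A j) = y j * D" if "j < m" for j
      proof -
        have "scalar_product \<omega> (A j) = (\<Sum>i<m. if i = j then y i * D else 0)"
          unfolding \<omega>_def scalar_product_sum using that by (intro sum.cong) (simp_all add: d(2))
        then show ?thesis using that by simp
      qed
      have "\<omega> \<in> \<Omega>" unfolding \<omega>_def
        by (intro int_vec.subspace_sum[OF assms(2)] int_vec.subspace_scale[OF assms(2)] d(1)) simp
      moreover have "\<omega> \<noteq> 0"
      proof
        assume "\<omega> = 0"
        moreover obtain i where "i < m" "y i \<noteq> 0" using y(1) by blast
        ultimately show False using sA[of i] D by simp
      qed
      moreover have "int p dvd scalar_product \<omega> a"
      proof -
        have "scalar_product \<omega> a = scalar_product a \<omega>" by (rule scalar_product_commute)
        also have "\<dots> = (\<Sum>i<m. u i * scalar_product (A i) \<omega>)" unfolding u by (simp add: scalar_product_sum)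
        also have "\<dots> = (\<Sum>i<m. u i * (y i * D))"
          using sA by (intro sum.cong) (simp_all add: scalar_product_commute[of _ \<omega>])
        also have "\<dots> = D * ipr m y u" by (simp add: ipr_def sum_distrib_left mult_ac)
        finally show ?thesis using dvd by simp
      qed
      ultimately have "sup_norm \<omega> \<in> {sup_norm \<omega> |\<omega>. \<omega> \<in> \<Omega> - {0} \<and> int p dvd scalar_product \<omega> a}" by blast
      moreover have "bdd_below {sup_norm \<omega> |\<omega>. \<omega> \<in> \<Omega> - {0} \<and> int p dvd scalar_product \<omega> a}"
        by (rule bdd_belowI[of _ 0]) (auto simp: sup_norm_def infnorm_pos_le)
      ultimately have "rho p a \<Omega> \<le> sup_norm \<omega>" unfolding rho_def by (rule cInf_lower)
      also have "\<dots> \<le> (K - 1) * \<rho>"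
      proof (rule sup_norm_le)
        fix l
        have "\<bar>real_of_int (\<omega> $ l)\<bar> = \<bar>\<Sum>i<m. real_of_int (y i) * real_of_int (d i $ l)\<bar>" by (simp add: \<omega>_def)
        also have "\<dots> \<le> (\<Sum>i<m. \<bar>real_of_int (y i) * real_of_int (d i $ l)\<bar>)" by (rule sum_abs)
        also have "\<dots> \<le> (\<Sum>i<m. \<rho> * (\<Sum>l\<in>UNIV. \<bar>real_of_int (d i $ l)\<bar>))"
        proof (rule sum_mono)
          fix i assume "i \<in> {..<m}"
          then have "\<bar>real_of_int (y i)\<bar> \<le> \<rho>" using y(2)[of i] by simp
          moreover have "\<bar>real_of_int (d i $ l)\<bar> \<le> (\<Sum>l\<in>UNIV. \<bar>real_of_int (d i $ l)\<bar>)" by (rule member_le_sum) auto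
          ultimately show "\<bar>real_of_int (y i) * real_of_int (d i $ l)\<bar> \<le> \<rho> * (\<Sum>l\<in>UNIV. \<bar>real_of_int (d i $ l)\<bar>)"
            unfolding abs_mult using \<rho> by (intro mult_mono) auto
        qed
        also have "\<dots> = (K - 1) * \<rho>" by (simp add: K_def sum_distrib_left[symmetric] mult.commute)
        finally show "\<bar>real_of_int (\<omega> $ l)\<bar> \<le> (K - 1) * \<rho>" .
      qed
      also have "\<dots> < K * \<rho>" using \<rho> by (simp add: algebra_simps)
      also have "\<dots> = rho p a \<Omega>" using K by (simp add: \<rho>_def)
      finally show False by simp
    qed
    have res: "(\<forall>t\<in>{1..<p}. cs.csum (orb p u t) \<noteq> 0) \<and>
       \<bar>1 / (real p - 1) * (\<Sum>t\<in>{1..<p}. ln (cmod (cs.csum (orb p u t)))) - lattice_mahler \<Omega>\<bar>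
       \<le> C * \<rho> powr (- (1 / (4 * real CARD('n))))"
      by (rule main[OF p]) (use \<rho> no in auto)
    have \<Delta>: "Delta p a = (\<Prod>t\<in>{1..<p}. cmod (cs.csum (orb p u t)))"
      unfolding cs.csum_def by (rule Delta_eq[OF p0 u])
    have "ln (Delta p a) = (\<Sum>t\<in>{1..<p}. ln (cmod (cs.csum (orb p u t))))"
      unfolding \<Delta> by (rule ln_prod) (use res in auto)
    moreover have "Delta p a \<noteq> 0" unfolding \<Delta> using res by simp
    moreover have "C * \<rho> powr (- (1 / (4 * real CARD('n)))) \<le> C' * rho p a \<Omega> powr (- (1 / (4 * real CARD('n))))"
    proof -
      have "\<rho> powr (- (1 / (4 * real CARD('n)))) = rho p a \<Omega> powr (- (1 / (4 * real CARD('n)))) / K powr (- (1 / (4 * real CARD('n))))"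
        unfolding \<rho>_def by (rule powr_divide)
      also have "\<dots> = K powr (1 / (4 * real CARD('n))) * rho p a \<Omega> powr (- (1 / (4 * real CARD('n))))"
        by (simp add: powr_minus_divide)
      finally show ?thesis
        by (simp add: C'_def mult.assoc) (intro mult_right_mono; simp)
    qed
    ultimately show ?thesis using res by simp
  qed
  have "\<exists>C. \<forall>a\<in>\<Omega>. \<forall>p. prime p \<and> rho p a \<Omega> \<ge> R \<longrightarrow>
              Delta p a \<noteq> 0 \<and>
              \<bar>1 / (real p - 1) * ln (Delta p a) - lattice_mahler \<Omega>\<bar>
                \<le> C * rho p a \<Omega> powr (- (1 / (4 * real CARD('n))) + \<epsilon>)" if "\<epsilon> > 0" for \<epsilon> :: real
  proof (intro exI[of _ C'] ballI allI impI)
    fix a p assume a: "a \<in> \<Omega>" and pr: "prime p \<and> rho p a \<Omega> \<ge> R"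
    have "rho p a \<Omega> \<ge> 1" using pr by (simp add: R_def)
    then have "C' * rho p a \<Omega> powr (- (1 / (4 * real CARD('n)))) \<le> C' * rho p a \<Omega> powr (- (1 / (4 * real CARD('n))) + \<epsilon>)"
      using that by (intro mult_left_mono powr_mono) (auto simp: C'_def)
    with bound[OF a conjunct1[OF pr] conjunct2[OF pr]] show "Delta p a \<noteq> 0 \<and>
              \<bar>1 / (real p - 1) * ln (Delta p a) - lattice_mahler \<Omega>\<bar>
                \<le> C' * rho p a \<Omega> powr (- (1 / (4 * real CARD('n))) + \<epsilon>)" by linarith
  qed
  then show ?thesis by blast
qed

end
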